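(* Let $\mathsf{M}$ be a loopless matroid on a finite nonempty set $E$ of size $n$, and let $\omega_{\mathsf{M}}\in\mathrm{PLaur}(\Sigma_E)$ be given by $(\omega_{\mathsf{M}})_\sigma=\frac{x_{\sigma(n)}}{x_{\sigma(1)}}\prod_{i\in E\setminus B_{\mathsf{M}}(\sigma)}x_i^{-1}$ for $\sigma\in S_E$. Then for any $f\in\mathrm{PLaur}(\Sigma_E)$, $$\chi_{\mathsf{M}}(\varphi_{\mathsf{M}}(f^\vee))=(-1)^{\mathrm{rk}(\mathsf{M})-1}\,\chi_{\mathsf{M}}\big(\varphi_{\mathsf{M}}(f)\cdot\varphi_{\mathsf{M}}(\omega_{\mathsf{M}})\big).$$
   Context: Braid fan and piecewise functions. Let $|E|=n$, let $S_E$ be the set of bijections $\sigma:[n]\to E$, and $\tau_i\in S_n$ the transposition swapping $i,i+1$. For $T\subseteq E$ let $e_T=\sum_{i\in T}e_i\in\mathbb{R}^E$. The braid fan $\Sigma_E$ is the fan in $\mathbb{R}^E$ cut out by the hyperplanes $b_i=b_j$; its maximal cones are $\widetilde C_\sigma=\{b\in\mathbb{R}^E:b_{\sigma(1)}\ge\dots\ge b_{\sigma(n)}\}$, $\sigma\in S_E$. An integral linear function is a linear function $\mathbb{R}^E\to\mathbb{R}$ sending $\mathbb{Z}^E$ to $\mathbb{Z}$. $\mathrm{PLin}(\Sigma_E)$ is the additive group of functions $\mathbb{R}^E\to\mathbb{R}$ whose restriction to each cone of $\Sigma_E$ is the restriction of an integral linear function. It is freely generated by $\{\delta_T:\emptyset\ne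 T\subseteq E\}$, where $\delta_T(e_T)=1$ and $\delta_T(e_{S})=0$ for nonempty $S\ne T$. $\mathrm{PLaur}(\Sigma_E)$ is the ring (componentwise operations) of collections $f=\{f_\sigma:\sigma\in S_E\}$, $f_\sigma\in\mathbb{Z}[x_e^{\pm1}:e\in E]$, such that for all $\sigma\in S_E$, $i\in[n-1]$, $f_\sigma-f_{\sigma\circ\tau_i}$ is divisible by $x_{\sigma(i)}-x_{\sigma(i+1)}$ in $\mathbb{Z}[x_e^{\pm1}:e\in E]$. The ring homomorphism $(-)^\vee:\mathrm{PLaur}(\Sigma_E)\to\mathrm{PLaur}(\Sigma_E)$ inverts all variables: $x_i\mapsto x_i^{-1}$. For a matroid $\mathsf{M}$ on $E$ with rank function $\mathrm{rk}_{\mathsf{M}}$ and $\mathrm{rk}(\mathsf{M})=\mathrm{rk}_{\mathsf{M}}(E)$, the greedy basis is $B_{\mathsf{M}}(\sigma)=\{\sigma(i): \mathrm{rk}_{\mathsf{M}}\{\sigma(1),\dots,\sigma(i)\}>\mathrm{rk}_{\mathsf{M}}\{\sigma(1),\dots,\sigma(i-1)\}\}$. The ring $K(\mathsf{M})$. A flat of $\mathsf{M}$ is a subset $F\subseteq E$ with $\mathrm{rk}_{\mathsf{M}}(F)<\mathrm{rk}_{\mathsf{M}}(F\cup\{i\})$ for all $i\in E\setminus F$. $\Sigma_{\mathsf{M}}$ is the fan in $\mathbb{R}^E$ of cones $\mathbb{R}_{\ge0}(e_{F_1},\dots,e_{F_k})$ for chains $\emptyset\subsetneq F_1\subsetneq\dots\subsetneq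 F_k\subseteq E$ of nonempty flats, and $|\Sigma_{\mathsf{M}}|$ is its support. $\mathrm{Lin}(\Sigma_{\mathsf{M}})$ is the group of restrictions to $|\Sigma_{\mathsf{M}}|$ of integral linear functions on $\mathbb{R}^E$. $\mathrm{PExp}(\Sigma_{\mathsf{M}})$ is the ring of functions $f:|\Sigma_{\mathsf{M}}|\to\mathbb{R}$ such that for each cone $C\in\Sigma_{\mathsf{M}}$, $f|_C=(a_1e^{m_1}+\dots+a_ke^{m_k})|_C$ for some $a_j\in\mathbb{Z}$ and integral linear functions $m_j$. The $K$-ring of $\mathsf{M}$ is $$K(\mathsf{M})=\mathrm{PExp}(\Sigma_{\mathsf{M}})/\langle e^f-1: f\in\mathrm{Lin}(\Sigma_{\mathsf{M}})\rangle.$$ Maps. $\varphi_{\mathsf{M}}:\mathrm{PLaur}(\Sigma_E)\to K(\mathsf{M})$ is the surjective ring homomorphism which replaces each monomial $x^m$ by the exponential function $e^m$ (so $f$ becomes the function on $\mathbb{R}^E$ given on $\widetilde C_\sigma$ by $f_\sigma$ with $x_i=e^{b_i}$ at the point $b$), restricts the resulting function to $|\Sigma_{\mathsf{M}}|$, and takes its class in $K(\mathsf{M})$. $\psi_{\mathsf{M}}:\mathrm{PLin}(\Sigma_E)\to K(\mathsf{M})$ is $f\mapsto[e^f|_{|\Sigma_{\mathsf{M}}|}]$. Restriction and contraction. For $f=\sum_{\emptyset\ne T\subseteq E}a_T\delta_T\in\mathrm{PLin}(\Sigma_E)$ and a nonempty proper subset $F\subset E$ with $F^c=E\setminus F$,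 put $$f|F=\sum_{\emptyset\ne T\subseteq F}a_T\delta_T\in\mathrm{PLin}(\Sigma_F),\qquad f/F=\sum_{\emptyset\ne T\subseteq F^c}(a_{F\cup T}-a_F)\delta_T\in\mathrm{PLin}(\Sigma_{F^c}).$$ $\mathsf{M}|F$ and $\mathsf{M}/F$ are the matroid restriction (on $F$) and contraction (on $F^c$). Euler characteristics. The matroid Euler characteristics of Larson, Li, Payne, and Proudfoot are characterized as the unique collection of additive functions $\{\chi_{\mathsf{M}}:K(\mathsf{M})\to\mathbb{Z}\}$, indexed by loopless matroids $\mathsf{M}$ on finite nonempty sets $E$, such that each $\chi_{\mathsf{M}}^*=\chi_{\mathsf{M}}\circ\psi_{\mathsf{M}}$ satisfies $\chi_{\mathsf{M}}^*(0)=1$ and, for every nonempty proper flat $F$ of $\mathsf{M}$ and every $f\in\mathrm{PLin}(\Sigma_E)$, $\chi_{\mathsf{M}}^*(f)=\chi_{\mathsf{M}}^*(f-\delta_F)+\chi_{\mathsf{M}|F}^*(f|F)\,\chi_{\mathsf{M}/F}^*(f/F)$. *)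

theory Defs
  imports
    Complex_Main
    "HOL-Library.FuncSet"
    "HOL-Library.Indicator_Function"
    "HOL-Library.Poly_Mapping"
    "HOL-Combinatorics.Transposition"
    "HOL-Algebra.QuotRing"
begin

section \<open>Matroids\<close>

text \<open>A matroid is given by its ground set and its rank function. The rank function is
  undefined off the subsets of the ground set, so that equality of records is equality of
  matroids.\<close>

record 'a matroid =
  ground :: "'a set"
  rk :: "'a set \<Rightarrow> nat"

definition is_matroid :: "'a matroid \<Rightarrow> bool" where
  "is_matroid M \<longleftrightarrow>
     finite (ground M) \<and>
     rk M \<in> extensional (Pow (ground M)) \<and>
     (\<forall>A. A \<subseteq> ground M \<longrightarrow> rk M A \<le> card A) \<and>
     (\<forall>A B. A \<subseteq> B \<longrightarrow> B \<subseteq> ground M \<longrightarrow> rk M A \<le> rk M B) \<and>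
     (\<forall>A B. A \<subseteq> ground M \<longrightarrow> B \<subseteq> ground M \<longrightarrow>
        rk M (A \<union> B) + rk M (A \<inter> B) \<le> rk M A + rk M B)"

definition loopless :: "'a matroid \<Rightarrow> bool" where
  "loopless M \<longleftrightarrow> (\<forall>i\<in>ground M. rk M {i} > 0)"

definition is_flat :: "'a matroid \<Rightarrow> 'a set \<Rightarrow> bool" where
  "is_flat M F \<longleftrightarrow> F \<subseteq> ground M \<and> (\<forall>i\<in>ground M - F. rk M F < rk M (F \<union> {i}))"

definition matroid_restrict :: "'a matroid \<Rightarrow> 'a set \<Rightarrow> 'a matroid" where
  "matroid_restrict M F = \<lparr>ground = F, rk = restrict (rk M) (Pow F)\<rparr>"

definition matroid_contract :: "'a matroid \<Rightarrow> 'a set \<Rightarrow> 'a matroid" where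
  "matroid_contract M F =
     \<lparr>ground = ground M - F, rk = (\<lambda>A\<in>Pow (ground M - F). rk M (A \<union> F) - rk M F)\<rparr>"

section \<open>The braid fan\<close>

text \<open>$\mathbb{R}^E$ is realised as the functions vanishing off \<open>E\<close>, so that
  $e_T$ is the indicator function of \<open>T\<close>.\<close>

definition RE :: "'a set \<Rightarrow> ('a \<Rightarrow> real) set" where
  "RE E = {b. \<forall>i. i \<notin> E \<longrightarrow> b i = 0}"

definition ZE :: "'a set \<Rightarrow> ('a \<Rightarrow> real) set" where
  "ZE E = {b \<in> RE E. \<forall>i\<in>E. b i \<in> \<int>}"

definition orderings :: "'a set \<Rightarrow> (nat \<Rightarrow> 'a) set" where
  "orderings E = {\<sigma> \<in> extensional {1..card E}. bij_betw \<sigma> {1..card E} E}"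

definition max_cone :: "'a set \<Rightarrow> (nat \<Rightarrow> 'a) \<Rightarrow> ('a \<Rightarrow> real) set" where
  "max_cone E \<sigma> = {b \<in> RE E. \<forall>i\<in>{1..<card E}. b (\<sigma> i) \<ge> b (\<sigma> (i + 1))}"

text \<open>The cones of the braid fan are the faces of the maximal cones, a face being cut out by
  turning some of the defining inequalities into equalities.\<close>

definition braid_fan :: "'a set \<Rightarrow> ('a \<Rightarrow> real) set set" where
  "braid_fan E = {{b \<in> max_cone E \<sigma>. \<forall>i\<in>J. b (\<sigma> i) = b (\<sigma> (i + 1))} | \<sigma> J.
     \<sigma> \<in> orderings E \<and> J \<subseteq> {1..<card E}}"

definition integral_linear :: "'a set \<Rightarrow> (('a \<Rightarrow> real) \<Rightarrow> real) \<Rightarrow> bool" where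
  "integral_linear E m \<longleftrightarrow>
     (\<forall>b\<in>RE E. \<forall>c\<in>RE E. m (\<lambda>i. b i + c i) = m b + m c) \<and>
     (\<forall>t. \<forall>b\<in>RE E. m (\<lambda>i. t * b i) = t * m b) \<and>
     (\<forall>b\<in>ZE E. m b \<in> \<int>)"

definition PLin :: "'a set \<Rightarrow> (('a \<Rightarrow> real) \<Rightarrow> real) set" where
  "PLin E = {f \<in> extensional (RE E).
     \<forall>C\<in>braid_fan E. \<exists>m. integral_linear E m \<and> (\<forall>b\<in>C. f b = m b)}"

definition delta :: "'a set \<Rightarrow> 'a set \<Rightarrow> ('a \<Rightarrow> real) \<Rightarrow> real" where
  "delta E T = (THE f. f \<in> PLin E \<and> f (indicator T) = 1 \<and>
     (\<forall>S. S \<noteq> {} \<longrightarrow> S \<subseteq> E \<longrightarrow> S \<noteq> T \<longrightarrow> f (indicator S) = 0))"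

definition delta_comb :: "'a set \<Rightarrow> ('a set \<Rightarrow> int) \<Rightarrow> ('a \<Rightarrow> real) \<Rightarrow> real" where
  "delta_comb E a = (\<lambda>b\<in>RE E. \<Sum>T\<in>Pow E - {{}}. of_int (a T) * delta E T b)"

text \<open>The coordinates of a piecewise linear function in the basis formed by the
  \<open>delta E T\<close>.\<close>

definition delta_coeff :: "'a set \<Rightarrow> (('a \<Rightarrow> real) \<Rightarrow> real) \<Rightarrow> 'a set \<Rightarrow> int" where
  "delta_coeff E f = (THE a. a \<in> extensional (Pow E - {{}}) \<and> f = delta_comb E a)"

definition plin_restrict ::
    "'a set \<Rightarrow> (('a \<Rightarrow> real) \<Rightarrow> real) \<Rightarrow> 'a set \<Rightarrow> ('a \<Rightarrow> real) \<Rightarrow> real" where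
  "plin_restrict E f F = delta_comb F (delta_coeff E f)"

definition plin_contract ::
    "'a set \<Rightarrow> (('a \<Rightarrow> real) \<Rightarrow> real) \<Rightarrow> 'a set \<Rightarrow> ('a \<Rightarrow> real) \<Rightarrow> real" where
  "plin_contract E f F =
     delta_comb (E - F) (\<lambda>T. delta_coeff E f (F \<union> T) - delta_coeff E f F)"

section \<open>Piecewise Laurent polynomials\<close>

text \<open>An exponent vector is a finitely supported integer-valued function, and a Laurent
  polynomial is a finitely supported function from exponent vectors to the integers, multiplied
  by convolution.\<close>

type_synonym 'a laurent = "('a \<Rightarrow>\<^sub>0 int) \<Rightarrow>\<^sub>0 int"

definition laurent :: "'a set \<Rightarrow> 'a laurent set" where
  "laurent E = {p. \<forall>m\<in>Poly_Mapping.keys p. Poly_Mapping.keys m \<subseteq> E}"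

definition xpow :: "'a \<Rightarrow> int \<Rightarrow> 'a laurent" where
  "xpow i k = Poly_Mapping.single (Poly_Mapping.single i k) 1"

definition laurent_dvd :: "'a set \<Rightarrow> 'a laurent \<Rightarrow> 'a laurent \<Rightarrow> bool" where
  "laurent_dvd E p q \<longleftrightarrow> (\<exists>r\<in>laurent E. q = p * r)"

definition PLaur :: "'a set \<Rightarrow> ((nat \<Rightarrow> 'a) \<Rightarrow> 'a laurent) set" where
  "PLaur E = {f \<in> orderings E \<rightarrow>\<^sub>E laurent E.
     \<forall>\<sigma>\<in>orderings E. \<forall>i\<in>{1..<card E}.
       laurent_dvd E (xpow (\<sigma> i) 1 - xpow (\<sigma> (i + 1)) 1)
         (f \<sigma> - f (\<sigma> \<circ> transpose i (i + 1)))}"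

definition plaur_dual ::
    "'a set \<Rightarrow> ((nat \<Rightarrow> 'a) \<Rightarrow> 'a laurent) \<Rightarrow> (nat \<Rightarrow> 'a) \<Rightarrow> 'a laurent" where
  "plaur_dual E f = (\<lambda>\<sigma>\<in>orderings E. Poly_Mapping.map_key uminus (f \<sigma>))"

definition laurent_exp :: "'a laurent \<Rightarrow> ('a \<Rightarrow> real) \<Rightarrow> real" where
  "laurent_exp p b = (\<Sum>m\<in>Poly_Mapping.keys p. of_int (Poly_Mapping.lookup p m) *
     exp (\<Sum>i\<in>Poly_Mapping.keys m. of_int (Poly_Mapping.lookup m i) * b i))"

text \<open>The divisibility conditions make the values prescribed on the different maximal cones
  through a point agree.\<close>

definition plaur_exp ::
    "'a set \<Rightarrow> ((nat \<Rightarrow> 'a) \<Rightarrow> 'a laurent) \<Rightarrow> ('a \<Rightarrow> real) \<Rightarrow> real" where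
  "plaur_exp E f b =
     (THE v. \<forall>\<sigma>\<in>orderings E. b \<in> max_cone E \<sigma> \<longrightarrow> v = laurent_exp (f \<sigma>) b)"

definition greedy_basis :: "'a matroid \<Rightarrow> (nat \<Rightarrow> 'a) \<Rightarrow> 'a set" where
  "greedy_basis M \<sigma> =
     {\<sigma> i | i. i \<in> {1..card (ground M)} \<and> rk M (\<sigma> ` {1..i}) > rk M (\<sigma> ` {1..i - 1})}"

definition omega :: "'a matroid \<Rightarrow> (nat \<Rightarrow> 'a) \<Rightarrow> 'a laurent" where
  "omega M = (\<lambda>\<sigma>\<in>orderings (ground M).
     xpow (\<sigma> (card (ground M))) 1 * xpow (\<sigma> 1) (-1) *
     (\<Prod>i\<in>ground M - greedy_basis M \<sigma>. xpow i (-1)))"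

section \<open>The K-ring of a matroid\<close>

definition ray_cone :: "'a set set \<Rightarrow> ('a \<Rightarrow> real) set" where
  "ray_cone \<C> = {b. \<exists>c. (\<forall>F\<in>\<C>. c F \<ge> 0) \<and> b = (\<lambda>i. \<Sum>F\<in>\<C>. c F * indicator F i)}"

definition matroid_fan :: "'a matroid \<Rightarrow> ('a \<Rightarrow> real) set set" where
  "matroid_fan M = {ray_cone \<C> | \<C>.
     (\<forall>F\<in>\<C>. is_flat M F \<and> F \<noteq> {}) \<and> (\<forall>F\<in>\<C>. \<forall>G\<in>\<C>. F \<subseteq> G \<or> G \<subseteq> F)}"

definition fan_support :: "'a matroid \<Rightarrow> ('a \<Rightarrow> real) set" where
  "fan_support M = \<Union>(matroid_fan M)"

definition Lin :: "'a matroid \<Rightarrow> (('a \<Rightarrow> real) \<Rightarrow> real) set" where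
  "Lin M = {restrict m (fan_support M) | m. integral_linear (ground M) m}"

definition PExp :: "'a matroid \<Rightarrow> (('a \<Rightarrow> real) \<Rightarrow> real) ring" where
  "PExp M =
     \<lparr>carrier = {f \<in> extensional (fan_support M).
        \<forall>C\<in>matroid_fan M. \<exists>(k::nat) (a::nat \<Rightarrow> int) m.
          (\<forall>j<k. integral_linear (ground M) (m j)) \<and>
          (\<forall>b\<in>C. f b = (\<Sum>j<k. of_int (a j) * exp (m j b)))},
      mult = (\<lambda>f g. \<lambda>b\<in>fan_support M. f b * g b),
      one = (\<lambda>b\<in>fan_support M. 1),
      zero = (\<lambda>b\<in>fan_support M. 0),
      add = (\<lambda>f g. \<lambda>b\<in>fan_support M. f b + g b)\<rparr>"

definition K_ideal :: "'a matroid \<Rightarrow> (('a \<Rightarrow> real) \<Rightarrow> real) set" where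
  "K_ideal M = Idl\<^bsub>PExp M\<^esub> {(\<lambda>b\<in>fan_support M. exp (f b) - 1) | f. f \<in> Lin M}"

definition K_ring :: "'a matroid \<Rightarrow> (('a \<Rightarrow> real) \<Rightarrow> real) set ring" where
  "K_ring M = PExp M Quot K_ideal M"

definition K_class ::
    "'a matroid \<Rightarrow> (('a \<Rightarrow> real) \<Rightarrow> real) \<Rightarrow> (('a \<Rightarrow> real) \<Rightarrow> real) set" where
  "K_class M g = K_ideal M +>\<^bsub>PExp M\<^esub> restrict g (fan_support M)"

definition phi ::
    "'a matroid \<Rightarrow> ((nat \<Rightarrow> 'a) \<Rightarrow> 'a laurent) \<Rightarrow> (('a \<Rightarrow> real) \<Rightarrow> real) set" where
  "phi M f = K_class M (plaur_exp (ground M) f)"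

definition psi ::
    "'a matroid \<Rightarrow> (('a \<Rightarrow> real) \<Rightarrow> real) \<Rightarrow> (('a \<Rightarrow> real) \<Rightarrow> real) set" where
  "psi M f = K_class M (\<lambda>b. exp (f b))"

section \<open>Matroid Euler characteristics\<close>

text \<open>The matroids range over those with ground set in the type \<open>'a\<close>. This is
  enough to determine \<open>chi M\<close>, as the recursion only passes to subsets of the ground set.\<close>

definition matroid_euler_characteristics ::
    "('a matroid \<Rightarrow> (('a \<Rightarrow> real) \<Rightarrow> real) set \<Rightarrow> int) \<Rightarrow> bool" where
  "matroid_euler_characteristics chi \<longleftrightarrow>
     (\<forall>M. is_matroid M \<and> loopless M \<and> ground M \<noteq> {} \<longrightarrow>
        (\<forall>u\<in>carrier (K_ring M). \<forall>v\<in>carrier (K_ring M).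
           chi M (u \<oplus>\<^bsub>K_ring M\<^esub> v) = chi M u + chi M v) \<and>
        chi M (psi M (\<lambda>b\<in>RE (ground M). 0)) = 1 \<and>
        (\<forall>F f. is_flat M F \<and> F \<noteq> {} \<and> F \<noteq> ground M \<and> f \<in> PLin (ground M) \<longrightarrow>
           chi M (psi M f) =
             chi M (psi M (\<lambda>b\<in>RE (ground M). f b - delta (ground M) F b)) +
             chi (matroid_restrict M F)
               (psi (matroid_restrict M F) (plin_restrict (ground M) f F)) *
             chi (matroid_contract M F)
               (psi (matroid_contract M F) (plin_contract (ground M) f F))))"


text \<open>The Laurent polynomials \<open>omega M\<close> do satisfy the divisibility conditions.\<close>

lemma keys_diff_subset:
  "Poly_Mapping.keys (p - q) \<subseteq> Poly_Mapping.keys p \<union> Poly_Mapping.keys (q :: 'b \<Rightarrow>\<^sub>0 int)"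
  by (auto simp: in_keys_iff lookup_minus)

lemma laurent_add: "p \<in> laurent E \<Longrightarrow> q \<in> laurent E \<Longrightarrow> p + q \<in> laurent E"
  unfolding laurent_def using Poly_Mapping.keys_add[of p q] by blast

lemma laurent_uminus: "p \<in> laurent E \<Longrightarrow> - p \<in> laurent E"
  unfolding laurent_def by (auto simp: in_keys_iff)

lemma laurent_single: "Poly_Mapping.keys m \<subseteq> E \<Longrightarrow> Poly_Mapping.single m c \<in> laurent E"
  unfolding laurent_def by auto

lemma laurent_0: "0 \<in> laurent E"
  unfolding laurent_def by auto

lemma laurent_dvd_0: "laurent_dvd E p 0"
  unfolding laurent_dvd_def by (rule bexI[OF _ laurent_0]) simp

lemma laurent_dvd_add: "laurent_dvd E p q \<Longrightarrow> laurent_dvd E p q' \<Longrightarrow> laurent_dvd E p (q + q')"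
  unfolding laurent_dvd_def by (metis laurent_add distrib_left)

lemma laurent_dvd_uminus: "laurent_dvd E p q \<Longrightarrow> laurent_dvd E p (- q)"
  unfolding laurent_dvd_def by (metis laurent_uminus mult_minus_right)

lemma laurent_dvd_monomials_step:
  assumes "Poly_Mapping.keys w \<subseteq> E" "a \<in> E" "b \<in> E"
  shows "laurent_dvd E (xpow a 1 - xpow b 1)
    (Poly_Mapping.single w 1 -
     Poly_Mapping.single (w + (Poly_Mapping.single a 1 - Poly_Mapping.single b 1)) 1)"
proof -
  let ?r = "- Poly_Mapping.single (w - Poly_Mapping.single b 1) 1 :: 'a laurent"
  have "Poly_Mapping.keys (w - Poly_Mapping.single b 1) \<subseteq> E"
    using keys_diff_subset[of w "Poly_Mapping.single b 1"] assms by auto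
  then have "?r \<in> laurent E"
    by (intro laurent_uminus laurent_single)
  moreover have "Poly_Mapping.single w 1 -
     Poly_Mapping.single (w + (Poly_Mapping.single a 1 - Poly_Mapping.single b 1)) 1
     = (xpow a 1 - xpow b 1) * ?r"
    by (simp add: xpow_def algebra_simps mult_single)
  ultimately show ?thesis
    unfolding laurent_dvd_def by blast
qed

lemma laurent_dvd_monomials_nat:
  assumes "Poly_Mapping.keys w \<subseteq> E" "a \<in> E" "b \<in> E"
  shows "w' = w + (\<Sum>j<(k::nat). Poly_Mapping.single a 1 - Poly_Mapping.single b 1) \<Longrightarrow>
    Poly_Mapping.keys w' \<subseteq> E \<and>
    laurent_dvd E (xpow a 1 - xpow b 1) (Poly_Mapping.single w 1 - Poly_Mapping.single w' 1)"
proof (induction k arbitrary: w')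
  case 0
  then show ?case using assms by (simp add: laurent_dvd_0)
next
  case (Suc k)
  define v where "v = w + (\<Sum>j<k. Poly_Mapping.single a 1 - Poly_Mapping.single b 1)"
  have v: "Poly_Mapping.keys v \<subseteq> E"
    "laurent_dvd E (xpow a 1 - xpow b 1) (Poly_Mapping.single w 1 - Poly_Mapping.single v 1)"
    using Suc.IH[OF v_def] by auto
  have w': "w' = v + (Poly_Mapping.single a 1 - Poly_Mapping.single b 1)"
    using Suc.prems by (simp add: v_def add.assoc)
  have "Poly_Mapping.keys w' \<subseteq> E"
    unfolding w' using v(1) assms(2,3) Poly_Mapping.keys_add[of v "Poly_Mapping.single a 1 - Poly_Mapping.single b 1"]
      keys_diff_subset[of "Poly_Mapping.single a 1" "Poly_Mapping.single b 1"] by fastforce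
  moreover have "laurent_dvd E (xpow a 1 - xpow b 1) (Poly_Mapping.single w 1 - Poly_Mapping.single w' 1)"
    using laurent_dvd_add[OF v(2) laurent_dvd_monomials_step[OF v(1) assms(2,3)]]
    by (simp add: w')
  ultimately show ?case by blast
qed

lemma laurent_dvd_monomials:
  assumes w: "Poly_Mapping.keys w \<subseteq> E" and w': "Poly_Mapping.keys w' \<subseteq> E"
    and ab: "a \<in> E" "b \<in> E" "a \<noteq> b"
    and other: "\<And>c. c \<noteq> a \<Longrightarrow> c \<noteq> b \<Longrightarrow> Poly_Mapping.lookup w c = Poly_Mapping.lookup w' c"
    and sum: "Poly_Mapping.lookup w a + Poly_Mapping.lookup w b =
      Poly_Mapping.lookup w' a + (Poly_Mapping.lookup w' b :: int)"
  shows "laurent_dvd E (xpow a 1 - xpow b 1) (Poly_Mapping.single w 1 - Poly_Mapping.single w' 1)"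
proof -
  have key: "laurent_dvd E (xpow a 1 - xpow b 1) (Poly_Mapping.single u 1 - Poly_Mapping.single u' 1)"
    if "Poly_Mapping.keys u \<subseteq> E"
      and o: "\<And>c. c \<noteq> a \<Longrightarrow> c \<noteq> b \<Longrightarrow> Poly_Mapping.lookup u c = Poly_Mapping.lookup u' c"
      and s: "Poly_Mapping.lookup u a + Poly_Mapping.lookup u b =
        Poly_Mapping.lookup u' a + Poly_Mapping.lookup u' b"
      and le: "Poly_Mapping.lookup u a \<le> Poly_Mapping.lookup u' a" for u u' :: "'a \<Rightarrow>\<^sub>0 int"
  proof -
    let ?k = "nat (Poly_Mapping.lookup u' a - Poly_Mapping.lookup u a)"
    have "u' = u + (\<Sum>j<?k. Poly_Mapping.single a 1 - Poly_Mapping.single b 1)"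
    proof (rule poly_mapping_eqI)
      fix c
      show "Poly_Mapping.lookup u' c = Poly_Mapping.lookup
        (u + (\<Sum>j<?k. Poly_Mapping.single a 1 - Poly_Mapping.single b 1)) c"
        using o[of c] s le ab(3)
        by (cases "c = a"; cases "c = b")
          (auto simp: lookup_add lookup_sum lookup_minus lookup_single when_def)
    qed
    from laurent_dvd_monomials_nat[OF that(1) ab(1,2) this] show ?thesis by blast
  qed
  show ?thesis
  proof (cases "Poly_Mapping.lookup w a \<le> Poly_Mapping.lookup w' a")
    case True
    then show ?thesis using key[OF w other sum] by blast
  next
    case False
    then have "laurent_dvd E (xpow a 1 - xpow b 1) (Poly_Mapping.single w' 1 - Poly_Mapping.single w 1)"
      using key[OF w'] other sum by (metis linear)
    from laurent_dvd_uminus[OF this] show ?thesis by simp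
  qed
qed

definition omega_exponent :: "'a matroid \<Rightarrow> (nat \<Rightarrow> 'a) \<Rightarrow> 'a \<Rightarrow>\<^sub>0 int" where
  "omega_exponent M \<sigma> = Poly_Mapping.single (\<sigma> (card (ground M))) 1 +
     Poly_Mapping.single (\<sigma> 1) (-1) +
     (\<Sum>i\<in>ground M - greedy_basis M \<sigma>. Poly_Mapping.single i (-1))"

lemma prod_xpow:
  "finite A \<Longrightarrow> (\<Prod>i\<in>A. xpow i k) = Poly_Mapping.single (\<Sum>i\<in>A. Poly_Mapping.single i k) 1"
  by (induction A rule: finite_induct) (auto simp: xpow_def mult_single)

lemma omega_eq:
  assumes "finite (ground M)" "\<sigma> \<in> orderings (ground M)"
  shows "omega M \<sigma> = Poly_Mapping.single (omega_exponent M \<sigma>) 1"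
  using assms by (simp add: omega_def omega_exponent_def prod_xpow) (simp add: xpow_def mult_single)

lemma lookup_omega_exponent:
  assumes "finite (ground M)"
  shows "Poly_Mapping.lookup (omega_exponent M \<sigma>) c =
    of_bool (c = \<sigma> (card (ground M))) - of_bool (c = \<sigma> 1) -
    of_bool (c \<in> ground M - greedy_basis M \<sigma>)"
  using assms
  by (auto simp: omega_exponent_def lookup_add lookup_sum lookup_single when_def)

lemma orderings_transpose:
  assumes "\<sigma> \<in> orderings E" "i \<in> {1..<card E}"
  shows "\<sigma> \<circ> transpose i (i + 1) \<in> orderings E"
proof -
  have "bij_betw (transpose i (i + 1)) {1..card E} {1..card E}"
    using assms(2) by (intro bij_betw_byWitness[where f' = "transpose i (i + 1)"])
      (auto simp: transpose_def)
  then have "bij_betw (\<sigma> \<circ> transpose i (i + 1)) {1..card E} E"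
    using assms(1) unfolding orderings_def by (auto intro: bij_betw_trans)
  moreover have "\<sigma> \<circ> transpose i (i + 1) \<in> extensional {1..card E}"
    using assms unfolding orderings_def extensional_def by (auto simp: transpose_def)
  ultimately show ?thesis unfolding orderings_def by blast
qed

lemma is_matroid_rk_insert:
  assumes "is_matroid M" "A \<subseteq> ground M" "x \<in> ground M"
  shows "rk M A \<le> rk M (insert x A)" "rk M (insert x A) \<le> rk M A + 1"
proof -
  show "rk M A \<le> rk M (insert x A)"
    using assms unfolding is_matroid_def by (meson insert_subset subset_insertI)
  have "rk M (A \<union> {x}) + rk M (A \<inter> {x}) \<le> rk M A + rk M {x}"
    using assms unfolding is_matroid_def by (meson empty_subsetI insert_subset)
  moreover have "rk M {x} \<le> card {x}"
    using assms unfolding is_matroid_def by (meson empty_subsetI insert_subset)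
  ultimately show "rk M (insert x A) \<le> rk M A + 1" by simp
qed

lemma in_greedy_basis_iff:
  assumes "\<sigma> \<in> orderings (ground M)" "j \<in> {1..card (ground M)}"
  shows "\<sigma> j \<in> greedy_basis M \<sigma> \<longleftrightarrow> rk M (\<sigma> ` {1..j}) > rk M (\<sigma> ` {1..j - 1})"
  using assms unfolding greedy_basis_def orderings_def bij_betw_def
  by (auto dest: inj_onD)

lemma image_transpose_prefix:
  assumes "j \<noteq> i" "1 \<le> i"
  shows "(\<sigma> \<circ> transpose i (i + 1)) ` {1..j} = \<sigma> ` {1..j::nat}"
proof -
  have "transpose i (i + 1) ` {1..j} = {1..j}"
    using assms by (intro transpose_image_eq) auto
  then show ?thesis by (metis image_comp)
qed

lemma omega_in_PLaur:
  assumes M: "is_matroid M" and ne: "ground M \<noteq> {}"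
  shows "omega M \<in> PLaur (ground M)"
proof -
  let ?E = "ground M" and ?n = "card (ground M)"
  have fin: "finite ?E" using M by (simp add: is_matroid_def)
  have n: "?n \<ge> 1" using fin ne by (simp add: Suc_leI card_gt_0_iff)
  have in_E: "\<sigma> j \<in> ?E" if "\<sigma> \<in> orderings ?E" "j \<in> {1..?n}" for \<sigma> j
    using that unfolding orderings_def by (auto dest: bij_betw_apply)
  have keys: "Poly_Mapping.keys (omega_exponent M \<sigma>) \<subseteq> ?E" if "\<sigma> \<in> orderings ?E" for \<sigma>
  proof
    fix c assume "c \<in> Poly_Mapping.keys (omega_exponent M \<sigma>)"
    then have "Poly_Mapping.lookup (omega_exponent M \<sigma>) c \<noteq> 0" by (simp add: in_keys_iff)
    then have "c = \<sigma> ?n \<or> c = \<sigma> 1 \<or> c \<in> ?E"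
      by (auto simp: lookup_omega_exponent[OF fin] split: if_splits)
    then show "c \<in> ?E" using in_E[OF that] n by auto
  qed
  have "laurent_dvd ?E (xpow (\<sigma> i) 1 - xpow (\<sigma> (i + 1)) 1)
          (omega M \<sigma> - omega M (\<sigma> \<circ> transpose i (i + 1)))"
    if \<sigma>: "\<sigma> \<in> orderings ?E" and i: "i \<in> {1..<?n}" for \<sigma> i
  proof -
    define \<tau> where "\<tau> = \<sigma> \<circ> transpose i (i + 1)"
    have \<tau>: "\<tau> \<in> orderings ?E" unfolding \<tau>_def by (rule orderings_transpose[OF \<sigma> i])
    have inj: "\<sigma> j = \<sigma> k \<longleftrightarrow> j = k" if "j \<in> {1..?n}" "k \<in> {1..?n}" for j k
      using \<sigma> that unfolding orderings_def bij_betw_def by (auto dest: inj_onD)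
    have \<tau>1: "\<tau> i = \<sigma> (i + 1)" "\<tau> (i + 1) = \<sigma> i" "\<And>j. j \<noteq> i \<Longrightarrow> j \<noteq> i + 1 \<Longrightarrow> \<tau> j = \<sigma> j"
      by (auto simp: \<tau>_def transpose_def)
    have pre: "\<tau> ` {1..j} = \<sigma> ` {1..j}" if "j \<noteq> i" for j
      unfolding \<tau>_def using that i by (intro image_transpose_prefix) auto
    let ?a = "\<sigma> i" and ?b = "\<sigma> (i + 1)" and ?B = "greedy_basis M \<sigma>" and ?B' = "greedy_basis M \<tau>"
    let ?P = "\<sigma> ` {1..i - 1}"
    have ab: "?a \<in> ?E" "?b \<in> ?E" "?a \<noteq> ?b"
      using in_E[OF \<sigma>] inj[of i "i + 1"] i by auto
    have P: "?P \<subseteq> ?E" using in_E[OF \<sigma>] i by auto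
    have other: "c \<in> ?B \<longleftrightarrow> c \<in> ?B'" if "c \<in> ?E" "c \<noteq> ?a" "c \<noteq> ?b" for c
    proof -
      obtain j where j: "j \<in> {1..?n}" "c = \<sigma> j"
        using \<open>c \<in> ?E\<close> \<sigma> unfolding orderings_def bij_betw_def by blast
      then have ne: "j \<noteq> i" "j \<noteq> i + 1" using that by auto
      then have "c = \<tau> j" using \<tau>1 j by simp
      have "j - 1 \<noteq> i" using ne i by auto
      then show ?thesis
        using in_greedy_basis_iff[OF \<sigma> j(1)] in_greedy_basis_iff[OF \<tau> j(1)] \<open>c = \<tau> j\<close> j(2)
          pre ne by simp
    qed
    have s1: "{1..i} = insert i {1..i - 1}" "{1..i + 1} = insert (i + 1) (insert i {1..i - 1})"
      using i by auto
    have im: "\<sigma> ` {1..i} = insert ?a ?P" "\<sigma> ` {1..i + 1} = insert ?b (insert ?a ?P)"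
      unfolding s1 by auto
    have "i - 1 \<noteq> i" using i by auto
    have "\<tau> ` {1..i} = insert (\<tau> i) (\<tau> ` {1..i - 1})" unfolding s1 by auto
    then have im': "\<tau> ` {1..i} = insert ?b ?P" "\<tau> ` {1..i + 1} = insert ?b (insert ?a ?P)"
      "\<tau> ` {1..i - 1} = ?P"
      using pre[OF \<open>i - 1 \<noteq> i\<close>] pre[of "i + 1"] im(2) \<tau>1 by simp_all
    have iff: "?a \<in> ?B \<longleftrightarrow> rk M (insert ?a ?P) > rk M ?P"
        "?b \<in> ?B \<longleftrightarrow> rk M (insert ?b (insert ?a ?P)) > rk M (insert ?a ?P)"
        "?b \<in> ?B' \<longleftrightarrow> rk M (insert ?b ?P) > rk M ?P"
        "?a \<in> ?B' \<longleftrightarrow> rk M (insert ?b (insert ?a ?P)) > rk M (insert ?b ?P)"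
    proof -
      have i': "i \<in> {1..?n}" "i + 1 \<in> {1..?n}" "i + 1 - 1 = i" using i by auto
      show "?a \<in> ?B \<longleftrightarrow> rk M (insert ?a ?P) > rk M ?P"
        using in_greedy_basis_iff[OF \<sigma> i'(1)] unfolding im .
      show "?b \<in> ?B \<longleftrightarrow> rk M (insert ?b (insert ?a ?P)) > rk M (insert ?a ?P)"
        using in_greedy_basis_iff[OF \<sigma> i'(2)] unfolding i'(3) im .
      show "?b \<in> ?B' \<longleftrightarrow> rk M (insert ?b ?P) > rk M ?P"
        using in_greedy_basis_iff[OF \<tau> i'(1)] unfolding im' \<tau>1(1) .
      show "?a \<in> ?B' \<longleftrightarrow> rk M (insert ?b (insert ?a ?P)) > rk M (insert ?b ?P)"
        using in_greedy_basis_iff[OF \<tau> i'(2)] unfolding i'(3) im' \<tau>1(2) .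
    qed
    have rks: "rk M ?P \<le> rk M (insert ?a ?P)" "rk M (insert ?a ?P) \<le> rk M ?P + 1"
      "rk M ?P \<le> rk M (insert ?b ?P)" "rk M (insert ?b ?P) \<le> rk M ?P + 1"
      "rk M (insert ?a ?P) \<le> rk M (insert ?b (insert ?a ?P))"
      "rk M (insert ?b (insert ?a ?P)) \<le> rk M (insert ?a ?P) + 1"
      "rk M (insert ?b ?P) \<le> rk M (insert ?b (insert ?a ?P))"
      "rk M (insert ?b (insert ?a ?P)) \<le> rk M (insert ?b ?P) + 1"
      using is_matroid_rk_insert[OF M P ab(1)] is_matroid_rk_insert[OF M P ab(2)]
        is_matroid_rk_insert[OF M _ ab(2), of "insert ?a ?P"]
        is_matroid_rk_insert[OF M _ ab(1), of "insert ?b ?P"] P ab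
      by (simp_all add: insert_commute)
    have cnt: "of_bool (?a \<in> ?B) + of_bool (?b \<in> ?B) = (of_bool (?a \<in> ?B') + of_bool (?b \<in> ?B') :: int)"
      unfolding iff using rks by (auto simp: of_bool_def)
    have ends_other: "c = \<tau> k \<longleftrightarrow> c = \<sigma> k" if "c \<noteq> ?a" "c \<noteq> ?b" for c k
      using \<tau>1 that by (metis)
    have ends_sum: "of_bool (?a = \<tau> k) + of_bool (?b = \<tau> k) =
        (of_bool (?a = \<sigma> k) + of_bool (?b = \<sigma> k) :: int)" for k
      using \<tau>1 ab(3) by (cases "k = i"; cases "k = i + 1") auto
    have "laurent_dvd ?E (xpow ?a 1 - xpow ?b 1)
      (Poly_Mapping.single (omega_exponent M \<sigma>) 1 - Poly_Mapping.single (omega_exponent M \<tau>) 1)"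
    proof (rule laurent_dvd_monomials[OF keys[OF \<sigma>] keys[OF \<tau>] ab])
      fix c assume c: "c \<noteq> ?a" "c \<noteq> ?b"
      show "Poly_Mapping.lookup (omega_exponent M \<sigma>) c = Poly_Mapping.lookup (omega_exponent M \<tau>) c"
        unfolding lookup_omega_exponent[OF fin] using ends_other[OF c] other[OF _ c] by auto
    next
      have mem: "of_bool (c \<in> ?E - X) = (1 - of_bool (c \<in> X) :: int)" if "c \<in> ?E" for c X
        using that by auto
      show "Poly_Mapping.lookup (omega_exponent M \<sigma>) ?a + Poly_Mapping.lookup (omega_exponent M \<sigma>) ?b =
        Poly_Mapping.lookup (omega_exponent M \<tau>) ?a + Poly_Mapping.lookup (omega_exponent M \<tau>) ?b"
        unfolding lookup_omega_exponent[OF fin] mem[OF ab(1)] mem[OF ab(2)]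
        using ends_sum[of ?n] ends_sum[of 1] cnt by linarith
    qed
    then show ?thesis
      by (simp only: omega_eq[OF fin \<sigma>] omega_eq[OF fin \<tau>] flip: \<tau>_def)
  qed
  moreover have "omega M \<in> orderings ?E \<rightarrow>\<^sub>E laurent ?E"
  proof (rule PiE_I)
    fix \<sigma> assume "\<sigma> \<in> orderings ?E"
    then show "omega M \<sigma> \<in> laurent ?E"
      using omega_eq[OF fin] keys by (auto intro: laurent_single)
  qed (simp add: omega_def)
  ultimately show ?thesis unfolding PLaur_def by blast
qed

end

theory Submission
  imports Defs "HOL-Combinatorics.Multiset_Permutations"
begin

text \<open>The Euler characteristic is computed by a localization formula: \<open>\<chi>\<^sub>M (\<phi>\<^sub>M f)\<close> is the value at
  \<open>x = 1\<close> of the sum over all orderings \<open>\<sigma>\<close> of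
  \<open>f\<^sub>\<sigma> \<Prod> (1 - x\<^sub>i) / \<Prod> (1 - x\<^bsub>\<sigma>(k+1)\<^esub> / x\<^bsub>\<sigma>(k)\<^esub>)\<close>, with \<open>i\<close> running over the complement of the greedy
  basis of \<open>\<sigma>\<close>. For \<open>f = x\<^sup>g\<close> with \<open>g\<close> piecewise linear, the sum satisfies the recursion that defines
  \<open>\<chi>\<close>, for all proper nonempty subsets \<open>F\<close> in place of flats; if \<open>F\<close> is not a flat, then \<open>M/F\<close> has a
  loop \<open>i\<close> and the common factor \<open>1 - x\<^sub>i\<close> kills the product term at \<open>x = 1\<close>. For \<open>g = 0\<close> the sum is
  identically 1, and the recursion also shows that the value at \<open>x = 1\<close> exists as the limit along
  \<open>x\<^sub>i = exp (t w\<^sub>i)\<close>, \<open>t \<rightarrow> 0\<close>. As the \<open>x\<^sup>g\<close> span the ring of piecewise Laurent polynomials, the formula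
  holds for all \<open>f\<close>. The substitution \<open>x \<mapsto> x\<^sup>-\<^sup>1\<close> (that is, \<open>t \<mapsto> -t\<close>) then turns each summand for the
  dual of \<open>f\<close> into \<open>(-1)\<^bsup>r-1\<^esup>\<close> times the summand for \<open>f \<omega>\<close>.\<close>

section \<open>Localization sums\<close>

text \<open>Single summands of the localization formula may have poles at \<open>x = 1\<close>, so
  only their sum can be evaluated there, and \<open>chi\<close> is compared with limits instead of
  values. The recursion for \<open>chi\<close> mentions flats only, but the sums see every subset,
  so loops enter through contractions and the induction must cover them. For a matroid with loops
  the vanishing factor alone does not settle the limit, because the rest of the sum might have a
  pole; turning the loops into coloops exhibits the rest as the sum of a loopless matroid, whose
  limit is finite. The hypotheses on \<open>chi\<close> speak only of sums and of classes of
  \<open>e^g\<close> with \<open>g\<close> piecewise linear, which is why the spanning statement for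
  \<open>PLaur\<close> is essential. Its proof needs coprimality of binomials
  \<open>x_a - x_b\<close>, expressed here through the substitution of \<open>x_b\<close> for
  \<open>x_a\<close>. The element \<open>omega\<close> collects the monomials that inverting the
  variables splits off the numerators and the denominators.\<close>

text \<open>The variables are \<open>x\<^sub>i = exp (y i)\<close>, and an ordering is a list. The set \<open>A\<close> of elements that
  precede the list makes the same functions serve for contractions.\<close>

fun den :: "('a \<Rightarrow> real) \<Rightarrow> 'a list \<Rightarrow> real" where
  "den y [] = 1"
| "den y [a] = 1"
| "den y (a # b # xs) = (1 - exp (y b - y a)) * den y (b # xs)"

fun num :: "('a set \<Rightarrow> nat) \<Rightarrow> 'a set \<Rightarrow> ('a \<Rightarrow> real) \<Rightarrow> 'a list \<Rightarrow> real" where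
  "num r A y [] = 1"
| "num r A y (e # xs) = (if r A < r (insert e A) then 1 else 1 - exp (y e)) * num r (insert e A) y xs"

fun wt :: "('a set \<Rightarrow> int) \<Rightarrow> 'a set \<Rightarrow> ('a \<Rightarrow> real) \<Rightarrow> 'a list \<Rightarrow> real" where
  "wt a A y [] = 1"
| "wt a A y (e # xs) = exp (of_int (a (insert e A) - a A) * y e) * wt a (insert e A) y xs"

text \<open>For \<open>A = {}\<close>, \<open>a {} = 0\<close> and submodular \<open>a\<close>,
  dropping \<open>num\<close> leaves Brion's formula for the lattice points of the base polytope of
  \<open>a\<close>: \<open>wt\<close> is the monomial of the greedy vertex of the ordering, and
  \<open>den\<close> comes from the directions \<open>e_b - e_a\<close> of consecutive
  elements.\<close>

definition locsum ::
    "('a set \<Rightarrow> nat) \<Rightarrow> ('a set \<Rightarrow> int) \<Rightarrow> 'a set \<Rightarrow> 'a set \<Rightarrow> ('a \<Rightarrow> real) \<Rightarrow> real" where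
  "locsum r a A E y = (\<Sum>xs\<in>permutations_of_set E. wt a A y xs * num r A y xs / den y xs)"

lemma den_append:
  "xs \<noteq> [] \<Longrightarrow> zs \<noteq> [] \<Longrightarrow>
    den y (xs @ zs) = den y xs * (1 - exp (y (hd zs) - y (last xs))) * den y zs"
proof (induction y xs rule: den.induct)
  case (2 y a)
  then show ?case by (cases zs) auto
qed auto

lemma num_append: "num r A y (xs @ zs) = num r A y xs * num r (A \<union> set xs) y zs"
  by (induction xs arbitrary: A) (auto simp: insert_commute)

lemma wt_append: "wt a A y (xs @ zs) = wt a A y xs * wt a (A \<union> set xs) y zs"
  by (induction xs arbitrary: A) auto

lemma den_nonzero: "distinct xs \<Longrightarrow> inj_on y (set xs) \<Longrightarrow> den y xs \<noteq> 0"
proof (induction y xs rule: den.induct)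
  case (3 y a b xs)
  then have "y b \<noteq> y a" by (auto dest: inj_onD)
  then show ?case using 3 by (auto intro: inj_on_subset)
qed auto

text \<open>\<open>wt\<close> sees only increments. The shift \<open>c\<close> is what makes the
  contracted coefficients \<open>a (F \<union> T) - a F\<close> fit.\<close>

lemma wt_translate:
  "(\<And>k. k \<le> length xs \<Longrightarrow> a (A \<union> set (take k xs)) = a' (B \<union> set (take k xs)) + c) \<Longrightarrow>
    wt a A y xs = wt a' B y xs"
proof (induction xs arbitrary: A B)
  case (Cons e xs)
  have "wt a (insert e A) y xs = wt a' (insert e B) y xs"
    using Cons.prems[of "Suc k" for k] by (intro Cons.IH) force
  moreover have "a A = a' B + c" "a (insert e A) = a' (insert e B) + c"
    using Cons.prems[of 0] Cons.prems[of 1] by auto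
  ultimately show ?case by simp
qed auto

lemma wt_cong:
  "(\<And>k. k \<le> length xs \<Longrightarrow> a (A \<union> set (take k xs)) = a' (A \<union> set (take k xs))) \<Longrightarrow>
    wt a A y xs = wt a' A y xs"
  by (rule wt_translate[where c = 0]) simp

lemma num_cong:
  "(\<And>k. k < length xs \<Longrightarrow>
      r (A \<union> set (take k xs)) < r (A \<union> set (take (Suc k) xs)) \<longleftrightarrow>
      r' (B \<union> set (take k xs)) < r' (B \<union> set (take (Suc k) xs))) \<Longrightarrow>
    num r A y xs = num r' B y xs"
proof (induction xs arbitrary: A B)
  case (Cons e xs)
  have "num r (insert e A) y xs = num r' (insert e B) y xs"
    using Cons.prems[of "Suc k" for k] by (intro Cons.IH) force
  moreover have "r A < r (insert e A) \<longleftrightarrow> r' B < r' (insert e B)"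
    using Cons.prems[of 0] by auto
  ultimately show ?case by simp
qed auto

lemma locsum_cong_a:
  assumes "\<And>T. T \<subseteq> E \<Longrightarrow> a (A \<union> T) = a' (A \<union> T)"
  shows "locsum r a A E y = locsum r a' A E y"
  unfolding locsum_def
proof (rule sum.cong[OF refl])
  fix xs assume "xs \<in> permutations_of_set E"
  then have "set xs = E" by (simp add: permutations_of_set_def)
  then have "wt a A y xs = wt a' A y xs"
    by (intro wt_cong assms) (meson set_take_subset)
  then show "wt a A y xs * num r A y xs / den y xs = wt a' A y xs * num r A y xs / den y xs"
    by simp
qed

text \<open>The set \<open>A \<union> set xs\<close> is reached only by the last step, whose
  increment loses 1.\<close>

lemma wt_drop_delta:
  assumes "xs \<noteq> []" "last xs \<notin> set (butlast xs)" "set xs \<inter> A = {}"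
  shows "wt (a(A \<union> set xs := a (A \<union> set xs) - 1)) A y xs = wt a A y xs * exp (- y (last xs))"
proof -
  let ?l = "last xs" and ?ys = "butlast xs" and ?a = "a(A \<union> set xs := a (A \<union> set xs) - 1)"
  have xs: "xs = ?ys @ [?l]" using assms(1) by simp
  have l: "?l \<notin> A" using assms(1,3) last_in_set[of xs] by blast
  have neq: "A \<union> set (take k ?ys) \<noteq> A \<union> set xs" for k
  proof -
    have "?l \<notin> A \<union> set (take k ?ys)" using l assms(2) by (auto dest: in_set_takeD)
    then show ?thesis using assms(1) by (metis UnI2 last_in_set)
  qed
  have S: "insert ?l (A \<union> set ?ys) = A \<union> set xs" by (subst (2) xs) auto
  have neq': "A \<union> set ?ys \<noteq> A \<union> set xs" using neq[of "length ?ys"] by simp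
  have "wt ?a A y ?ys = wt a A y ?ys" using neq by (intro wt_cong) simp
  moreover have "wt ?a (A \<union> set ?ys) y [?l] = wt a (A \<union> set ?ys) y [?l] * exp (- y ?l)"
    using neq' by (simp add: S algebra_simps flip: exp_add)
  ultimately have "wt ?a A y (?ys @ [?l]) = wt a A y (?ys @ [?l]) * exp (- y ?l)"
    by (simp only: wt_append mult.assoc)
  then show ?thesis using xs by metis
qed

text \<open>Here the lowered value is the one at the starting set, so the first increment gains 1.
  Together with \<open>wt_drop_delta\<close> this gives the ratio by which the weight of an ordering
  through \<open>B\<close> changes.\<close>

lemma wt_drop_delta_hd:
  assumes "zs \<noteq> []" "set zs \<inter> B = {}"
  shows "wt (a(B := a B - 1)) B y zs = wt a B y zs * exp (y (hd zs))"
proof -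
  obtain z zs' where zs: "zs = z # zs'" using assms(1) by (cases zs) auto
  have z: "z \<notin> B" using assms zs by auto
  have neq: "insert z B \<union> X \<noteq> B" for X using z by auto
  have "wt (a(B := a B - 1)) (insert z B) y zs' = wt a (insert z B) y zs'"
    using neq by (intro wt_cong) simp
  moreover have "insert z B \<noteq> B" using neq[of "{}"] by simp
  ultimately show ?thesis using zs by (simp add: algebra_simps flip: exp_add)
qed

text \<open>Lowering the coefficient of \<open>T\<close> only affects the orderings that begin with \<open>T\<close>; there it
  cancels the factor of the denominator at the end of \<open>T\<close>, and the sum splits as a product.\<close>

lemma locsum_recursion:
  assumes fin: "finite E" and T: "T \<subseteq> E" "T \<noteq> {}" "T \<noteq> E" and disj: "A \<inter> E = {}"
    and inj: "inj_on y E"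
  shows "locsum r a A E y = locsum r (a(A \<union> T := a (A \<union> T) - 1)) A E y +
    locsum r a A T y * locsum r a (A \<union> T) (E - T) y"
proof -
  let ?a = "a(A \<union> T := a (A \<union> T) - 1)"
  let ?P = "permutations_of_set T \<times> permutations_of_set (E - T)"
  let ?h = "\<lambda>(us, vs). us @ vs"
  let ?t = "\<lambda>a xs. wt a A y xs * num r A y xs / den y xs"
  have sub: "?h ` ?P \<subseteq> permutations_of_set E"
    using T by (auto simp: permutations_of_set_def)
  have inj_h: "inj_on ?h ?P"
  proof (rule inj_onI, clarify)
    fix us vs us' vs'
    assume *: "us \<in> permutations_of_set T" "us' \<in> permutations_of_set T" "us @ vs = us' @ vs'"
    then have "length us = length us'" by (metis length_finite_permutations_of_set)
    then show "us = us' \<and> vs = vs'" using * by simp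
  qed
  have other: "?t a xs = ?t ?a xs" if xs: "xs \<in> permutations_of_set E" "xs \<notin> ?h ` ?P" for xs
  proof -
    have "A \<union> set (take k xs) \<noteq> A \<union> T" for k
    proof
      assume eq: "A \<union> set (take k xs) = A \<union> T"
      have d: "set xs = E" "distinct xs" using xs by (auto dest: permutations_of_setD)
      have "set (take k xs) \<subseteq> E" using d set_take_subset by metis
      then have s: "set (take k xs) = T" using eq T disj by blast
      have "set (take k xs) \<union> set (drop k xs) = E" "set (take k xs) \<inter> set (drop k xs) = {}"
        using d set_take_disj_set_drop_if_distinct[OF d(2), of k k]
        by (auto simp flip: set_append)
      then have "set (drop k xs) = E - T" using s by auto
      then have "(take k xs, drop k xs) \<in> ?P" using s d by (auto simp: permutations_of_set_def)
      then have "?h (take k xs, drop k xs) \<in> ?h ` ?P" by (rule imageI)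
      then show False using xs(2) by simp
    qed
    then have "wt a A y xs = wt ?a A y xs" by (intro wt_cong) simp
    then show ?thesis by simp
  qed
  have main: "?t a (us @ vs) = ?t ?a (us @ vs) +
      (wt a A y us * num r A y us / den y us) *
      (wt a (A \<union> T) y vs * num r (A \<union> T) y vs / den y vs)"
    if "us \<in> permutations_of_set T" "vs \<in> permutations_of_set (E - T)" for us vs
  proof -
    have us: "set us = T" "distinct us" and vs: "set vs = E - T" "distinct vs"
      using that by (auto dest: permutations_of_setD)
    have ne: "us \<noteq> []" "vs \<noteq> []" using us vs T by auto
    \<comment> \<open>The lowered weight is \<open>q\<close> times the old one, and
      \<open>den\<close> has the factor \<open>1 - q\<close> at the junction of \<open>us\<close>
      and \<open>vs\<close>. The difference of the two summands therefore loses this factor and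
      splits into a product.\<close>
    define q where "q = exp (y (hd vs) - y (last us))"
    have "hd vs \<in> E - T" "last us \<in> T" using ne us vs hd_in_set last_in_set by metis+
    then have "y (hd vs) \<noteq> y (last us)" using inj T by (auto dest: inj_onD)
    then have q: "q \<noteq> 1" by (simp add: q_def)
    have "last us \<notin> set (butlast us)"
      using us ne by (metis append_butlast_last_id distinct_append not_distinct_conv_prefix)
    then have w1: "wt ?a A y us = wt a A y us * exp (- y (last us))"
      using wt_drop_delta[of us A a y] ne us T disj by (auto simp: Int_commute)
    have w2: "wt ?a (A \<union> T) y vs = wt a (A \<union> T) y vs * exp (y (hd vs))"
      using vs disj ne by (intro wt_drop_delta_hd) auto
    have w: "wt ?a A y (us @ vs) = wt a A y us * wt a (A \<union> T) y vs * q"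
      unfolding wt_append us w1 w2 q_def by (simp add: exp_diff exp_minus field_simps)
    have dn: "den y us \<noteq> 0" "den y vs \<noteq> 0"
      using den_nonzero us vs inj T by (metis inj_on_subset Diff_subset)+
    show ?thesis
      unfolding w unfolding den_append[OF ne] num_append wt_append us q_def[symmetric]
      using dn q by (simp add: divide_simps) (simp add: algebra_simps)
  qed
  have split: "locsum r a' A E y =
      (\<Sum>xs\<in>permutations_of_set E - ?h ` ?P. ?t a' xs) + (\<Sum>xs\<in>?h ` ?P. ?t a' xs)" for a'
    unfolding locsum_def by (intro sum.subset_diff sub) simp
  note split[of a]
  also have "(\<Sum>xs\<in>permutations_of_set E - ?h ` ?P. ?t a xs) = (\<Sum>xs\<in>permutations_of_set E - ?h ` ?P. ?t ?a xs)"
    using other by (intro sum.cong) auto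
  also have "(\<Sum>xs\<in>?h ` ?P. ?t a xs) = (\<Sum>p\<in>?P. ?t a (?h p))"
    using sum.reindex[OF inj_h] by simp
  also have "\<dots> = (\<Sum>p\<in>?P. ?t ?a (?h p) +
      (wt a A y (fst p) * num r A y (fst p) / den y (fst p)) *
      (wt a (A \<union> T) y (snd p) * num r (A \<union> T) y (snd p) / den y (snd p)))"
    by (intro sum.cong refl) (clarsimp simp only: main mem_Times_iff fst_conv snd_conv split_beta)
  also have "\<dots> = (\<Sum>xs\<in>?h ` ?P. ?t ?a xs) + locsum r a A T y * locsum r a (A \<union> T) (E - T) y"
    unfolding sum.distrib locsum_def sum_product sum.cartesian_product sum.reindex[OF inj_h]
    by (simp add: split_beta)
  finally show ?thesis
    unfolding split[of ?a] by (simp only: add.assoc)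
qed

text \<open>The increments of \<open>a'\<close> and \<open>a\<close> differ only at the step that
  adds \<open>i\<close>. Induction from the right keeps the preceding prefix visible, which decides
  whether \<open>i\<close> has occurred.\<close>

lemma wt_linear:
  assumes "\<And>T. T \<subseteq> E \<Longrightarrow> a' (A \<union> T) = a (A \<union> T) + c * of_bool (i \<in> T)"
    and "i \<in> E" "A \<inter> E = {}" "set xs \<subseteq> E" "distinct xs"
  shows "wt a' A y xs = wt a A y xs * (if i \<in> set xs then exp (of_int c * y i) else 1)"
  using assms(4,5)
proof (induction xs rule: rev_induct)
  case (snoc x xs)
  have *: "a' (insert x (A \<union> set xs)) = a (insert x (A \<union> set xs)) + c * of_bool (i \<in> insert x (set xs))"
    "a' (A \<union> set xs) = a (A \<union> set xs) + c * of_bool (i \<in> set xs)"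
    using assms(1)[of "insert x (set xs)"] assms(1)[of "set xs"] snoc.prems by simp_all
  then show ?case
    using snoc by (auto simp: wt_append algebra_simps simp flip: exp_add)
qed auto

text \<open>Linear functions are trivial in \<open>K(M)\<close>; on the side of the sums they
  contribute a factor that tends to 1 along \<open>t * w\<close>.\<close>

lemma locsum_linear:
  assumes "\<And>T. T \<subseteq> E \<Longrightarrow> a' (A \<union> T) = a (A \<union> T) + c * of_bool (i \<in> T)"
    and "i \<in> E" "A \<inter> E = {}"
  shows "locsum r a' A E y = exp (of_int c * y i) * locsum r a A E y"
  unfolding locsum_def sum_distrib_left
proof (rule sum.cong[OF refl])
  fix xs assume "xs \<in> permutations_of_set E"
  then have "set xs = E" "distinct xs" by (auto dest: permutations_of_setD)
  then have "wt a' A y xs = wt a A y xs * exp (of_int c * y i)"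
    using wt_linear[OF assms, of xs] assms(2) by auto
  then show "wt a' A y xs * num r A y xs / den y xs =
    exp (of_int c * y i) * (wt a A y xs * num r A y xs / den y xs)"
    by simp
qed

section \<open>The value at zero\<close>

lemma matroid_finite: "is_matroid M \<Longrightarrow> finite (ground M)"
  by (simp add: is_matroid_def)

lemma matroid_rk_mono: "is_matroid M \<Longrightarrow> A \<subseteq> B \<Longrightarrow> B \<subseteq> ground M \<Longrightarrow> rk M A \<le> rk M B"
  by (simp add: is_matroid_def)

lemma matroid_rk_submodular:
  "is_matroid M \<Longrightarrow> A \<subseteq> ground M \<Longrightarrow> B \<subseteq> ground M \<Longrightarrow>
    rk M (A \<union> B) + rk M (A \<inter> B) \<le> rk M A + rk M B"
  by (simp add: is_matroid_def)

lemma matroid_rk_empty: "is_matroid M \<Longrightarrow> rk M {} = 0"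
  unfolding is_matroid_def by (metis card.empty empty_subsetI le_zero_eq)

lemma matroid_rk_insert_insert:
  assumes M: "is_matroid M" and A: "A \<subseteq> ground M" and e: "e \<in> ground M" and a: "a \<in> ground M"
    and ne: "e \<noteq> a"
  shows "rk M (insert e (insert a A)) + rk M A \<le> rk M (insert e A) + rk M (insert a A)"
proof -
  have "rk M A \<le> rk M (insert e A \<inter> insert a A)"
    using assms by (intro matroid_rk_mono) auto
  moreover have "insert e (insert a A) = insert e A \<union> insert a A" by auto
  ultimately show ?thesis
    using matroid_rk_submodular[OF M, of "insert e A" "insert a A"] assms by simp
qed

text \<open>The factor \<open>1 - x\<close> contributed by the element \<open>x\<close> of \<open>xs\<close> that stops being in the greedy
  basis when \<open>e\<close> is inserted at the front; there is none if \<open>e\<close> is independent of \<open>xs\<close>.\<close>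

fun ins_factor :: "('a set \<Rightarrow> nat) \<Rightarrow> 'a \<Rightarrow> 'a set \<Rightarrow> ('a \<Rightarrow> real) \<Rightarrow> 'a list \<Rightarrow> real" where
  "ins_factor r e A y [] = 1"
| "ins_factor r e A y (a # xs) =
    (if r (insert e (insert a A)) = r (insert a A) then 1 - exp (y a)
     else ins_factor r e (insert a A) y xs)"

text \<open>By submodularity \<open>e\<close> stays in the closure of every larger set, so adding it
  changes no rank jump of \<open>xs\<close>.\<close>

lemma num_insert_closure:
  assumes M: "is_matroid M" and "A \<union> set xs \<subseteq> ground M" "e \<in> ground M" "e \<notin> set xs" "distinct xs"
    and "rk M (insert e A) = rk M A"
  shows "num (rk M) (insert e A) y xs = num (rk M) A y xs"
  using assms(2-)
proof (induction xs arbitrary: A)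
  case (Cons a xs)
  have *: "rk M (insert e (insert a A)) = rk M (insert a A)"
    using matroid_rk_insert_insert[OF M, of A e a] is_matroid_rk_insert[OF M, of "insert a A" e] Cons.prems
    by auto
  then have "num (rk M) (insert e (insert a A)) y xs = num (rk M) (insert a A) y xs"
    using Cons.prems by (intro Cons.IH) auto
  then show ?case using * Cons.prems by (simp add: insert_commute)
qed auto

text \<open>The rank jumps with and without \<open>e\<close> agree until \<open>e\<close> falls into
  the closure of the prefix. The element causing this jumps over the prefix but not over the prefix
  with \<open>e\<close>; from then on \<open>num_insert_closure\<close> applies.\<close>

lemma num_insert:
  assumes M: "is_matroid M" and "A \<union> set xs \<subseteq> ground M" "e \<in> ground M" "e \<notin> set xs" "distinct xs"
    and "rk M A < rk M (insert e A)"
  shows "num (rk M) (insert e A) y xs = num (rk M) A y xs * ins_factor (rk M) e A y xs"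
  using assms(2-)
proof (induction xs arbitrary: A)
  case (Cons a xs)
  have *: "insert a (insert e A) = insert e (insert a A)" by auto
  have ranks: "rk M (insert e A) = rk M A + 1" "rk M A \<le> rk M (insert a A)"
    "rk M (insert a A) \<le> rk M A + 1" "rk M (insert a A) \<le> rk M (insert e (insert a A))"
    "rk M (insert e (insert a A)) \<le> rk M (insert a A) + 1"
    "rk M (insert e A) \<le> rk M (insert e (insert a A))"
    using is_matroid_rk_insert[OF M, of A e] is_matroid_rk_insert[OF M, of A a]
      is_matroid_rk_insert[OF M, of "insert a A" e] is_matroid_rk_insert[OF M, of "insert e A" a]
      Cons.prems by (auto simp: insert_commute)
  show ?case
  proof (cases "rk M (insert e (insert a A)) = rk M (insert a A)")
    case True
    then have "num (rk M) (insert e (insert a A)) y xs = num (rk M) (insert a A) y xs"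
      using Cons.prems by (intro num_insert_closure[OF M]) auto
    then show ?thesis using True ranks by (auto simp: *)
  next
    case False
    then have "num (rk M) (insert e (insert a A)) y xs =
        num (rk M) (insert a A) y xs * ins_factor (rk M) e (insert a A) y xs"
      using Cons.prems ranks by (intro Cons.IH) auto
    then show ?thesis using False ranks by (auto simp: *)
  qed
qed auto

text \<open>With \<open>u = e / (p - e)\<close> (in exponentiated coordinates) inserting \<open>e\<close> between neighbours \<open>a, b\<close>
  multiplies the summand by a difference \<open>u\<^sub>a - u\<^sub>b\<close>, so that the sum over all positions telescopes.\<close>

lemma sum_insertions_after:
  assumes M: "is_matroid M" and "A \<union> set xs \<subseteq> ground M" "e \<in> ground M" "e \<notin> set (p # xs)"
    "distinct (p # xs)" "inj_on y (insert e (set (p # xs)))"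
  shows "(\<Sum>k\<le>length xs. num (rk M) A y (take k xs @ e # drop k xs) /
        den y (p # take k xs @ e # drop k xs)) =
    num (rk M) A y xs / den y (p # xs) *
      (1 + (if rk M (insert e A) = rk M A then 1 - exp (y p) else ins_factor (rk M) e A y xs) *
        (exp (y e) / (exp (y p) - exp (y e))))"
  using assms(2-)
proof (induction xs arbitrary: A p)
  case Nil
  have "y e \<noteq> y p" using Nil by (auto dest: inj_onD)
  then have "exp (y e) \<noteq> exp (y p)" by simp
  moreover have "rk M A \<le> rk M (insert e A)" using is_matroid_rk_insert[OF M] Nil by auto
  ultimately show ?case by (auto simp: exp_diff divide_simps) (auto simp: algebra_simps)
next
  case (Cons a xs)
  let ?r = "rk M"
  define P Q X where "P = exp (y p)" and "Q = exp (y a)" and "X = exp (y e)"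
  have neq: "y e \<noteq> y p" "y e \<noteq> y a" "y p \<noteq> y a" using Cons.prems by (auto dest: inj_onD)
  then have neq': "X \<noteq> P" "X \<noteq> Q" "P \<noteq> Q" by (auto simp: P_def Q_def X_def)
  have pos: "P > 0" "Q > 0" "X > 0" by (auto simp: P_def Q_def X_def)
  define N D c where "N = num ?r (insert a A) y xs" and "D = den y (a # xs)"
    and "c = (if ?r (insert e (insert a A)) = ?r (insert a A) then 1 - exp (y a)
      else ins_factor ?r e (insert a A) y xs)"
  define j where "j = (if ?r A < ?r (insert a A) then 1 else 1 - exp (y a))"
  have D: "D \<noteq> 0" unfolding D_def using Cons.prems by (intro den_nonzero) (auto intro: inj_on_subset)
  have IH: "(\<Sum>k\<le>length xs. num ?r (insert a A) y (take k xs @ e # drop k xs) /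
        den y (a # take k xs @ e # drop k xs)) = N / D * (1 + c * (X / (Q - X)))"
    unfolding N_def D_def c_def X_def Q_def
    using Cons.prems by (intro Cons.IH) (auto intro: inj_on_subset)
  have dens: "den y (p # e # a # xs) = (1 - X / P) * ((1 - Q / X) * D)"
    "den y (p # a # xs) = (1 - Q / P) * D"
    "\<And>zs. den y (p # a # zs) = (1 - Q / P) * den y (a # zs)"
    by (simp_all add: P_def Q_def X_def D_def exp_diff)
  have first: "num ?r A y (e # a # xs) = j * N *
      (if ?r (insert e A) = ?r A then 1 - X else c)"
  proof (cases "?r (insert e A) = ?r A")
    case True
    then have "num ?r (insert e A) y (a # xs) = num ?r A y (a # xs)"
      using Cons.prems by (intro num_insert_closure[OF M]) auto
    then show ?thesis using True by (simp add: N_def j_def X_def)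
  next
    case False
    then have l: "?r A < ?r (insert e A)" using is_matroid_rk_insert[OF M, of A e] Cons.prems by auto
    then have "num ?r (insert e A) y (a # xs) = num ?r A y (a # xs) * ins_factor ?r e A y (a # xs)"
      using Cons.prems by (intro num_insert[OF M]) auto
    then show ?thesis using False l by (simp add: N_def j_def c_def)
  qed
  have cl: "c = 1 - Q" if "?r (insert e A) = ?r A"
    using matroid_rk_insert_insert[OF M, of A e a] is_matroid_rk_insert[OF M, of "insert a A" e]
      Cons.prems that by (auto simp: c_def Q_def)
  have "(\<Sum>k\<le>length (a # xs). num ?r A y (take k (a # xs) @ e # drop k (a # xs)) /
        den y (p # take k (a # xs) @ e # drop k (a # xs))) =
      num ?r A y (e # a # xs) / den y (p # e # a # xs) +
      (\<Sum>k\<le>length xs. j / (1 - Q / P) * (num ?r (insert a A) y (take k xs @ e # drop k xs) /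
        den y (a # take k xs @ e # drop k xs)))"
    unfolding length_Cons sum.atMost_Suc_shift by (simp add: dens(3) j_def del: den.simps)
  also have "\<dots> = j * N * (if ?r (insert e A) = ?r A then 1 - X else c) /
      ((1 - X / P) * ((1 - Q / X) * D)) + j / (1 - Q / P) * (N / D * (1 + c * (X / (Q - X))))"
    unfolding sum_distrib_left[symmetric] IH dens(1) first ..
  \<comment> \<open>With \<open>u_z = X / (z - X)\<close> the new denominators give
    \<open>u_P - u_Q\<close>. If \<open>e\<close> lies in the closure of \<open>A\<close>, the sum
    still telescopes, because \<open>(1 - X) * u_z\<close> and \<open>(1 - z) * u_z\<close> differ
    by \<open>X\<close> for every \<open>z\<close>.\<close>
  also have "\<dots> = j * N / ((1 - Q / P) * D) *
      (1 + (if ?r (insert e A) = ?r A then 1 - P else c) * (X / (P - X)))"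
    using cl D neq' pos by (auto simp: divide_simps) (auto simp: algebra_simps)
  also have "(if ?r (insert e A) = ?r A then 1 - P else c) =
      (if ?r (insert e A) = ?r A then 1 - exp (y p) else ins_factor ?r e A y (a # xs))"
    by (simp add: c_def P_def)
  finally show ?case
    unfolding dens(2)[symmetric] by (simp add: j_def N_def P_def X_def)
qed

text \<open>In front there is no left neighbour: the denominator contributes
  \<open>1 / (1 - Q / X) = - X / (Q - X)\<close>, which cancels the boundary term left by
  \<open>sum_insertions_after\<close>. By \<open>jump\<close> both carry the same factor
  \<open>c\<close>.\<close>

lemma sum_insertions:
  assumes M: "is_matroid M" and "A \<union> set xs \<subseteq> ground M" "e \<in> ground M" "e \<notin> set xs"
    "distinct xs" "inj_on y (insert e (set xs))" and jump: "rk M A < rk M (insert e A)" and "xs \<noteq> []"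
  shows "(\<Sum>k\<le>length xs. num (rk M) A y (take k xs @ e # drop k xs) /
      den y (take k xs @ e # drop k xs)) = num (rk M) A y xs / den y xs"
proof -
  obtain a xs' where xs: "xs = a # xs'" using \<open>xs \<noteq> []\<close> by (cases xs) auto
  let ?r = "rk M"
  define Q X where "Q = exp (y a)" and "X = exp (y e)"
  define c where "c = ins_factor ?r e A y xs"
  define j N D where "j = (if ?r A < ?r (insert a A) then 1 else 1 - exp (y a))"
    and "N = num ?r (insert a A) y xs'" and "D = den y xs"
  have "y e \<noteq> y a" using assms xs by (auto dest: inj_onD)
  then have neq: "X \<noteq> Q" by (simp add: Q_def X_def)
  have pos: "Q > 0" "X > 0" by (auto simp: Q_def X_def)
  have D: "D \<noteq> 0" unfolding D_def using assms by (intro den_nonzero) (auto intro: inj_on_subset)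
  have first: "num ?r A y (e # xs) = j * N * c"
    using num_insert[OF M, of A xs e y] assms by (simp add: c_def j_def N_def xs)
  have den1: "den y (e # xs) = (1 - Q / X) * D"
    by (simp add: xs D_def Q_def X_def exp_diff)
  have "(\<Sum>k\<le>length xs'. num ?r (insert a A) y (take k xs' @ e # drop k xs') /
        den y (a # take k xs' @ e # drop k xs')) = N / D * (1 + c * (X / (Q - X)))"
    using sum_insertions_after[OF M, of "insert a A" xs' e a y] assms
    by (simp add: xs N_def D_def c_def Q_def X_def)
  note this = this[THEN arg_cong[of _ _ "\<lambda>t. j * t"]]
  then have "(\<Sum>k\<le>length xs. num ?r A y (take k xs @ e # drop k xs) / den y (take k xs @ e # drop k xs))
      = j * N * c / ((1 - Q / X) * D) + j * (N / D * (1 + c * (X / (Q - X))))"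
    unfolding first[symmetric] den1[symmetric]
    unfolding xs length_Cons sum.atMost_Suc_shift
    by (simp add: sum_distrib_left j_def del: den.simps)
  also have "\<dots> = j * N / D"
    using neq pos D by (simp add: divide_simps) (simp add: algebra_simps)
  finally show ?thesis by (simp add: j_def N_def D_def xs)
qed

lemma permutations_of_set_insert_sum:
  assumes "finite E" "e \<notin> E"
  shows "(\<Sum>zs\<in>permutations_of_set (insert e E). g zs) =
    (\<Sum>xs\<in>permutations_of_set E. \<Sum>k\<le>card E. g (take k xs @ e # drop k xs))"
proof -
  let ?h = "\<lambda>(xs, k). take k xs @ e # drop k xs"
  have "bij_betw ?h (permutations_of_set E \<times> {..card E}) (permutations_of_set (insert e E))"
  proof (rule bij_betwI[where g = "\<lambda>zs. (remove1 e zs, length (takeWhile (\<lambda>z. z \<noteq> e) zs))"])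
    show "?h \<in> permutations_of_set E \<times> {..card E} \<rightarrow> permutations_of_set (insert e E)"
    proof clarify
      fix xs k assume xs: "xs \<in> permutations_of_set E"
      then have "set xs = E" "distinct xs" by (auto dest: permutations_of_setD)
      then have "set (take k xs) \<union> set (drop k xs) = E" "distinct (take k xs)" "distinct (drop k xs)"
        "set (take k xs) \<inter> set (drop k xs) = {}"
        by (simp_all add: set_take_disj_set_drop_if_distinct flip: set_append)
      then show "take k xs @ e # drop k xs \<in> permutations_of_set (insert e E)"
        using assms by (auto simp: permutations_of_set_def)
    qed
    show "(\<lambda>zs. (remove1 e zs, length (takeWhile (\<lambda>z. z \<noteq> e) zs)))
        \<in> permutations_of_set (insert e E) \<rightarrow> permutations_of_set E \<times> {..card E}"
    proof
      fix zs assume zs: "zs \<in> permutations_of_set (insert e E)"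
      then have s: "set zs = insert e E" "distinct zs" by (auto dest: permutations_of_setD)
      have "length (takeWhile (\<lambda>z. z \<noteq> e) zs) < length zs"
        using s length_takeWhile_le[of "\<lambda>z. z \<noteq> e" zs] takeWhile_eq_take[of "\<lambda>z. z \<noteq> e" zs]
          set_takeWhileD[of e "\<lambda>z. z \<noteq> e" zs] by (metis insertI1 le_neq_implies_less take_all_iff order_refl)
      then show "(remove1 e zs, length (takeWhile (\<lambda>z. z \<noteq> e) zs))
          \<in> permutations_of_set E \<times> {..card E}"
        using s assms length_finite_permutations_of_set[OF zs] by (auto simp: permutations_of_set_def)
    qed
  next
    fix p assume "p \<in> permutations_of_set E \<times> {..card E}"
    then obtain xs k where p: "p = (xs, k)" and xs: "set xs = E" "distinct xs" "k \<le> card E"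
      by (auto dest: permutations_of_setD)
    have e: "e \<notin> set (take k xs)" "e \<notin> set (drop k xs)"
      using xs assms by (auto dest: in_set_takeD in_set_dropD)
    moreover have "takeWhile (\<lambda>z. z \<noteq> e) (take k xs) = take k xs"
      using e by (intro takeWhile_eq_all_conv[THEN iffD2]) auto
    moreover have "k \<le> length xs" using xs distinct_card by metis
    ultimately show "(\<lambda>zs. (remove1 e zs, length (takeWhile (\<lambda>z. z \<noteq> e) zs))) (?h p) = p"
      using e by (auto simp: p remove1_append takeWhile_append)
  next
    fix zs assume "zs \<in> permutations_of_set (insert e E)"
    then have s: "set zs = insert e E" "distinct zs" by (auto dest: permutations_of_setD)
    then obtain us vs where "zs = us @ e # vs" "e \<notin> set us"
      using split_list_first[of e zs] by auto
    moreover from this have "takeWhile (\<lambda>z. z \<noteq> e) us = us" by auto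
    ultimately show "?h (remove1 e zs, length (takeWhile (\<lambda>z. z \<noteq> e) zs)) = zs"
      using s by (auto simp: remove1_append takeWhile_append)
  qed
  from sum.reindex_bij_betw[OF this, of g] show ?thesis
    by (simp add: sum.cartesian_product split_beta)
qed

lemma wt_const: "wt (\<lambda>_. c) A y xs = 1"
  by (induction xs arbitrary: A) auto

text \<open>Induction on \<open>E\<close> inside a fixed matroid, which spares the passage to
  restrictions when \<open>e\<close> is removed. Every ordering of \<open>insert e E\<close> arises
  by inserting \<open>e\<close> into one of \<open>E\<close>, and by looplessness \<open>e\<close>
  is independent of the empty prefix, as \<open>sum_insertions\<close> requires.\<close>

lemma locsum_zero:
  assumes M: "is_matroid M" and "E \<subseteq> ground M" "E \<noteq> {}" and loopless: "\<And>e. e \<in> E \<Longrightarrow> 0 < rk M {e}"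
    and inj: "inj_on y E"
  shows "locsum (rk M) (\<lambda>_. 0) {} E y = 1"
proof -
  have "finite E" using assms matroid_finite finite_subset by metis
  then show ?thesis using \<open>E \<noteq> {}\<close> assms(2,4,5)
  proof (induction E rule: finite_ne_induct)
    case (singleton e)
    then show ?case using matroid_rk_empty[OF M] by (simp add: locsum_def)
  next
    case (insert e E)
    have "locsum (rk M) (\<lambda>_. 0) {} (insert e E) y =
      (\<Sum>xs\<in>permutations_of_set E. \<Sum>k\<le>card E. num (rk M) {} y (take k xs @ e # drop k xs) /
          den y (take k xs @ e # drop k xs))"
      unfolding locsum_def wt_const using insert by (simp add: permutations_of_set_insert_sum)
    also have "\<dots> = (\<Sum>xs\<in>permutations_of_set E. num (rk M) {} y xs / den y xs)"
    proof (rule sum.cong[OF refl])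
      fix xs assume xs: "xs \<in> permutations_of_set E"
      then have s: "set xs = E" "distinct xs" by (auto dest: permutations_of_setD)
      have "xs \<noteq> []" using s insert by auto
      then show "(\<Sum>k\<le>card E. num (rk M) {} y (take k xs @ e # drop k xs) /
          den y (take k xs @ e # drop k xs)) = num (rk M) {} y xs / den y xs"
        using sum_insertions[OF M, of "{}" xs e y] s insert.prems insert.hyps matroid_rk_empty[OF M]
          length_finite_permutations_of_set[OF xs] by (auto simp del: den.simps)
    qed
    also have "\<dots> = locsum (rk M) (\<lambda>_. 0) {} E y" unfolding locsum_def wt_const by simp
    also have "\<dots> = 1" using insert by (intro insert.IH) (auto intro: inj_on_subset)
    finally show ?case .
  qed
qed

section \<open>Piecewise linear functions on the braid fan\<close>

lemma orderings_in: "\<sigma> \<in> orderings E \<Longrightarrow> k \<in> {1..card E} \<Longrightarrow> \<sigma> k \<in> E"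
  unfolding orderings_def by (auto dest: bij_betw_apply)

lemma orderings_inj: "\<sigma> \<in> orderings E \<Longrightarrow> inj_on \<sigma> {1..card E}"
  unfolding orderings_def by (auto dest: bij_betw_imp_inj_on)

lemma orderings_image: "\<sigma> \<in> orderings E \<Longrightarrow> \<sigma> ` {1..card E} = E"
  unfolding orderings_def by (auto dest: bij_betw_imp_surj_on)

lemma orderings_obtain:
  assumes "\<sigma> \<in> orderings E" "i \<in> E"
  obtains k where "k \<in> {1..card E}" "i = \<sigma> k"
  using assms orderings_image[of \<sigma> E] by (metis imageE)

lemma orderings_prefix: "\<sigma> \<in> orderings E \<Longrightarrow> k \<le> card E \<Longrightarrow> \<sigma> ` {1..k} \<subseteq> E"
  using orderings_in[of \<sigma> E] by auto

lemma orderings_eq_iff: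
  "\<sigma> \<in> orderings E \<Longrightarrow> j \<in> {1..card E} \<Longrightarrow> k \<in> {1..card E} \<Longrightarrow> \<sigma> j = \<sigma> k \<longleftrightarrow> j = k"
  using orderings_inj inj_on_eq_iff by metis

lemma orderings_prefix_mem:
  "\<sigma> \<in> orderings E \<Longrightarrow> j \<in> {1..card E} \<Longrightarrow> k \<le> card E \<Longrightarrow> \<sigma> j \<in> \<sigma> ` {1..k} \<longleftrightarrow> j \<le> k"
  using orderings_eq_iff[of \<sigma> E j] by (auto simp: image_iff)

lemma orderings_prefix_inj:
  assumes "\<sigma> \<in> orderings E" "j \<le> card E" "k \<le> card E" "\<sigma> ` {1..j} = \<sigma> ` {1..k}"
  shows "j = k"
proof -
  have "card (\<sigma> ` {1..i}) = i" if "i \<le> card E" for i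
    using card_image[of \<sigma> "{1..i}"] inj_on_subset[OF orderings_inj[OF assms(1)], of "{1..i}"] that
    by auto
  then show ?thesis using assms by metis
qed

section \<open>Orderings as lists, and the maximal cones through a given vector\<close>

definition list_of :: "'a set \<Rightarrow> (nat \<Rightarrow> 'a) \<Rightarrow> 'a list" where
  "list_of E \<sigma> = map \<sigma> [1..<Suc (card E)]"

lemma list_of_bij:
  assumes "finite E"
  shows "bij_betw (list_of E) (orderings E) (permutations_of_set E)"
proof (rule bij_betwI[where g = "\<lambda>xs. \<lambda>i\<in>{1..card E}. xs ! (i - 1)"])
  show "list_of E \<in> orderings E \<rightarrow> permutations_of_set E"
  proof
    fix \<sigma> assume "\<sigma> \<in> orderings E"
    then show "list_of E \<sigma> \<in> permutations_of_set E"
      using orderings_inj[of \<sigma> E] orderings_image[of \<sigma> E]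
      by (auto simp: list_of_def permutations_of_set_def distinct_map atLeastLessThanSuc_atLeastAtMost
          simp del: upt_Suc)
  qed
  show "(\<lambda>xs. \<lambda>i\<in>{1..card E}. xs ! (i - 1)) \<in> permutations_of_set E \<rightarrow> orderings E"
  proof
    fix xs assume "xs \<in> permutations_of_set E"
    then have xs: "set xs = E" "distinct xs" and len: "length xs = card E"
      by (auto dest: permutations_of_setD length_finite_permutations_of_set)
    have "bij_betw ((!) xs \<circ> (\<lambda>i. i - 1)) {1..card E} E"
    proof (rule bij_betw_trans)
      show "bij_betw (\<lambda>i. i - 1) {1..card E} {..<card E}"
        by (rule bij_betwI[where g = Suc]) auto
      show "bij_betw ((!) xs) {..<card E} E" using bij_betw_nth[OF xs(2)] xs(1) len by auto
    qed
    moreover have "bij_betw (\<lambda>i\<in>{1..card E}. xs ! (i - 1)) {1..card E} E \<longleftrightarrow>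
        bij_betw ((!) xs \<circ> (\<lambda>i. i - 1)) {1..card E} E"
      by (rule bij_betw_cong) simp
    ultimately show "(\<lambda>i\<in>{1..card E}. xs ! (i - 1)) \<in> orderings E"
      unfolding orderings_def by simp
  qed
next
  fix \<sigma> assume "\<sigma> \<in> orderings E"
  then show "(\<lambda>i\<in>{1..card E}. list_of E \<sigma> ! (i - 1)) = \<sigma>"
    unfolding list_of_def orderings_def by (auto simp: fun_eq_iff extensional_def simp del: upt_Suc)
next
  fix xs assume "xs \<in> permutations_of_set E"
  then have "length xs = card E" by (rule length_finite_permutations_of_set)
  then show "list_of E (\<lambda>i\<in>{1..card E}. xs ! (i - 1)) = xs"
    unfolding list_of_def by (intro nth_equalityI) (auto simp del: upt_Suc)
qed

lemma max_cone_exists: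
  assumes "finite E" "b \<in> RE E"
  obtains \<sigma> where "\<sigma> \<in> orderings E" "b \<in> max_cone E \<sigma>"
proof -
  obtain ys where ys: "set ys = E" "distinct ys" using finite_distinct_list[OF assms(1)] by blast
  define xs where "xs = sort_key (\<lambda>i. - b i) ys"
  have "xs \<in> permutations_of_set E" using ys by (auto simp: xs_def permutations_of_set_def)
  then obtain \<sigma> where \<sigma>: "\<sigma> \<in> orderings E" "list_of E \<sigma> = xs"
    using list_of_bij[OF assms(1)] unfolding bij_betw_def by (metis imageE)
  have "b (\<sigma> (i + 1)) \<le> b (\<sigma> i)" if "i \<in> {1..<card E}" for i
  proof -
    have "sorted (map (\<lambda>i. - b i) xs)" by (simp add: xs_def)
    then have "map (\<lambda>i. - b i) xs ! (i - 1) \<le> map (\<lambda>i. - b i) xs ! i"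
      using that \<sigma>(2) by (intro sorted_nth_mono) (auto simp: list_of_def)
    moreover have "xs ! (i - 1) = \<sigma> i" "xs ! i = \<sigma> (i + 1)" "length xs = card E"
      using that \<sigma>(2) by (auto simp: list_of_def simp del: upt_Suc)
    ultimately show ?thesis using that by auto
  qed
  then show thesis using that \<sigma> assms by (auto simp: max_cone_def)
qed

lemma max_cone_antimono:
  assumes "b \<in> max_cone E \<sigma>" "1 \<le> j" "j \<le> k" "k \<le> card E"
  shows "b (\<sigma> k) \<le> b (\<sigma> j)"
  using assms(3,4)
proof (induction k rule: dec_induct)
  case (step i)
  then have "b (\<sigma> (i + 1)) \<le> b (\<sigma> i)" using assms by (auto simp: max_cone_def)
  then show ?case using step by simp
qed simp

text \<open>An explicit formula for the piecewise linear functions \<open>delta E T\<close>.\<close>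

definition height :: "'a set \<Rightarrow> 'a set \<Rightarrow> ('a \<Rightarrow> real) \<Rightarrow> real" where
  "height E T b = (if T = E then Min (b ` E) else max 0 (Min (b ` T) - Max (b ` (E - T))))"

lemma height_top:
  assumes "\<sigma> \<in> orderings E" "b \<in> max_cone E \<sigma>" "finite E" "E \<noteq> {}"
  shows "height E E b = b (\<sigma> (card E))"
proof -
  have n: "card E \<ge> 1" using assms by (simp add: Suc_leI card_gt_0_iff)
  have "Min (b ` E) = b (\<sigma> (card E))"
  proof (rule Min_eqI)
    fix v assume "v \<in> b ` E"
    then obtain i where i: "i \<in> E" "v = b i" by blast
    from orderings_obtain[OF assms(1) i(1)] obtain k where "k \<in> {1..card E}" "i = \<sigma> k" .
    then show "b (\<sigma> (card E)) \<le> v" using max_cone_antimono[OF assms(2), of k "card E"] i by auto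
  qed (use assms orderings_in[OF assms(1)] n in auto)
  then show ?thesis by (simp add: height_def)
qed

lemma height_prefix:
  assumes "\<sigma> \<in> orderings E" "b \<in> max_cone E \<sigma>" "finite E" "k \<in> {1..<card E}"
  shows "height E (\<sigma> ` {1..k}) b = b (\<sigma> k) - b (\<sigma> (k + 1))"
proof -
  have k1: "\<sigma> (k + 1) \<in> E - \<sigma> ` {1..k}"
    using assms orderings_in[of \<sigma> E "k + 1"] orderings_prefix_mem[of \<sigma> E "k + 1" k] by auto
  then have ne: "\<sigma> ` {1..k} \<noteq> E" by blast
  have mn: "Min (b ` \<sigma> ` {1..k}) = b (\<sigma> k)"
    using assms(4) max_cone_antimono[OF assms(2), of _ k] by (intro Min_eqI) auto
  have mx: "Max (b ` (E - \<sigma> ` {1..k})) = b (\<sigma> (k + 1))"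
  proof (rule Max_eqI)
    fix v assume "v \<in> b ` (E - \<sigma> ` {1..k})"
    then obtain i where i: "i \<in> E" "v = b i" "i \<notin> \<sigma> ` {1..k}" by blast
    from orderings_obtain[OF assms(1) i(1)] obtain j where j: "j \<in> {1..card E}" "i = \<sigma> j" .
    then have "k + 1 \<le> j" using i by auto
    moreover have "j \<le> card E" using j by simp
    ultimately show "v \<le> b (\<sigma> (k + 1))"
      using max_cone_antimono[OF assms(2), of "k + 1" j] i j by simp
  next
    show "b (\<sigma> (k + 1)) \<in> b ` (E - \<sigma> ` {1..k})" using k1 by (rule imageI)
  qed (use assms(3) in simp)
  have "b (\<sigma> (k + 1)) \<le> b (\<sigma> k)" using assms(2,4) by (simp add: max_cone_def)
  then show ?thesis using ne unfolding height_def mn mx by simp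
qed

text \<open>Unless \<open>T\<close> is a prefix of \<open>\<sigma>\<close>, some element outside
  \<open>T\<close> precedes an element of \<open>T\<close>; on the cone of \<open>\<sigma>\<close>
  the minimum over \<open>T\<close> then does not exceed the maximum over the complement.\<close>

lemma height_not_prefix:
  assumes "\<sigma> \<in> orderings E" "b \<in> max_cone E \<sigma>" "finite E" "T \<subseteq> E" "T \<noteq> {}"
    and not_prefix: "\<And>k. k \<in> {1..card E} \<Longrightarrow> T \<noteq> \<sigma> ` {1..k}"
  shows "height E T b = 0"
proof -
  have "T \<noteq> E"
    using not_prefix[of "card E"] orderings_image[OF assms(1)] assms
    by (auto simp: Suc_le_eq card_gt_0_iff)
  have "\<exists>j k. j \<in> {1..card E} \<and> k \<in> {1..card E} \<and> j < k \<and> \<sigma> j \<notin> T \<and> \<sigma> k \<in> T"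
  proof (rule ccontr)
    assume *: "\<not> ?thesis"
    define K where "K = {k \<in> {1..card E}. \<sigma> k \<in> T}"
    have T: "T = \<sigma> ` K" unfolding K_def using assms(4) by (subst (asm) orderings_image[OF assms(1), symmetric]) blast
    then have K: "K \<noteq> {}" "finite K" using assms by (auto simp: K_def)
    have "K = {1..Max K}"
    proof
      show "K \<subseteq> {1..Max K}" using K by (auto simp: K_def)
      show "{1..Max K} \<subseteq> K"
      proof
        fix j assume j: "j \<in> {1..Max K}"
        have "Max K \<in> K" using K by simp
        then have m: "Max K \<in> {1..card E}" "\<sigma> (Max K) \<in> T" unfolding K_def by blast+
        have "j \<in> {1..card E}" using j m(1) by simp
        moreover have "\<sigma> j \<in> T" if "j \<noteq> Max K"
          using * m j that calculation by (meson atLeastAtMost_iff le_neq_implies_less)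
        ultimately show "j \<in> K" using m(2) unfolding K_def by (metis (mono_tags, lifting) mem_Collect_eq)
      qed
    qed
    moreover have "Max K \<in> {1..card E}" using Max_in[OF K(2,1)] by (simp add: K_def)
    ultimately show False using not_prefix T by metis
  qed
  then obtain j k where jk: "j \<in> {1..card E}" "k \<in> {1..card E}" "j < k" "\<sigma> j \<notin> T" "\<sigma> k \<in> T" by blast
  have "Min (b ` T) \<le> b (\<sigma> k)" using jk finite_subset[OF assms(4,3)] by (intro Min_le) auto
  moreover have "b (\<sigma> j) \<le> Max (b ` (E - T))"
    using jk assms orderings_in[OF assms(1)] by (intro Max_ge) auto
  moreover have "b (\<sigma> k) \<le> b (\<sigma> j)" using max_cone_antimono[OF assms(2)] jk by auto
  ultimately show ?thesis using \<open>T \<noteq> E\<close> by (simp add: height_def)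
qed

text \<open>Only prefixes of \<open>\<sigma>\<close> contribute, and there the heights are
  consecutive differences, so this is summation by parts; \<open>a {} = 0\<close> is the boundary
  term at the first position.\<close>

lemma sum_height:
  fixes a :: "'a set \<Rightarrow> real"
  assumes "\<sigma> \<in> orderings E" "b \<in> max_cone E \<sigma>" "finite E" "E \<noteq> {}" "a {} = 0"
  shows "(\<Sum>T\<in>Pow E - {{}}. a T * height E T b) =
    (\<Sum>k\<in>{1..card E}. (a (\<sigma> ` {1..k}) - a (\<sigma> ` {1..k - 1})) * b (\<sigma> k))"
proof -
  let ?n = "card E" and ?p = "\<lambda>k. \<sigma> ` {1..k}"
  have n: "?n \<ge> 1" using assms by (simp add: Suc_leI card_gt_0_iff)
  have "(\<Sum>T\<in>Pow E - {{}}. a T * height E T b) = (\<Sum>T\<in>?p ` {1..?n}. a T * height E T b)"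
  proof (rule sum.mono_neutral_right)
    show "?p ` {1..?n} \<subseteq> Pow E - {{}}"
    proof
      fix T assume "T \<in> ?p ` {1..?n}"
      then obtain k where "k \<in> {1..?n}" "T = ?p k" by blast
      then show "T \<in> Pow E - {{}}" using orderings_prefix[OF assms(1), of k] by simp
    qed
    show "\<forall>T\<in>Pow E - {{}} - ?p ` {1..?n}. a T * height E T b = 0"
    proof
      fix T assume "T \<in> Pow E - {{}} - ?p ` {1..?n}"
      then have "height E T b = 0" by (intro height_not_prefix[OF assms(1-3)]) blast+
      then show "a T * height E T b = 0" by simp
    qed
  qed (use assms in auto)
  also have "\<dots> = (\<Sum>k\<in>{1..?n}. a (?p k) * height E (?p k) b)"
  proof -
    have "inj_on ?p {1..?n}"
      using orderings_prefix_inj[OF assms(1)] by (intro inj_onI) (meson atLeastAtMost_iff)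
    from sum.reindex[OF this] show ?thesis by (simp add: o_def)
  qed
  also have "\<dots> = (\<Sum>k\<in>{1..<?n}. a (?p k) * (b (\<sigma> k) - b (\<sigma> (k + 1)))) + a E * b (\<sigma> ?n)"
  proof -
    have "{1..?n} = insert ?n {1..<?n}" using n by auto
    then have "(\<Sum>k\<in>{1..?n}. a (?p k) * height E (?p k) b) =
        a (?p ?n) * height E (?p ?n) b + (\<Sum>k\<in>{1..<?n}. a (?p k) * height E (?p k) b)"
      by simp
    then show ?thesis
      using height_prefix[OF assms(1-3)] height_top[OF assms(1-4)] orderings_image[OF assms(1)]
      by simp
  qed
  also have "\<dots> = (\<Sum>k\<in>{1..?n}. (a (?p k) - a (?p (k - 1))) * b (\<sigma> k))"
  proof -
    have "(\<Sum>k\<in>{1..<m}. a (?p k) * (b (\<sigma> k) - b (\<sigma> (k + 1)))) + a (?p m) * b (\<sigma> m) =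
        (\<Sum>k\<in>{1..m}. (a (?p k) - a (?p (k - 1))) * b (\<sigma> k))" if "m \<ge> 1" for m
      using that
    proof (induction m rule: dec_induct)
      case base
      then show ?case using assms(5) by simp
    next
      case (step m)
      then show ?case by (simp add: algebra_simps)
    qed
    from this[OF n] show ?thesis using orderings_image[OF assms(1)] by simp
  qed
  finally show ?thesis .
qed

section \<open>Integral linear functions and the basis of the functions
  \<open>delta E T\<close>\<close>

lemma integral_linearI:
  fixes c :: "'a \<Rightarrow> int"
  assumes "\<And>b. b \<in> RE E \<Longrightarrow> m b = (\<Sum>i\<in>E. of_int (c i) * b i)"
  shows "integral_linear E m"
  unfolding integral_linear_def
proof (intro conjI ballI allI)
  fix b c assume "b \<in> RE E" "c \<in> RE E"
  moreover from this have "(\<lambda>i. b i + c i) \<in> RE E" by (simp add: RE_def)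
  ultimately show "m (\<lambda>i. b i + c i) = m b + m c"
    by (simp add: assms[of "\<lambda>i. b i + c i"] assms[of b] assms[of c] sum.distrib distrib_left)
next
  fix t b assume "b \<in> RE E"
  moreover from this have "(\<lambda>i. t * b i) \<in> RE E" by (simp add: RE_def)
  ultimately show "m (\<lambda>i. t * b i) = t * m b"
    by (simp add: assms[of "\<lambda>i. t * b i"] assms[of b] sum_distrib_left mult.left_commute)
next
  fix b assume "b \<in> ZE E"
  then show "m b \<in> \<int>" by (auto simp: assms[of b] ZE_def intro!: Ints_sum Ints_mult)
qed

lemma integral_linearE:
  assumes m: "integral_linear E m" and fin: "finite E"
  obtains c :: "'a \<Rightarrow> int" where "\<And>b. b \<in> RE E \<Longrightarrow> m b = (\<Sum>i\<in>E. of_int (c i) * b i)"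
proof -
  have unit: "indicator {i} \<in> RE E" "indicator {i} \<in> ZE E" if "i \<in> E" for i
    using that by (auto simp: RE_def ZE_def indicator_def)
  have rep: "m b = (\<Sum>i\<in>S. m (indicator {i}) * b i)" if "S \<subseteq> E" "b \<in> RE S" for S b
    using finite_subset[OF that(1) fin] that
  proof (induction S arbitrary: b rule: finite_induct)
    case empty
    then have "b = (\<lambda>_. 0)" "b \<in> RE E" by (auto simp: RE_def)
    then have "m b = m (\<lambda>i. 0 * b i)" by auto
    also have "\<dots> = 0 * m b" using m \<open>b \<in> RE E\<close> unfolding integral_linear_def by blast
    finally show ?case by simp
  next
    case (insert j S)
    define b' where "b' = (\<lambda>i. if i = j then 0 else b i)"
    have b': "b' \<in> RE S" using insert by (auto simp: RE_def b'_def)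
    then have "b' \<in> RE E" using insert by (auto simp: RE_def)
    have u: "(\<lambda>i. b j * indicator {j} i) \<in> RE E" using insert by (auto simp: RE_def indicator_def)
    have "b = (\<lambda>i. b' i + b j * indicator {j} i)" by (auto simp: b'_def)
    then have "m b = m b' + m (\<lambda>i. b j * indicator {j} i)"
      using m \<open>b' \<in> RE E\<close> u unfolding integral_linear_def by metis
    also have "m (\<lambda>i. b j * indicator {j} i) = b j * m (indicator {j})"
      using m unit[of j] insert unfolding integral_linear_def by (metis insert_subset)
    also have "m b' = (\<Sum>i\<in>S. m (indicator {i}) * b' i)" using insert b' by (intro insert.IH) auto
    also have "\<dots> = (\<Sum>i\<in>S. m (indicator {i}) * b i)"
      using insert by (intro sum.cong) (auto simp: b'_def)
    finally show ?case using insert by simp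
  qed
  have int: "m (indicator {i}) \<in> \<int>" if "i \<in> E" for i
    using m unit[OF that] unfolding integral_linear_def by blast
  show thesis
  proof
    fix b assume "b \<in> RE E"
    then have "m b = (\<Sum>i\<in>E. m (indicator {i}) * b i)" by (intro rep) auto
    also have "\<dots> = (\<Sum>i\<in>E. of_int \<lfloor>m (indicator {i})\<rfloor> * b i)"
      using int by (intro sum.cong) (auto elim: Ints_cases)
    finally show "m b = (\<Sum>i\<in>E. of_int \<lfloor>m (indicator {i})\<rfloor> * b i)" .
  qed
qed

lemma sum_orderings:
  assumes "\<sigma> \<in> orderings E"
  shows "(\<Sum>i\<in>E. g i) = (\<Sum>k\<in>{1..card E}. g (\<sigma> k))"
  using assms sum.reindex_bij_betw[of \<sigma> "{1..card E}" E g] by (simp add: orderings_def)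

text \<open>The combination formed in \<open>delta_comb\<close>, but with the explicit functions
  \<open>height\<close> in place of the descriptions \<open>delta\<close>. The empty set is left out
  of the sum; \<open>a {} = 0\<close> is the normalization under which the coefficients on a cone
  are increments of \<open>a\<close>.\<close>

definition pl_comb :: "'a set \<Rightarrow> ('a set \<Rightarrow> int) \<Rightarrow> ('a \<Rightarrow> real) \<Rightarrow> real" where
  "pl_comb E a = (\<lambda>b\<in>RE E. \<Sum>T\<in>Pow E - {{}}. of_int (a T) * height E T b)"

lemma pl_comb_cong: "(\<And>T. T \<subseteq> E \<Longrightarrow> T \<noteq> {} \<Longrightarrow> a T = a' T) \<Longrightarrow> pl_comb E a = pl_comb E a'"
  unfolding pl_comb_def by (intro restrict_ext sum.cong) auto

lemma pl_comb_max_cone: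
  assumes "\<sigma> \<in> orderings E" "b \<in> max_cone E \<sigma>" "finite E" "E \<noteq> {}" "a {} = 0"
  shows "pl_comb E a b =
    (\<Sum>k\<in>{1..card E}. of_int (a (\<sigma> ` {1..k}) - a (\<sigma> ` {1..k - 1})) * b (\<sigma> k))"
proof -
  have "b \<in> RE E" using assms by (simp add: max_cone_def)
  then show ?thesis using sum_height[OF assms(1-4), of "\<lambda>T. of_int (a T)"] assms(5)
    by (simp add: pl_comb_def)
qed

lemma braid_fan_subset: "C \<in> braid_fan E \<Longrightarrow> \<exists>\<sigma>\<in>orderings E. C \<subseteq> max_cone E \<sigma>"
  unfolding braid_fan_def by auto

lemma max_cone_in_braid_fan: "\<sigma> \<in> orderings E \<Longrightarrow> max_cone E \<sigma> \<in> braid_fan E"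
  unfolding braid_fan_def by (auto intro!: exI[of _ \<sigma>] exI[of _ "{}"])

lemma pl_comb_linear:
  assumes "\<sigma> \<in> orderings E" "finite E" "E \<noteq> {}"
  shows "\<exists>m. integral_linear E m \<and> (\<forall>b\<in>max_cone E \<sigma>. pl_comb E a b = m b)"
proof -
  \<comment> \<open>The value at the empty set does not enter \<open>pl_comb\<close>; resetting it
    makes \<open>pl_comb_max_cone\<close> applicable.\<close>
  let ?a = "a({} := 0)"
  define c where "c i = (let k = the_inv_into {1..card E} \<sigma> i in ?a (\<sigma> ` {1..k}) - ?a (\<sigma> ` {1..k - 1}))" for i
  let ?m = "\<lambda>b. \<Sum>i\<in>E. of_int (c i) * b i :: real"
  have "pl_comb E a b = ?m b" if "b \<in> max_cone E \<sigma>" for b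
  proof -
    have "pl_comb E a b = pl_comb E ?a b" by (metis pl_comb_cong fun_upd_other)
    also have "\<dots> = (\<Sum>k\<in>{1..card E}. of_int (?a (\<sigma> ` {1..k}) - ?a (\<sigma> ` {1..k - 1})) * b (\<sigma> k))"
      by (rule pl_comb_max_cone[OF assms(1) that assms(2,3)]) simp
    also have "\<dots> = (\<Sum>k\<in>{1..card E}. of_int (c (\<sigma> k)) * b (\<sigma> k))"
      using the_inv_into_f_f[OF orderings_inj[OF assms(1)]]
      by (intro sum.cong refl) (simp add: c_def Let_def)
    finally show ?thesis by (simp add: sum_orderings[OF assms(1)])
  qed
  moreover have "integral_linear E ?m" by (rule integral_linearI) simp
  ultimately show ?thesis by blast
qed

lemma pl_comb_PLin:
  assumes "finite E" "E \<noteq> {}"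
  shows "pl_comb E a \<in> PLin E"
proof -
  have "\<exists>m. integral_linear E m \<and> (\<forall>b\<in>C. pl_comb E a b = m b)" if "C \<in> braid_fan E" for C
    using braid_fan_subset[OF that] pl_comb_linear[OF _ assms] by (meson subsetD)
  then show ?thesis by (simp add: PLin_def pl_comb_def)
qed

lemma indicator_RE: "S \<subseteq> E \<Longrightarrow> indicator S \<in> RE E"
  by (auto simp: RE_def indicator_def)

lemma height_indicator:
  assumes "finite E" "T \<subseteq> E" "T \<noteq> {}" "S \<subseteq> E" "S \<noteq> {}"
  shows "height E T (indicator S) = of_bool (T = S)"
proof -
  have fin: "finite T" using assms finite_subset by blast
  have mn: "Min (indicator S ` T :: real set) = of_bool (T \<subseteq> S)" if "finite T" "T \<noteq> {}" for T
  proof (cases "T \<subseteq> S")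
    case True
    then have "indicator S ` T = {1::real}" using that by (auto simp: indicator_def)
    then show ?thesis using True by simp
  next
    case False
    then show ?thesis using that by (auto intro!: Min_eqI) (auto simp: indicator_def image_iff)
  qed
  have mx: "Max (indicator S ` U :: real set) = of_bool (U \<inter> S \<noteq> {})" if "finite U" "U \<noteq> {}" for U
  proof (cases "U \<inter> S = {}")
    case True
    then have "indicator S ` U = {0::real}" using that by (force simp: indicator_def)
    then show ?thesis using True by simp
  next
    case False
    then show ?thesis using that by (auto intro!: Max_eqI) (auto simp: indicator_def image_iff)
  qed
  show ?thesis
  proof (cases "T = E")
    case True
    then show ?thesis using assms mn[of E] by (auto simp: height_def)
  next
    case False
    then have "finite (E - T)" "E - T \<noteq> {}" using assms by auto
    then show ?thesis using False assms mn[OF fin] mx by (auto simp: height_def)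
  qed
qed

lemma pl_comb_indicator:
  assumes "finite E" "S \<subseteq> E" "S \<noteq> {}"
  shows "pl_comb E a (indicator S) = of_int (a S)"
proof -
  have "pl_comb E a (indicator S) = (\<Sum>T\<in>Pow E - {{}}. of_int (a T) * of_bool (T = S))"
    using assms indicator_RE height_indicator[OF assms(1) _ _ assms(2,3)] by (auto simp: pl_comb_def)
  also have "\<dots> = of_int (a S)"
    using assms by (subst sum.remove[of _ S]) (auto intro: sum.neutral)
  finally show ?thesis .
qed

lemma indicator_prefix_max_cone:
  assumes "\<sigma> \<in> orderings E" "k \<le> card E"
  shows "indicator (\<sigma> ` {1..k}) \<in> max_cone E \<sigma>"
proof -
  have "\<sigma> i \<in> \<sigma> ` {1..k}" if "i \<in> {1..<card E}" "\<sigma> (i + 1) \<in> \<sigma> ` {1..k}" for i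
    using that orderings_prefix_mem[OF assms(1) _ assms(2), of "i + 1"] by auto
  then show ?thesis
    using indicator_RE[OF orderings_prefix[OF assms]] by (simp add: max_cone_def indicator_def)
qed

text \<open>On the cone of \<open>\<sigma>\<close> a linear function is determined by its values at
  the indicators of the prefixes of \<open>\<sigma>\<close>, and these values serve as
  coefficients.\<close>

lemma PLin_eq_pl_comb:
  assumes "finite E" "E \<noteq> {}" "f \<in> PLin E"
  obtains a where "f = pl_comb E a"
proof
  \<comment> \<open>The values at prefixes are sums of integers, so the floor only changes the
    type.\<close>
  let ?a = "\<lambda>T. \<lfloor>f (indicator T)\<rfloor>"
  show "f = pl_comb E ?a"
  proof
    fix b
    show "f b = pl_comb E ?a b"
    proof (cases "b \<in> RE E")
      case False
      then show ?thesis using assms(3) by (simp add: PLin_def pl_comb_def extensional_def)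
    next
      case True
      then obtain \<sigma> where \<sigma>: "\<sigma> \<in> orderings E" "b \<in> max_cone E \<sigma>" using max_cone_exists assms by blast
      then obtain m where m: "integral_linear E m" "\<And>b. b \<in> max_cone E \<sigma> \<Longrightarrow> f b = m b"
        using assms(3) max_cone_in_braid_fan[OF \<sigma>(1)] unfolding PLin_def by (smt (verit) mem_Collect_eq)
      from integral_linearE[OF m(1) assms(1)] obtain c :: "'a \<Rightarrow> int"
        where c: "\<And>b. b \<in> RE E \<Longrightarrow> m b = (\<Sum>i\<in>E. of_int (c i) * b i)" by blast
      have pre: "f (indicator (\<sigma> ` {1..k})) = (\<Sum>j\<in>{1..k}. of_int (c (\<sigma> j)))" if "k \<le> card E" for k
      proof -
        have "f (indicator (\<sigma> ` {1..k})) = (\<Sum>i\<in>E. of_int (c i) * indicator (\<sigma> ` {1..k}) i)"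
          using indicator_prefix_max_cone[OF \<sigma>(1) that] m c by (simp add: max_cone_def)
        also have "\<dots> = (\<Sum>j\<in>{1..card E}. of_int (c (\<sigma> j)) * of_bool (j \<le> k))"
          unfolding sum_orderings[OF \<sigma>(1)]
          using orderings_prefix_mem[OF \<sigma>(1) _ that] by (intro sum.cong) (auto simp: indicator_def)
        also have "\<dots> = (\<Sum>j\<in>{1..k}. of_int (c (\<sigma> j)))"
          using that by (intro sum.mono_neutral_cong_right) auto
        finally show ?thesis .
      qed
      let ?b = "?a({} := 0)"
      have "pl_comb E ?a b = pl_comb E ?b b" by (metis pl_comb_cong fun_upd_other)
      also have "\<dots> = (\<Sum>k\<in>{1..card E}. of_int (?b (\<sigma> ` {1..k}) - ?b (\<sigma> ` {1..k - 1})) * b (\<sigma> k))"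
        by (rule pl_comb_max_cone[OF \<sigma> assms(1,2)]) simp
      also have "\<dots> = (\<Sum>k\<in>{1..card E}. of_int (c (\<sigma> k)) * b (\<sigma> k))"
      proof (rule sum.cong[OF refl])
        fix k assume k: "k \<in> {1..card E}"
        have eq: "?b (\<sigma> ` {1..j}) = (\<Sum>i\<in>{1..j}. c (\<sigma> i))" if "j \<le> card E" for j
          using pre[OF that] that by (cases "j = 0") (auto simp flip: of_int_sum)
        have "?b (\<sigma> ` {1..k}) - ?b (\<sigma> ` {1..k - 1}) = (\<Sum>i\<in>{1..k}. c (\<sigma> i)) - (\<Sum>i\<in>{1..k - 1}. c (\<sigma> i))"
        proof -
          have "k \<le> card E" "k - 1 \<le> card E" using k by auto
          then show ?thesis using eq by metis
        qed
        also have "\<dots> = c (\<sigma> k)" using k by (cases k) auto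
        finally have "?b (\<sigma> ` {1..k}) - ?b (\<sigma> ` {1..k - 1}) = c (\<sigma> k)" .
        then show "of_int (?b (\<sigma> ` {1..k}) - ?b (\<sigma> ` {1..k - 1})) * b (\<sigma> k) = of_int (c (\<sigma> k)) * b (\<sigma> k)"
          by simp
      qed
      also have "\<dots> = f b"
        using m(2) \<sigma>(2) c[OF True] sum_orderings[OF \<sigma>(1), of "\<lambda>i. of_int (c i) * b i"] by simp
      finally show ?thesis by simp
    qed
  qed
qed

lemma pl_comb_eq_iff:
  assumes "finite E"
  shows "pl_comb E a = pl_comb E a' \<longleftrightarrow> (\<forall>T. T \<subseteq> E \<longrightarrow> T \<noteq> {} \<longrightarrow> a T = a' T)"
  using pl_comb_indicator[OF assms] pl_comb_cong[of E a a'] by (metis of_int_eq_iff)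

lemma delta_eq:
  assumes "finite E" "T \<subseteq> E" "T \<noteq> {}"
  shows "delta E T = pl_comb E (\<lambda>S. of_bool (S = T))"
  unfolding delta_def
proof (rule the_equality)
  have ne: "E \<noteq> {}" using assms by auto
  show "pl_comb E (\<lambda>S. of_bool (S = T)) \<in> PLin E \<and>
    pl_comb E (\<lambda>S. of_bool (S = T)) (indicator T) = 1 \<and>
    (\<forall>S. S \<noteq> {} \<longrightarrow> S \<subseteq> E \<longrightarrow> S \<noteq> T \<longrightarrow> pl_comb E (\<lambda>S. of_bool (S = T)) (indicator S) = 0)"
    using assms ne by (auto simp: pl_comb_PLin pl_comb_indicator)
  fix f assume f: "f \<in> PLin E \<and> f (indicator T) = 1 \<and>
    (\<forall>S. S \<noteq> {} \<longrightarrow> S \<subseteq> E \<longrightarrow> S \<noteq> T \<longrightarrow> f (indicator S) = 0)"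
  then obtain a where a: "f = pl_comb E a" using PLin_eq_pl_comb[OF assms(1) ne] by blast
  show "f = pl_comb E (\<lambda>S. of_bool (S = T))"
    unfolding a
  proof (rule pl_comb_cong)
    fix S assume "S \<subseteq> E" "S \<noteq> {}"
    then have "real_of_int (a S) = of_bool (S = T)"
      using f a pl_comb_indicator[OF assms(1), of S a] by auto
    then show "a S = of_bool (S = T)" by (cases "S = T") simp_all
  qed
qed

lemma delta_apply:
  assumes "finite E" "T \<subseteq> E" "T \<noteq> {}" "b \<in> RE E"
  shows "delta E T b = height E T b"
proof -
  have "delta E T b = (\<Sum>S\<in>Pow E - {{}}. of_bool (S = T) * height E S b)"
    using assms by (simp add: delta_eq pl_comb_def)
  also have "\<dots> = height E T b"
    using assms by (subst sum.remove[of _ T]) (auto intro: sum.neutral)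
  finally show ?thesis .
qed

lemma delta_comb_eq: "finite E \<Longrightarrow> delta_comb E a = pl_comb E a"
  unfolding delta_comb_def pl_comb_def by (intro restrict_ext sum.cong) (auto simp: delta_apply)

lemma delta_coeff_pl_comb:
  assumes "finite E" "T \<subseteq> E" "T \<noteq> {}"
  shows "delta_coeff E (pl_comb E a) T = a T"
proof -
  have "delta_coeff E (pl_comb E a) = restrict a (Pow E - {{}})"
    unfolding delta_coeff_def
  proof (rule the_equality)
    show "restrict a (Pow E - {{}}) \<in> extensional (Pow E - {{}}) \<and>
      pl_comb E a = delta_comb E (restrict a (Pow E - {{}}))"
      using assms(1) pl_comb_cong[of E a "restrict a (Pow E - {{}})"] by (simp add: delta_comb_eq)
    fix a' assume "a' \<in> extensional (Pow E - {{}}) \<and> pl_comb E a = delta_comb E a'"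
    then show "a' = restrict a (Pow E - {{}})"
      using assms by (auto simp: delta_comb_eq pl_comb_eq_iff extensional_def)
  qed
  then show ?thesis using assms by simp
qed

section \<open>The K-ring\<close>

text \<open>The condition that \<open>PExp\<close> imposes on a single cone, isolated so that
  closure under the ring operations can be proved cone by cone.\<close>

definition exp_sum :: "'a set \<Rightarrow> ('a \<Rightarrow> real) set \<Rightarrow> (('a \<Rightarrow> real) \<Rightarrow> real) \<Rightarrow> bool" where
  "exp_sum E C f \<longleftrightarrow> (\<exists>(k::nat) (a::nat \<Rightarrow> int) m. (\<forall>j<k. integral_linear E (m j)) \<and>
    (\<forall>b\<in>C. f b = (\<Sum>j<k. of_int (a j) * exp (m j b))))"

lemma exp_sum_cong: "exp_sum E C f \<Longrightarrow> (\<And>b. b \<in> C \<Longrightarrow> g b = f b) \<Longrightarrow> exp_sum E C g"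
  unfolding exp_sum_def by simp

lemma exp_sum_zero: "exp_sum E C (\<lambda>_. 0)"
  unfolding exp_sum_def by (rule exI[of _ 0]) simp

lemma exp_sum_add_term:
  assumes "exp_sum E C f" "integral_linear E l"
  shows "exp_sum E C (\<lambda>b. f b + of_int c * exp (l b))"
proof -
  obtain k and a :: "nat \<Rightarrow> int" and m where km: "\<forall>j<k. integral_linear E (m j)"
    "\<forall>b\<in>C. f b = (\<Sum>j<k. of_int (a j) * exp (m j b))"
    using assms(1) unfolding exp_sum_def by blast
  show ?thesis
    unfolding exp_sum_def
  proof (intro exI[of _ "Suc k"] exI[of _ "a(k := c)"] exI[of _ "m(k := l)"] conjI ballI)
    show "\<forall>j<Suc k. integral_linear E ((m(k := l)) j)" using km(1) assms(2) by (auto simp: less_Suc_eq)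
    show "f b + of_int c * exp (l b) = (\<Sum>j<Suc k. of_int ((a(k := c)) j) * exp ((m(k := l)) j b))"
      if "b \<in> C" for b using km(2) that by simp
  qed
qed

text \<open>Induction on the number of exponential terms. The case \<open>cong\<close> is there
  because only the values on \<open>C\<close> are prescribed.\<close>

lemma exp_sum_induct [consumes 1, case_names zero add_term cong]:
  assumes "exp_sum E C f"
    and zero: "P (\<lambda>_. 0)"
    and add: "\<And>f l c. P f \<Longrightarrow> integral_linear E l \<Longrightarrow> P (\<lambda>b. f b + of_int c * exp (l b))"
    and cong: "\<And>f g. P f \<Longrightarrow> (\<And>b. b \<in> C \<Longrightarrow> g b = f b) \<Longrightarrow> P g"
  shows "P f"
proof -
  obtain k and a :: "nat \<Rightarrow> int" and m where km: "\<forall>j<k. integral_linear E (m j)"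
    "\<forall>b\<in>C. f b = (\<Sum>j<k. of_int (a j) * exp (m j b))"
    using assms(1) unfolding exp_sum_def by blast
  have "P (\<lambda>b. \<Sum>j<k'. of_int (a j) * exp (m j b))" if "k' \<le> k" for k'
    using that
  proof (induction k')
    case (Suc k')
    then show ?case using add[of "\<lambda>b. \<Sum>j<k'. of_int (a j) * exp (m j b)" "m k'" "a k'"] km(1) by simp
  qed (simp add: zero)
  from cong[OF this[OF order_refl]] km(2) show ?thesis by blast
qed

lemma exp_sum_add: "exp_sum E C g \<Longrightarrow> exp_sum E C f \<Longrightarrow> exp_sum E C (\<lambda>b. f b + g b)"
proof (induction g rule: exp_sum_induct)
  case (add_term g l c)
  then have "exp_sum E C (\<lambda>b. (f b + g b) + of_int c * exp (l b))" by (intro exp_sum_add_term) auto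
  then show ?case by (simp add: add.assoc)
next
  case (cong g g')
  then show ?case by (auto intro: exp_sum_cong)
qed simp

lemma integral_linear_add:
  assumes "integral_linear E m" "integral_linear E l"
  shows "integral_linear E (\<lambda>b. m b + l b)"
  using assms unfolding integral_linear_def by (auto simp: algebra_simps)

lemma integral_linear_zero: "integral_linear E (\<lambda>_. 0)"
  unfolding integral_linear_def by auto

lemma exp_sum_mult_term:
  assumes "exp_sum E C f" "integral_linear E l"
  shows "exp_sum E C (\<lambda>b. f b * (of_int c * exp (l b)))"
  using assms(1)
proof (induction f rule: exp_sum_induct)
  case (add_term f m d)
  have "exp_sum E C (\<lambda>b. f b * (of_int c * exp (l b)) + of_int (d * c) * exp (m b + l b))"
    using add_term assms(2) by (intro exp_sum_add_term integral_linear_add) auto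
  then show ?case by (simp add: algebra_simps exp_add)
next
  case (cong f f')
  then show ?case by (auto intro: exp_sum_cong)
qed (simp add: exp_sum_zero)

lemma exp_sum_mult: "exp_sum E C g \<Longrightarrow> exp_sum E C f \<Longrightarrow> exp_sum E C (\<lambda>b. f b * g b)"
proof (induction g rule: exp_sum_induct)
  case zero
  then show ?case by (simp add: exp_sum_zero)
next
  case (add_term g l c)
  then have "exp_sum E C (\<lambda>b. f b * g b + f b * (of_int c * exp (l b)))"
    by (intro exp_sum_add exp_sum_mult_term) auto
  then show ?case by (simp add: algebra_simps)
next
  case (cong g g')
  then show ?case by (auto intro: exp_sum_cong)
qed

lemma exp_sum_exp: "integral_linear E l \<Longrightarrow> exp_sum E C (\<lambda>b. exp (l b))"
  using exp_sum_add_term[OF exp_sum_zero, of E l C 1] by simp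

lemma exp_sum_const: "exp_sum E C (\<lambda>_. of_int c)"
  using exp_sum_add_term[OF exp_sum_zero integral_linear_zero, of E C c] by simp

lemma exp_sum_uminus: "exp_sum E C f \<Longrightarrow> exp_sum E C (\<lambda>b. - f b)"
  using exp_sum_mult[of E C f "\<lambda>_. of_int (-1)"] exp_sum_const[of E C "-1"] by simp

lemma PExp_carrier_iff:
  "f \<in> carrier (PExp M) \<longleftrightarrow>
    f \<in> extensional (fan_support M) \<and> (\<forall>C\<in>matroid_fan M. exp_sum (ground M) C f)"
  unfolding PExp_def exp_sum_def by simp

lemma restrict_PExp_iff:
  "restrict g (fan_support M) \<in> carrier (PExp M) \<longleftrightarrow> (\<forall>C\<in>matroid_fan M. exp_sum (ground M) C g)"
proof -
  have "restrict g (fan_support M) b = g b" if "C \<in> matroid_fan M" "b \<in> C" for C b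
    using that by (auto simp: fan_support_def)
  then show ?thesis
    unfolding PExp_carrier_iff by (metis exp_sum_cong restrict_extensional)
qed

lemma PExp_simps:
  "f \<otimes>\<^bsub>PExp M\<^esub> g = (\<lambda>b\<in>fan_support M. f b * g b)"
  "f \<oplus>\<^bsub>PExp M\<^esub> g = (\<lambda>b\<in>fan_support M. f b + g b)"
  "\<one>\<^bsub>PExp M\<^esub> = (\<lambda>b\<in>fan_support M. 1)" "\<zero>\<^bsub>PExp M\<^esub> = (\<lambda>b\<in>fan_support M. 0)"
  by (simp_all add: PExp_def)

lemma PExp_cring: "cring (PExp M)"
proof (rule cringI)
  have closed: "(\<lambda>b\<in>fan_support M. h b) \<in> carrier (PExp M)"
    if "\<And>C. C \<in> matroid_fan M \<Longrightarrow> exp_sum (ground M) C h" for h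
    using that by (simp add: restrict_PExp_iff)
  have es: "exp_sum (ground M) C f" if "f \<in> carrier (PExp M)" "C \<in> matroid_fan M" for f C
    using that by (simp add: PExp_carrier_iff)
  show "abelian_group (PExp M)"
  proof (rule abelian_groupI)
    show "\<zero>\<^bsub>PExp M\<^esub> \<in> carrier (PExp M)"
      unfolding PExp_simps by (intro closed exp_sum_zero)
    show "f \<oplus>\<^bsub>PExp M\<^esub> g \<in> carrier (PExp M)"
      if "f \<in> carrier (PExp M)" "g \<in> carrier (PExp M)" for f g
      unfolding PExp_simps using that by (intro closed exp_sum_add es)
  next
    fix f assume f: "f \<in> carrier (PExp M)"
    let ?g = "\<lambda>b\<in>fan_support M. - f b"
    have "?g \<in> carrier (PExp M)" using f by (intro closed exp_sum_uminus es)
    moreover have "?g \<oplus>\<^bsub>PExp M\<^esub> f = \<zero>\<^bsub>PExp M\<^esub>" by (auto simp: PExp_simps)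
    ultimately show "\<exists>g\<in>carrier (PExp M). g \<oplus>\<^bsub>PExp M\<^esub> f = \<zero>\<^bsub>PExp M\<^esub>" by blast
    show "\<zero>\<^bsub>PExp M\<^esub> \<oplus>\<^bsub>PExp M\<^esub> f = f"
      using f by (auto simp: PExp_simps PExp_carrier_iff extensional_def)
  qed (auto simp: PExp_simps algebra_simps intro!: restrict_ext)
  show "Group.comm_monoid (PExp M)"
  proof (rule comm_monoidI)
    show "\<one>\<^bsub>PExp M\<^esub> \<otimes>\<^bsub>PExp M\<^esub> f = f" if "f \<in> carrier (PExp M)" for f
      using that by (auto simp: PExp_simps PExp_carrier_iff extensional_def)
    show "\<one>\<^bsub>PExp M\<^esub> \<in> carrier (PExp M)"
      unfolding PExp_simps using exp_sum_const[of "ground M" _ 1] by (intro closed) simp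
    show "f \<otimes>\<^bsub>PExp M\<^esub> g \<in> carrier (PExp M)"
      if "f \<in> carrier (PExp M)" "g \<in> carrier (PExp M)" for f g
      unfolding PExp_simps using that by (intro closed exp_sum_mult es)
  qed (auto simp: PExp_simps algebra_simps intro!: restrict_ext)
qed (auto simp: PExp_simps algebra_simps intro!: restrict_ext)

lemma Lin_exp_carrier:
  assumes "f \<in> Lin M"
  shows "(\<lambda>b\<in>fan_support M. exp (f b) - 1) \<in> carrier (PExp M)"
proof -
  obtain m where m: "f = restrict m (fan_support M)" "integral_linear (ground M) m"
    using assms unfolding Lin_def by auto
  have "(\<lambda>b\<in>fan_support M. exp (f b) - 1) = (\<lambda>b\<in>fan_support M. exp (m b) + - 1)"
    using m by auto
  moreover have "exp_sum (ground M) C (\<lambda>b. exp (m b) + - 1)" for C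
    using exp_sum_add[OF exp_sum_const exp_sum_exp[OF m(2)], of C "-1"] by simp
  ultimately show ?thesis by (simp add: restrict_PExp_iff)
qed

lemma K_ideal_ideal: "ideal (K_ideal M) (PExp M)"
proof -
  interpret cring "PExp M" by (rule PExp_cring)
  show ?thesis unfolding K_ideal_def using Lin_exp_carrier by (intro genideal_ideal) auto
qed

lemma K_ring_cring: "cring (K_ring M)"
  unfolding K_ring_def by (intro ideal.quotient_is_cring K_ideal_ideal PExp_cring)

lemma K_class_hom: "(+>\<^bsub>PExp M\<^esub>) (K_ideal M) \<in> ring_hom (PExp M) (K_ring M)"
  unfolding K_ring_def by (rule ideal.rcos_ring_hom[OF K_ideal_ideal])

definition pexp :: "'a matroid \<Rightarrow> (('a \<Rightarrow> real) \<Rightarrow> real) \<Rightarrow> bool" where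
  "pexp M g \<longleftrightarrow> restrict g (fan_support M) \<in> carrier (PExp M)"

lemma pexp_iff: "pexp M g \<longleftrightarrow> (\<forall>C\<in>matroid_fan M. exp_sum (ground M) C g)"
  by (simp add: pexp_def restrict_PExp_iff)

lemma K_class_carrier: "pexp M g \<Longrightarrow> K_class M g \<in> carrier (K_ring M)"
  unfolding K_class_def pexp_def by (rule ring_hom_closed[OF K_class_hom])

lemma K_class_cong:
  "(\<And>b. b \<in> fan_support M \<Longrightarrow> g b = h b) \<Longrightarrow> K_class M g = K_class M h"
  unfolding K_class_def by (metis restrict_ext)

lemma K_class_add:
  assumes "pexp M g" "pexp M h"
  shows "K_class M (\<lambda>b. g b + h b) = K_class M g \<oplus>\<^bsub>K_ring M\<^esub> K_class M h"
proof -
  have "restrict (\<lambda>b. g b + h b) (fan_support M) =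
      restrict g (fan_support M) \<oplus>\<^bsub>PExp M\<^esub> restrict h (fan_support M)"
    by (auto simp: PExp_simps)
  then show ?thesis
    using ring_hom_add[OF K_class_hom] assms unfolding K_class_def pexp_def by simp
qed

lemma K_class_mult:
  assumes "pexp M g" "pexp M h"
  shows "K_class M (\<lambda>b. g b * h b) = K_class M g \<otimes>\<^bsub>K_ring M\<^esub> K_class M h"
proof -
  have "restrict (\<lambda>b. g b * h b) (fan_support M) =
      restrict g (fan_support M) \<otimes>\<^bsub>PExp M\<^esub> restrict h (fan_support M)"
    by (auto simp: PExp_simps)
  then show ?thesis
    using ring_hom_mult[OF K_class_hom] assms unfolding K_class_def pexp_def by simp
qed

lemma pexp_add: "pexp M g \<Longrightarrow> pexp M h \<Longrightarrow> pexp M (\<lambda>b. g b + h b)"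
  unfolding pexp_iff by (auto intro: exp_sum_add)

text \<open>The difference of the two functions is \<open>g * (exp m - 1)\<close>, a multiple of a
  generator of \<open>K_ideal M\<close>.\<close>

lemma K_class_linear:
  assumes g: "pexp M g" and m: "integral_linear (ground M) m"
  shows "K_class M (\<lambda>b. g b * exp (m b)) = K_class M g"
proof -
  interpret I: ideal "K_ideal M" "PExp M" by (rule K_ideal_ideal)
  interpret Q: cring "K_ring M" by (rule K_ring_cring)
  let ?u = "\<lambda>b\<in>fan_support M. exp (m b) - 1"
  have "(\<lambda>b\<in>fan_support M. exp (restrict m (fan_support M) b) - 1) \<in>
      {(\<lambda>b\<in>fan_support M. exp (f b) - 1) |f. f \<in> Lin M}"
    using m unfolding Lin_def by blast
  moreover have "{(\<lambda>b\<in>fan_support M. exp (f b) - 1) |f. f \<in> Lin M} \<subseteq> K_ideal M"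
    unfolding K_ideal_def using Lin_exp_carrier by (intro I.genideal_self) auto
  moreover have "(\<lambda>b\<in>fan_support M. exp (restrict m (fan_support M) b) - 1) = ?u" by auto
  ultimately have u: "?u \<in> K_ideal M" by auto
  then have "restrict g (fan_support M) \<otimes>\<^bsub>PExp M\<^esub> ?u \<in> K_ideal M"
    using g unfolding pexp_def by (intro I.I_l_closed)
  moreover have "restrict g (fan_support M) \<otimes>\<^bsub>PExp M\<^esub> ?u =
      restrict (\<lambda>b. g b * (exp (m b) - 1)) (fan_support M)" by (auto simp: PExp_simps)
  ultimately have w: "restrict (\<lambda>b. g b * (exp (m b) - 1)) (fan_support M) \<in> K_ideal M" by simp
  then have p: "pexp M (\<lambda>b. g b * (exp (m b) - 1))" using I.Icarr by (simp add: pexp_def)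
  have "K_class M (\<lambda>b. g b * (exp (m b) - 1)) = K_ideal M"
    unfolding K_class_def using w by (rule I.a_rcos_const)
  also have "\<dots> = \<zero>\<^bsub>K_ring M\<^esub>" by (simp add: K_ring_def FactRing_def)
  finally have z: "K_class M (\<lambda>b. g b * (exp (m b) - 1)) = \<zero>\<^bsub>K_ring M\<^esub>" .
  have "K_class M (\<lambda>b. g b * exp (m b)) = K_class M (\<lambda>b. g b * (exp (m b) - 1) + g b)"
    by (simp add: algebra_simps)
  also have "\<dots> = K_class M g"
    unfolding K_class_add[OF p g] z using K_class_carrier[OF g] by (rule Q.l_zero)
  finally show ?thesis .
qed

section \<open>The matroid fan inside the braid fan\<close>

lemma RE_sum_indicator:
  assumes "\<And>F. F \<in> \<C> \<Longrightarrow> F \<subseteq> E"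
  shows "(\<lambda>i. \<Sum>F\<in>\<C>. c F * indicator F i) \<in> RE E"
  unfolding RE_def
proof (intro CollectI allI impI sum.neutral ballI)
  fix i F assume "i \<notin> E" "F \<in> \<C>"
  then have "i \<notin> F" using assms by blast
  then show "c F * indicator F i = 0" by simp
qed

text \<open>\<open>b0\<close> is the sum of the rays of the cone. As \<open>\<C>\<close> is a chain,
  \<open>b0\<close> is strictly larger on each member \<open>F\<close> than off it, so an ordering
  along which \<open>b0\<close> decreases lists \<open>F\<close> before its complement.\<close>

lemma matroid_fan_subset_max_cone:
  assumes M: "is_matroid M" and C: "C \<in> matroid_fan M"
  shows "\<exists>\<sigma>\<in>orderings (ground M). C \<subseteq> max_cone (ground M) \<sigma>"
proof -
  let ?E = "ground M"
  obtain \<C> where \<C>: "C = ray_cone \<C>" "\<And>F. F \<in> \<C> \<Longrightarrow> is_flat M F \<and> F \<noteq> {}"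
    "\<And>F G. F \<in> \<C> \<Longrightarrow> G \<in> \<C> \<Longrightarrow> F \<subseteq> G \<or> G \<subseteq> F"
    using C unfolding matroid_fan_def by auto
  have sub: "F \<subseteq> ?E" if "F \<in> \<C>" for F using \<C>(2)[OF that] by (simp add: is_flat_def)
  have fin: "finite \<C>" using sub finite_subset[of \<C> "Pow ?E"] matroid_finite[OF M] by auto
  define b0 :: "'a \<Rightarrow> real" where "b0 i = (\<Sum>F\<in>\<C>. indicator F i)" for i
  have RE: "(\<lambda>i. \<Sum>F\<in>\<C>. c F * indicator F i) \<in> RE ?E" for c :: "'a set \<Rightarrow> real"
    using sub by (rule RE_sum_indicator)
  have "b0 = (\<lambda>i. \<Sum>F\<in>\<C>. 1 * indicator F i)" by (simp add: b0_def fun_eq_iff)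
  then have "b0 \<in> RE ?E" using RE[of "\<lambda>_. 1"] by (simp only:)
  then obtain \<sigma> where \<sigma>: "\<sigma> \<in> orderings ?E" "b0 \<in> max_cone ?E \<sigma>"
    using max_cone_exists matroid_finite[OF M] by blast
  have prefix: "\<sigma> i \<in> F" if F: "F \<in> \<C>" and i: "i \<in> {1..<card ?E}" and mem: "\<sigma> (i + 1) \<in> F" for F i
  proof (rule ccontr)
    assume n: "\<sigma> i \<notin> F"
    have le: "indicator G (\<sigma> i) \<le> (indicator G (\<sigma> (i + 1)) :: real)" if "G \<in> \<C>" for G
      using \<C>(3)[OF F that] n mem by (auto simp: indicator_def)
    have "b0 (\<sigma> i) < b0 (\<sigma> (i + 1))"
      unfolding b0_def using F n mem fin le by (intro sum_strict_mono_ex1) (auto intro!: bexI[of _ F])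
    moreover have "b0 (\<sigma> (i + 1)) \<le> b0 (\<sigma> i)" using \<sigma>(2) i unfolding max_cone_def by blast
    ultimately show False by simp
  qed
  have "C \<subseteq> max_cone ?E \<sigma>"
  proof
    fix b assume "b \<in> C"
    then obtain c where c: "\<And>F. F \<in> \<C> \<Longrightarrow> c F \<ge> 0" "b = (\<lambda>i. \<Sum>F\<in>\<C>. c F * indicator F i)"
      unfolding \<C>(1) ray_cone_def by auto
    show "b \<in> max_cone ?E \<sigma>"
      unfolding max_cone_def
    proof (intro CollectI conjI ballI)
      show "b \<in> RE ?E" unfolding c(2) by (rule RE)
      fix i assume i: "i \<in> {1..<card ?E}"
      show "b (\<sigma> (i + 1)) \<le> b (\<sigma> i)"
        unfolding c(2) using prefix[OF _ i] c(1) by (intro sum_mono mult_left_mono) (auto simp: indicator_def)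
    qed
  qed
  then show ?thesis using \<sigma> by blast
qed

lemma fan_support_RE: "is_matroid M \<Longrightarrow> b \<in> fan_support M \<Longrightarrow> b \<in> RE (ground M)"
  unfolding fan_support_def using matroid_fan_subset_max_cone by (fastforce simp: max_cone_def)

lemma PLin_matroid_fan_linear:
  assumes "is_matroid M" "f \<in> PLin (ground M)" "C \<in> matroid_fan M"
  shows "\<exists>m. integral_linear (ground M) m \<and> (\<forall>b\<in>C. f b = m b)"
proof -
  obtain \<sigma> where \<sigma>: "\<sigma> \<in> orderings (ground M)" "C \<subseteq> max_cone (ground M) \<sigma>"
    using matroid_fan_subset_max_cone assms by blast
  from assms(2) max_cone_in_braid_fan[OF \<sigma>(1)]
  have "\<exists>m. integral_linear (ground M) m \<and> (\<forall>b\<in>max_cone (ground M) \<sigma>. f b = m b)"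
    unfolding PLin_def by blast
  then show ?thesis using \<sigma>(2) by (meson subsetD)
qed

lemma PLin_pexp:
  assumes "is_matroid M" "f \<in> PLin (ground M)"
  shows "pexp M (\<lambda>b. exp (f b))"
  unfolding pexp_iff
proof
  fix C assume C: "C \<in> matroid_fan M"
  obtain m where m: "integral_linear (ground M) m" "\<forall>b\<in>C. f b = m b"
    using PLin_matroid_fan_linear[OF assms C] by blast
  then show "exp_sum (ground M) C (\<lambda>b. exp (f b))"
    by (intro exp_sum_cong[OF exp_sum_exp[OF m(1)]]) auto
qed

lemma integral_linear_plusD:
  "integral_linear E m \<Longrightarrow> b \<in> RE E \<Longrightarrow> c \<in> RE E \<Longrightarrow> m (\<lambda>i. b i + c i) = m b + m c"
  unfolding integral_linear_def by simp

lemma integral_linear_scaleD: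
  "integral_linear E m \<Longrightarrow> b \<in> RE E \<Longrightarrow> m (\<lambda>i. t * b i) = t * m b"
  unfolding integral_linear_def by simp

lemma integral_linear_sum:
  assumes m: "integral_linear E m" and "finite \<C>" "\<And>F. F \<in> \<C> \<Longrightarrow> F \<subseteq> E"
  shows "m (\<lambda>i. \<Sum>F\<in>\<C>. c F * indicator F i) = (\<Sum>F\<in>\<C>. c F * m (indicator F))"
  using assms(2,3)
proof (induction \<C> rule: finite_induct)
  case empty
  have "m (\<lambda>i. 0 * (\<lambda>_. 0) i) = 0 * m (\<lambda>_. 0)"
    by (rule integral_linear_scaleD[OF m]) (simp add: RE_def)
  then show ?case by simp
next
  case (insert F \<C>)
  have 1: "(\<lambda>i. c F * indicator F i) \<in> RE E" "(\<lambda>i. \<Sum>F\<in>\<C>. c F * indicator F i) \<in> RE E"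
    using RE_sum_indicator[of \<C> E c] RE_sum_indicator[of "{F}" E c] insert.prems by simp_all
  have "m (\<lambda>i. \<Sum>F\<in>insert F \<C>. c F * indicator F i) =
      m (\<lambda>i. c F * indicator F i + (\<Sum>F\<in>\<C>. c F * indicator F i))" using insert by simp
  also have "\<dots> = m (\<lambda>i. c F * indicator F i) + m (\<lambda>i. \<Sum>F\<in>\<C>. c F * indicator F i)"
    by (rule integral_linear_plusD[OF m 1])
  also have "m (\<lambda>i. c F * indicator F i) = c F * m (indicator F)"
    using insert.prems by (intro integral_linear_scaleD[OF m] indicator_RE) simp
  finally show ?case using insert by simp
qed

text \<open>Both functions are linear on each cone of the fan, and a cone is spanned by indicators
  of nonempty flats. This is why coefficients at other sets are invisible in
  \<open>K(M)\<close>.\<close>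

lemma PLin_eq_on_fan_support:
  assumes M: "is_matroid M" and f: "f \<in> PLin (ground M)" and g: "g \<in> PLin (ground M)"
    and flats: "\<And>F. is_flat M F \<Longrightarrow> F \<noteq> {} \<Longrightarrow> f (indicator F) = g (indicator F)"
    and b: "b \<in> fan_support M"
  shows "f b = g b"
proof -
  obtain C where C: "C \<in> matroid_fan M" "b \<in> C" using b by (auto simp: fan_support_def)
  then obtain \<C> where \<C>: "C = ray_cone \<C>" "\<And>F. F \<in> \<C> \<Longrightarrow> is_flat M F \<and> F \<noteq> {}"
    unfolding matroid_fan_def by auto
  have sub: "F \<subseteq> ground M" if "F \<in> \<C>" for F using \<C>(2)[OF that] by (simp add: is_flat_def)
  have fin: "finite \<C>" using sub finite_subset[of \<C> "Pow (ground M)"] matroid_finite[OF M] by auto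
  obtain c where c: "\<And>F. F \<in> \<C> \<Longrightarrow> c F \<ge> 0" "b = (\<lambda>i. \<Sum>F\<in>\<C>. c F * indicator F i)"
    using C(2) unfolding \<C>(1) ray_cone_def by auto
  have mem: "indicator F \<in> C" if "F \<in> \<C>" for F
    unfolding \<C>(1) ray_cone_def using that fin
    by (auto intro!: exI[of _ "\<lambda>G. of_bool (G = F)"] simp: fun_eq_iff if_distrib[of "\<lambda>x. x * _"]
        of_bool_def sum.delta' cong: if_cong)
  have eval: "h b = (\<Sum>F\<in>\<C>. c F * h (indicator F))" if h: "h \<in> PLin (ground M)" for h
  proof -
    obtain m where m: "integral_linear (ground M) m" "\<forall>b\<in>C. h b = m b"
      using PLin_matroid_fan_linear[OF M h C(1)] by blast
    have "h b = m (\<lambda>i. \<Sum>F\<in>\<C>. c F * indicator F i)" using m C(2) c(2) by simp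
    also have "\<dots> = (\<Sum>F\<in>\<C>. c F * m (indicator F))"
      using integral_linear_sum[OF m(1) fin sub] by blast
    also have "\<dots> = (\<Sum>F\<in>\<C>. c F * h (indicator F))" using m(2) mem by (intro sum.cong) auto
    finally show ?thesis .
  qed
  show ?thesis unfolding eval[OF f] eval[OF g] using flats \<C>(2) by (intro sum.cong) auto
qed

section \<open>Euler characteristics as limits\<close>

lemma matroid_restrict_simps [simp]:
  "ground (matroid_restrict M F) = F"
  "A \<subseteq> F \<Longrightarrow> rk (matroid_restrict M F) A = rk M A"
  by (simp_all add: matroid_restrict_def)

lemma matroid_contract_simps [simp]:
  "ground (matroid_contract M F) = ground M - F"
  "A \<subseteq> ground M - F \<Longrightarrow> rk (matroid_contract M F) A = rk M (A \<union> F) - rk M F"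
  by (simp_all add: matroid_contract_def)

lemma matroid_rk_le_card: "is_matroid M \<Longrightarrow> A \<subseteq> ground M \<Longrightarrow> rk M A \<le> card A"
  by (simp add: is_matroid_def)

lemma is_matroid_restrict:
  assumes M: "is_matroid M" and F: "F \<subseteq> ground M"
  shows "is_matroid (matroid_restrict M F)"
  unfolding is_matroid_def
proof (intro conjI allI impI)
  show "finite (ground (matroid_restrict M F))"
    using matroid_finite[OF M] F finite_subset by auto
  show "rk (matroid_restrict M F) \<in> extensional (Pow (ground (matroid_restrict M F)))"
    by (simp add: matroid_restrict_def)
  fix A assume A: "A \<subseteq> ground (matroid_restrict M F)"
  then show "rk (matroid_restrict M F) A \<le> card A" using matroid_rk_le_card[OF M] F by simp
  fix B assume B: "B \<subseteq> ground (matroid_restrict M F)"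
  then have "A \<inter> B \<subseteq> F" by auto
  then show "rk (matroid_restrict M F) (A \<union> B) + rk (matroid_restrict M F) (A \<inter> B)
      \<le> rk (matroid_restrict M F) A + rk (matroid_restrict M F) B"
    using A B F matroid_rk_submodular[OF M, of A B] by simp
next
  fix A B assume "A \<subseteq> B" "B \<subseteq> ground (matroid_restrict M F)"
  then show "rk (matroid_restrict M F) A \<le> rk (matroid_restrict M F) B"
    using F matroid_rk_mono[OF M, of A B] by simp
qed

lemma is_matroid_contract:
  assumes M: "is_matroid M" and F: "F \<subseteq> ground M"
  shows "is_matroid (matroid_contract M F)"
  unfolding is_matroid_def
proof (intro conjI allI impI)
  have le: "rk M F \<le> rk M (A \<union> F)" if "A \<subseteq> ground M - F" for A
    using that F by (intro matroid_rk_mono[OF M]) auto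
  show "finite (ground (matroid_contract M F))" using matroid_finite[OF M] by simp
  show "rk (matroid_contract M F) \<in> extensional (Pow (ground (matroid_contract M F)))"
    by (simp add: matroid_contract_def)
  {
    fix A assume A: "A \<subseteq> ground (matroid_contract M F)"
    then have "A \<subseteq> ground M" by auto
    then have "rk M (A \<union> F) \<le> rk M A + rk M F" "rk M A \<le> card A"
      using matroid_rk_submodular[OF M, of A F] matroid_rk_le_card[OF M, of A] F by auto
    then show "rk (matroid_contract M F) A \<le> card A" using A by simp
    fix B assume B: "B \<subseteq> ground (matroid_contract M F)"
    have "A \<inter> B \<subseteq> ground M - F" using A by auto
    moreover have "(A \<union> F) \<inter> (B \<union> F) = A \<inter> B \<union> F" "(A \<union> F) \<union> (B \<union> F) = A \<union> B \<union> F" by auto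
    moreover have "A \<union> F \<subseteq> ground M" "B \<union> F \<subseteq> ground M" using A B F by auto
    ultimately show "rk (matroid_contract M F) (A \<union> B) + rk (matroid_contract M F) (A \<inter> B)
        \<le> rk (matroid_contract M F) A + rk (matroid_contract M F) B"
      using A B F matroid_rk_submodular[OF M, of "A \<union> F" "B \<union> F"]
        le[of A] le[of B] le[of "A \<inter> B"] le[of "A \<union> B"] by simp
  next
    fix A B assume "A \<subseteq> B" "B \<subseteq> ground (matroid_contract M F)"
    then show "rk (matroid_contract M F) A \<le> rk (matroid_contract M F) B"
      using F matroid_rk_mono[OF M, of "A \<union> F" "B \<union> F"] by (auto intro: diff_le_mono)
  }
qed

lemma loopless_restrict: "loopless M \<Longrightarrow> F \<subseteq> ground M \<Longrightarrow> loopless (matroid_restrict M F)"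
  by (auto simp: loopless_def)

lemma loopless_contract_iff:
  "F \<subseteq> ground M \<Longrightarrow> loopless (matroid_contract M F) \<longleftrightarrow> is_flat M F"
  by (auto simp: loopless_def is_flat_def)

lemma pl_comb_add:
  assumes "b \<in> RE E" "\<And>T. T \<subseteq> E \<Longrightarrow> T \<noteq> {} \<Longrightarrow> a'' T = a T + a' T"
  shows "pl_comb E a'' b = pl_comb E a b + pl_comb E a' b"
proof -
  have "pl_comb E a'' b = (\<Sum>T\<in>Pow E - {{}}. of_int (a T) * height E T b + of_int (a' T) * height E T b)"
    using assms by (auto simp: pl_comb_def algebra_simps intro!: sum.cong)
  then show ?thesis using assms(1) by (simp add: pl_comb_def sum.distrib)
qed

lemma pl_comb_linear_form:
  assumes "finite E" "i \<in> E" "b \<in> RE E"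
  shows "pl_comb E (\<lambda>T. c * of_bool (i \<in> T)) b = of_int c * b i"
proof -
  let ?f = "\<lambda>b\<in>RE E. of_int c * b i :: real"
  have "integral_linear E (\<lambda>b. of_int c * b i)"
  proof (rule integral_linearI[where c = "\<lambda>j. c * of_bool (j = i)"])
    show "of_int c * b i = (\<Sum>j\<in>E. of_int (c * of_bool (j = i)) * b j)" for b
      using assms by (subst sum.remove[of _ i]) (auto intro: sum.neutral)
  qed
  moreover have "\<forall>b\<in>C. ?f b = of_int c * b i" if "C \<in> braid_fan E" for C
    using braid_fan_subset[OF that] by (auto simp: max_cone_def)
  ultimately have "?f \<in> PLin E" unfolding PLin_def by auto
  moreover have "E \<noteq> {}" using assms by auto
  ultimately obtain a where a: "?f = pl_comb E a" using PLin_eq_pl_comb[OF assms(1)] by blast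
  have "pl_comb E (\<lambda>T. c * of_bool (i \<in> T)) = pl_comb E a"
  proof (rule pl_comb_cong)
    fix T assume T: "T \<subseteq> E" "T \<noteq> {}"
    have "real_of_int (a T) = pl_comb E a (indicator T)"
      using pl_comb_indicator[OF assms(1) T] by simp
    also have "\<dots> = of_int c * indicator T i" using indicator_RE[OF T(1)] by (simp flip: a)
    finally have "real_of_int (a T) = of_int (c * of_bool (i \<in> T))" by (simp add: indicator_def)
    then show "c * of_bool (i \<in> T) = a T" by (simp only: of_int_eq_iff)
  qed
  then show ?thesis using assms(3) by (simp flip: a)
qed

text \<open>This is \<open>chi^*\<close> of the matroid in the coordinates of the basis
  \<open>delta E T\<close>, in which restriction keeps \<open>a\<close> and contraction turns it
  into \<open>a (F \<union> T) - a F\<close>.\<close>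

definition euler ::
    "('a matroid \<Rightarrow> (('a \<Rightarrow> real) \<Rightarrow> real) set \<Rightarrow> int) \<Rightarrow> 'a matroid \<Rightarrow> ('a set \<Rightarrow> int) \<Rightarrow> int" where
  "euler chi M a = chi M (psi M (pl_comb (ground M) a))"

context
  fixes chi :: "'a matroid \<Rightarrow> (('a \<Rightarrow> real) \<Rightarrow> real) set \<Rightarrow> int"
  assumes chi: "matroid_euler_characteristics chi"
begin

lemma euler_zero:
  assumes "is_matroid M" "loopless M" "ground M \<noteq> {}"
  shows "euler chi M (\<lambda>_. 0) = 1"
proof -
  have "pl_comb (ground M) (\<lambda>_. 0) = (\<lambda>b\<in>RE (ground M). 0)" by (simp add: pl_comb_def)
  then show ?thesis
    using chi assms unfolding matroid_euler_characteristics_def euler_def by simp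
qed

lemma euler_flat:
  assumes M: "is_matroid M" "loopless M" "ground M \<noteq> {}"
    and F: "is_flat M F" "F \<noteq> {}" "F \<noteq> ground M"
  shows "euler chi M a = euler chi M (a(F := a F - 1)) +
    euler chi (matroid_restrict M F) a * euler chi (matroid_contract M F) (\<lambda>T. a (F \<union> T) - a F)"
proof -
  let ?E = "ground M" and ?f = "pl_comb (ground M) a"
  have fin: "finite ?E" and FE: "F \<subseteq> ?E" using M F by (auto simp: matroid_finite is_flat_def)
  then have finF: "finite F" "finite (?E - F)" using finite_subset by auto
  have "?f \<in> PLin ?E" using fin M by (intro pl_comb_PLin)
  then have "chi M (psi M ?f) = chi M (psi M (\<lambda>b\<in>RE ?E. ?f b - delta ?E F b)) +
      chi (matroid_restrict M F) (psi (matroid_restrict M F) (plin_restrict ?E ?f F)) *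
      chi (matroid_contract M F) (psi (matroid_contract M F) (plin_contract ?E ?f F))"
    using chi M F unfolding matroid_euler_characteristics_def by blast
  moreover have "(\<lambda>b\<in>RE ?E. ?f b - delta ?E F b) = pl_comb ?E (a(F := a F - 1))"
  proof
    fix b show "(\<lambda>b\<in>RE ?E. ?f b - delta ?E F b) b = pl_comb ?E (a(F := a F - 1)) b"
    proof (cases "b \<in> RE ?E")
      case True
      then have "?f b = pl_comb ?E (a(F := a F - 1)) b + pl_comb ?E (\<lambda>S. of_bool (S = F)) b"
        by (intro pl_comb_add) auto
      then show ?thesis using True delta_eq[OF fin FE F(2)] by simp
    qed (simp add: pl_comb_def)
  qed
  moreover have "plin_restrict ?E ?f F = pl_comb F a"
    unfolding plin_restrict_def delta_comb_eq[OF finF(1)]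
    using FE by (intro pl_comb_cong delta_coeff_pl_comb[OF fin]) auto
  moreover have "plin_contract ?E ?f F = pl_comb (?E - F) (\<lambda>T. a (F \<union> T) - a F)"
    unfolding plin_contract_def delta_comb_eq[OF finF(2)]
  proof (rule pl_comb_cong)
    fix T assume "T \<subseteq> ?E - F" "T \<noteq> {}"
    then show "delta_coeff ?E ?f (F \<union> T) - delta_coeff ?E ?f F = a (F \<union> T) - a F"
      using FE F(2) delta_coeff_pl_comb[OF fin, of F a] delta_coeff_pl_comb[OF fin, of "F \<union> T" a]
      by auto
  qed
  ultimately show ?thesis by (simp add: euler_def)
qed

text \<open>By \<open>PLin_eq_on_fan_support\<close> the class of \<open>e^f\<close> depends only on
  the values of \<open>f\<close> at indicators of nonempty flats. For a set that is not a flat this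
  replaces \<open>euler_flat\<close>, without a product term.\<close>

lemma euler_cong:
  assumes M: "is_matroid M" "ground M \<noteq> {}"
    and eq: "\<And>F. is_flat M F \<Longrightarrow> F \<noteq> {} \<Longrightarrow> a F = a' F"
  shows "euler chi M a = euler chi M a'"
proof -
  have fin: "finite (ground M)" using M by (simp add: matroid_finite)
  have "psi M (pl_comb (ground M) a) = psi M (pl_comb (ground M) a')"
    unfolding psi_def
  proof (rule K_class_cong)
    fix b assume b: "b \<in> fan_support M"
    have "pl_comb (ground M) a b = pl_comb (ground M) a' b"
    proof (rule PLin_eq_on_fan_support[OF M(1) _ _ _ b])
      fix F assume F: "is_flat M F" "F \<noteq> {}"
      then have "F \<subseteq> ground M" by (simp add: is_flat_def)
      then show "pl_comb (ground M) a (indicator F) = pl_comb (ground M) a' (indicator F)"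
        using eq[OF F] F(2) fin by (simp add: pl_comb_indicator)
    qed (use fin M in \<open>auto intro: pl_comb_PLin\<close>)
    then show "exp (pl_comb (ground M) a b) = exp (pl_comb (ground M) a' b)" by simp
  qed
  then show ?thesis by (simp add: euler_def)
qed

text \<open>The recursion lowers coefficients of proper subsets only; this lemma is the means to
  dispose of the coefficient of the whole ground set.\<close>

lemma euler_linear:
  assumes M: "is_matroid M" "i \<in> ground M"
    and eq: "\<And>T. T \<subseteq> ground M \<Longrightarrow> T \<noteq> {} \<Longrightarrow> a' T = a T + c * of_bool (i \<in> T)"
  shows "euler chi M a' = euler chi M a"
proof -
  have fin: "finite (ground M)" and ne: "ground M \<noteq> {}" using M by (auto simp: matroid_finite)
  let ?l = "\<lambda>b. of_int c * b i :: real"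
  have lin: "integral_linear (ground M) ?l"
  proof (rule integral_linearI[where c = "\<lambda>j. c * of_bool (j = i)"])
    show "?l b = (\<Sum>j\<in>ground M. of_int (c * of_bool (j = i)) * b j)" for b
      using M fin by (subst sum.remove[of _ i]) (auto intro: sum.neutral)
  qed
  have "psi M (pl_comb (ground M) a') =
      K_class M (\<lambda>b. exp (pl_comb (ground M) a b) * exp (?l b))"
    unfolding psi_def
  proof (rule K_class_cong)
    fix b assume "b \<in> fan_support M"
    then have "b \<in> RE (ground M)" using fan_support_RE M by blast
    then have "pl_comb (ground M) a' b = pl_comb (ground M) a b + ?l b"
      using pl_comb_add[of b "ground M" a' a "\<lambda>T. c * of_bool (i \<in> T)"] eq
        pl_comb_linear_form[OF fin M(2)] by simp
    then show "exp (pl_comb (ground M) a' b) = exp (pl_comb (ground M) a b) * exp (?l b)"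
      by (simp add: exp_add)
  qed
  also have "\<dots> = psi M (pl_comb (ground M) a)"
    unfolding psi_def using fin ne M lin by (intro K_class_linear PLin_pexp pl_comb_PLin)
  finally show ?thesis by (simp add: euler_def)
qed

end

text \<open>As \<open>step\<close> is an equivalence, each coefficient in \<open>X\<close> can be
  moved to 0 from either sign.\<close>

lemma coeff_induct:
  fixes a :: "'b \<Rightarrow> int"
  assumes "finite X" and step: "\<And>a T. T \<in> X \<Longrightarrow> P a \<longleftrightarrow> P (a(T := a T - 1))"
    and base: "P (\<lambda>T. if T \<in> X then 0 else a T)"
  shows "P a"
  using assms
proof (induction X arbitrary: a rule: finite_induct)
  case (insert T X)
  have shift: "P a" if "P (a(T := 0))" for a
  proof -
    have "P (a(T := k))" for k
    proof (induction k rule: int_induct[where k = 0])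
      case (step1 k)
      then show ?case using insert.prems(1)[of T "a(T := k + 1)"] by (simp add: fun_upd_same del: fun_upd_apply)
    next
      case (step2 k)
      then show ?case using insert.prems(1)[of T "a(T := k)"] by (simp add: fun_upd_same del: fun_upd_apply)
    qed (rule that)
    from this[of "a T"] show ?thesis by simp
  qed
  have "P (a(T := 0))"
  proof (rule insert.IH)
    show "P (\<lambda>S. if S \<in> X then 0 else (a(T := 0)) S)"
      using insert.prems(2) by (rule back_subst[where P = P]) auto
  qed (use insert.prems(1) in blast)
  then show ?case by (rule shift)
qed simp

lemma locsum_restrict:
  assumes "F \<subseteq> ground M"
  shows "locsum (rk (matroid_restrict M F)) a {} F y = locsum (rk M) a {} F y"
  unfolding locsum_def
proof (rule sum.cong[OF refl])
  fix xs assume "xs \<in> permutations_of_set F"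
  then have "set (take k xs) \<subseteq> F" for k using set_take_subset[of k xs] by (auto dest: permutations_of_setD)
  then have "num (rk (matroid_restrict M F)) {} y xs = num (rk M) {} y xs"
    by (intro num_cong) simp
  then show "wt a {} y xs * num (rk (matroid_restrict M F)) {} y xs / den y xs =
      wt a {} y xs * num (rk M) {} y xs / den y xs" by simp
qed

lemma locsum_contract:
  assumes M: "is_matroid M" and F: "F \<subseteq> ground M"
  shows "locsum (rk (matroid_contract M F)) (\<lambda>T. a (F \<union> T) - a F) {} (ground M - F) y =
    locsum (rk M) a F (ground M - F) y"
  unfolding locsum_def
proof (rule sum.cong[OF refl])
  fix xs assume "xs \<in> permutations_of_set (ground M - F)"
  then have s: "set (take k xs) \<subseteq> ground M - F" for k
    using set_take_subset[of k xs] by (auto dest: permutations_of_setD)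
  have "rk M F \<le> rk M (set (take k xs) \<union> F)" for k
    using s[of k] F by (intro matroid_rk_mono[OF M]) auto
  then have "num (rk (matroid_contract M F)) {} y xs = num (rk M) F y xs"
    using s by (intro num_cong) (simp add: Un_commute less_diff_iff)
  moreover have "wt a F y xs = wt (\<lambda>T. a (F \<union> T) - a F) {} y xs"
    by (rule wt_translate[where c = "a F"]) simp
  ultimately show "wt (\<lambda>T. a (F \<union> T) - a F) {} y xs * num (rk (matroid_contract M F)) {} y xs / den y xs =
      wt a F y xs * num (rk M) F y xs / den y xs" by simp
qed

section \<open>Matroids with loops\<close>

definition loops :: "'a matroid \<Rightarrow> 'a set" where
  "loops M = {e \<in> ground M. rk M {e} = 0}"

text \<open>The direct sum of \<open>M\<close> without its loops and the free matroid on the loops.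
  It is loopless on the same ground set, and each of its greedy bases is that of \<open>M\<close>
  together with all loops.\<close>

definition loops_to_coloops :: "'a matroid \<Rightarrow> 'a matroid" where
  "loops_to_coloops M = \<lparr>ground = ground M,
     rk = (\<lambda>A\<in>Pow (ground M). rk M (A - loops M) + card (A \<inter> loops M))\<rparr>"

lemma loops_to_coloops_simps [simp]:
  "ground (loops_to_coloops M) = ground M"
  "A \<subseteq> ground M \<Longrightarrow> rk (loops_to_coloops M) A = rk M (A - loops M) + card (A \<inter> loops M)"
  by (simp_all add: loops_to_coloops_def)

lemma is_matroid_loops_to_coloops:
  assumes M: "is_matroid M"
  shows "is_matroid (loops_to_coloops M)"
  unfolding is_matroid_def
proof (intro conjI allI impI)
  let ?N = "loops_to_coloops M" and ?L = "loops M"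
  have fin: "finite A" if "A \<subseteq> ground M" for A using that matroid_finite[OF M] finite_subset by blast
  show "finite (ground ?N)" using matroid_finite[OF M] by simp
  show "rk ?N \<in> extensional (Pow (ground ?N))" by (simp add: loops_to_coloops_def)
  {
    fix A assume A: "A \<subseteq> ground ?N"
    have "rk M (A - ?L) \<le> card (A - ?L)" using A by (intro matroid_rk_le_card[OF M]) auto
    moreover have "card (A - ?L) + card (A \<inter> ?L) = card A"
      using fin[of A] A card_Int_Diff[of A ?L] by simp
    ultimately show "rk ?N A \<le> card A" using A by simp
    fix B assume B: "B \<subseteq> ground ?N"
    have s: "A \<inter> B \<subseteq> ground M" "A - ?L \<subseteq> ground M" "B - ?L \<subseteq> ground M" using A B by auto
    have e: "(A - ?L) \<union> (B - ?L) = A \<union> B - ?L" "(A - ?L) \<inter> (B - ?L) = A \<inter> B - ?L"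
      "(A \<inter> ?L) \<union> (B \<inter> ?L) = (A \<union> B) \<inter> ?L" "(A \<inter> ?L) \<inter> (B \<inter> ?L) = (A \<inter> B) \<inter> ?L" by auto
    have "card (A \<inter> ?L) + card (B \<inter> ?L) = card ((A \<union> B) \<inter> ?L) + card ((A \<inter> B) \<inter> ?L)"
      using card_Un_Int[of "A \<inter> ?L" "B \<inter> ?L"] fin A B unfolding e by simp
    then show "rk ?N (A \<union> B) + rk ?N (A \<inter> B) \<le> rk ?N A + rk ?N B"
      using matroid_rk_submodular[OF M s(2,3)] A B s(1) unfolding e by simp
  next
    fix A B assume AB: "A \<subseteq> B" "B \<subseteq> ground ?N"
    then have "rk M (A - ?L) \<le> rk M (B - ?L)" by (intro matroid_rk_mono[OF M]) auto
    moreover have "card (A \<inter> ?L) \<le> card (B \<inter> ?L)" using AB fin by (intro card_mono) auto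
    ultimately show "rk ?N A \<le> rk ?N B" using AB by simp
  }
qed

lemma loopless_loops_to_coloops: "loopless (loops_to_coloops M)"
  unfolding loopless_def
proof
  fix e assume e: "e \<in> ground (loops_to_coloops M)"
  show "0 < rk (loops_to_coloops M) {e}"
  proof (cases "e \<in> loops M")
    case False
    then have "{e} - loops M = {e}" "0 < rk M {e}" using e by (auto simp: loops_def)
    then show ?thesis using e by simp
  qed (use e in simp)
qed

lemma matroid_rk_Diff_loops:
  assumes M: "is_matroid M" and A: "A \<subseteq> ground M"
  shows "rk M (A - loops M) = rk M A"
proof -
  have "rk M (B \<union> K) = rk M B" if "finite K" "B \<subseteq> ground M" "K \<subseteq> loops M" for B K
    using that
  proof (induction K rule: finite_induct)
    case (insert e K)
    have e: "e \<in> ground M" "rk M {e} = 0" and K: "B \<union> K \<subseteq> ground M"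
      using insert.prems by (auto simp: loops_def)
    have "rk M (insert e (B \<union> K)) \<le> rk M (B \<union> K) + rk M {e}"
      using matroid_rk_submodular[OF M K, of "{e}"] e by simp
    then show ?case using insert is_matroid_rk_insert(1)[OF M K e(1)] e by simp
  qed simp
  moreover have "A - loops M \<union> A \<inter> loops M = A" by auto
  ultimately show ?thesis
    using A matroid_finite[OF M] finite_subset[OF A]
    by (metis Diff_subset Int_lower2 finite_Int order_trans)
qed

text \<open>A loop never raises the rank in \<open>M\<close> and always does in
  \<open>loops_to_coloops M\<close>; for the other elements the jumps agree. The loops thus give a
  factor that does not depend on their order.\<close>

lemma num_loops_to_coloops:
  assumes M: "is_matroid M" and "A \<union> set xs \<subseteq> ground M" "distinct xs" "A \<inter> set xs = {}"
  shows "num (rk M) A y xs =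
    (\<Prod>e\<in>set xs \<inter> loops M. 1 - exp (y e)) * num (rk (loops_to_coloops M)) A y xs"
  using assms(2-)
proof (induction xs arbitrary: A)
  case (Cons e xs)
  let ?r = "rk M" and ?s = "rk (loops_to_coloops M)" and ?L = "loops M"
  have IH: "num ?r (insert e A) y xs = (\<Prod>e\<in>set xs \<inter> ?L. 1 - exp (y e)) * num ?s (insert e A) y xs"
    using Cons.prems by (intro Cons.IH) auto
  have A: "A \<subseteq> ground M" "insert e A \<subseteq> ground M" "e \<notin> A" "finite A"
    using Cons.prems matroid_finite[OF M] finite_subset by auto
  have s: "?s A = ?r A + card (A \<inter> ?L)" "?s (insert e A) = ?r (insert e A) + card (insert e A \<inter> ?L)"
    using A matroid_rk_Diff_loops[OF M] by simp_all
  show ?case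
  proof (cases "e \<in> ?L")
    case True
    have "?r (insert e A - ?L) = ?r (A - ?L)" using True by simp
    then have eq: "?r (insert e A) = ?r A" using matroid_rk_Diff_loops[OF M] A by simp
    have "?s A < ?s (insert e A)" using True A unfolding s eq by simp
    moreover have "(\<Prod>e\<in>set (e # xs) \<inter> ?L. 1 - exp (y e)) =
        (1 - exp (y e)) * (\<Prod>e\<in>set xs \<inter> ?L. 1 - exp (y e))"
      using True Cons.prems by (simp add: Int_insert_left)
    ultimately show ?thesis using eq IH by simp
  next
    case False
    then have "?s A < ?s (insert e A) \<longleftrightarrow> ?r A < ?r (insert e A)" unfolding s by simp
    then show ?thesis using False IH by simp
  qed
qed simp

lemma locsum_loops_to_coloops:
  assumes M: "is_matroid M"
  shows "locsum (rk M) a {} (ground M) y =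
    (\<Prod>e\<in>loops M. 1 - exp (y e)) * locsum (rk (loops_to_coloops M)) a {} (ground M) y"
  unfolding locsum_def sum_distrib_left
proof (rule sum.cong[OF refl])
  fix xs assume "xs \<in> permutations_of_set (ground M)"
  then have xs: "set xs = ground M" "distinct xs" by (auto dest: permutations_of_setD)
  moreover have "ground M \<inter> loops M = loops M" by (auto simp: loops_def)
  ultimately have "num (rk M) {} y xs =
      (\<Prod>e\<in>loops M. 1 - exp (y e)) * num (rk (loops_to_coloops M)) {} y xs"
    using num_loops_to_coloops[OF M, of "{}" xs y] by simp
  then show "wt a {} y xs * num (rk M) {} y xs / den y xs = (\<Prod>e\<in>loops M. 1 - exp (y e)) *
      (wt a {} y xs * num (rk (loops_to_coloops M)) {} y xs / den y xs)" by simp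
qed

text \<open>Loops are part of the statement because \<open>locsum_recursion\<close> contracts
  arbitrary subsets; for a contraction by a non-flat the limit 0 makes up for the product term that
  the recursion for \<open>chi\<close> does not have there.\<close>

lemma locsum_tendsto:
  assumes chi: "matroid_euler_characteristics chi"
    and "is_matroid M" "ground M \<noteq> {}" "inj_on w (ground M)" "a {} = 0"
  shows "((\<lambda>t. locsum (rk M) a {} (ground M) (\<lambda>i. t * w i)) \<longlongrightarrow>
    (if loopless M then of_int (euler chi M a) else 0)) (at 0)"
  using assms(2-)
proof (induction "card (ground M)" arbitrary: M a rule: less_induct)
  case less
  let ?S = "\<lambda>M a t. locsum (rk M) a {} (ground M) (\<lambda>i. t * w i)"
  have inj_t: "inj_on (\<lambda>i. t * w i) E" if "inj_on w E" "t \<noteq> 0" for t E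
    using that by (auto simp: inj_on_def)
  have nz: "eventually (\<lambda>t::real. t \<noteq> 0) (at 0)" by (simp add: eventually_at_filter)
  \<comment> \<open>Stated for every loopless \<open>N\<close> on the ground set of
    \<open>M\<close>: besides \<open>M\<close> itself it is applied to
    \<open>loops_to_coloops M\<close>, which has the same size and so is out of reach of the
    induction hypothesis.\<close>
  have main: "(?S N a \<longlongrightarrow> of_int (euler chi N a)) (at 0)"
    if N: "is_matroid N" "loopless N" "ground N = ground M" and a: "a {} = 0" for N a
  proof -
    let ?E = "ground N"
    have fin: "finite ?E" and ne: "?E \<noteq> {}" and inj: "inj_on w ?E"
      using N less.prems matroid_finite by auto
    \<comment> \<open>The steps of \<open>coeff_induct\<close> do not touch the coefficients of the
      empty set and of the ground set. Requiring both to vanish makes the base case the zero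
      function on the subsets of \<open>?E\<close>.\<close>
    define P where "P a \<longleftrightarrow> a {} = 0 \<and> a ?E = 0 \<longrightarrow> (?S N a \<longlongrightarrow> of_int (euler chi N a)) (at 0)" for a
    have P: "P a" for a
    proof (rule coeff_induct[of "Pow ?E - {{}, ?E}"])
      show "finite (Pow ?E - {{}, ?E})" using fin by simp
      fix a and T assume T: "T \<in> Pow ?E - {{}, ?E}"
      show "P a \<longleftrightarrow> P (a(T := a T - 1))"
      proof (cases "a {} = 0 \<and> a ?E = 0")
        case True
        let ?a = "a(T := a T - 1)" and ?c = "\<lambda>S. a (T \<union> S) - a T"
          and ?R = "matroid_restrict N T" and ?Q = "matroid_contract N T"
        define g where "g t = ?S ?R a t * ?S ?Q ?c t" for t
        define l where "l = of_int (euler chi ?R a) *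
          (if loopless ?Q then of_int (euler chi ?Q ?c) else (0::real))"
        have TE: "T \<subseteq> ?E" "T \<noteq> {}" "T \<noteq> ?E" using T by auto
        have cards: "card T < card ?E" "card (?E - T) < card ?E"
          using TE fin by (auto intro!: psubset_card_mono)
        have mat: "is_matroid ?R" "is_matroid ?Q" "loopless ?R"
          by (intro is_matroid_restrict is_matroid_contract loopless_restrict N TE(1))+
        have r: "(?S ?R a \<longlongrightarrow> (if loopless ?R then of_int (euler chi ?R a) else 0)) (at 0)"
          using cards mat TE inj True N(3) by (intro less.hyps) (auto intro: inj_on_subset)
        have q: "(?S ?Q ?c \<longlongrightarrow> (if loopless ?Q then of_int (euler chi ?Q ?c) else 0)) (at 0)"
          using cards mat TE inj N(3) by (intro less.hyps) (auto intro: inj_on_subset)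
        have g: "(g \<longlongrightarrow> l) (at 0)"
          unfolding g_def[abs_def] l_def using tendsto_mult[OF r q] mat(3) by simp
        have eqS: "?S N a t = ?S N ?a t + g t" if "t \<noteq> 0" for t
          using locsum_recursion[OF fin TE _ inj_t[OF inj that], of "{}" "rk N" a]
            locsum_restrict[OF TE(1)] locsum_contract[OF N(1) TE(1)]
          by (simp add: g_def)
        have eqE: "of_int (euler chi N a) = of_int (euler chi N ?a) + l"
        proof (cases "is_flat N T")
          case True
          then show ?thesis
            using euler_flat[OF chi N(1,2) ne True TE(2,3), of a] loopless_contract_iff[OF TE(1)]
            by (simp add: l_def)
        next
          case False
          then have "euler chi N a = euler chi N ?a"
            by (intro euler_cong[OF chi N(1) ne]) auto
          then show ?thesis using False loopless_contract_iff[OF TE(1)] by (simp add: l_def)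
        qed
        have "(?S N a \<longlongrightarrow> of_int (euler chi N a)) (at 0) \<longleftrightarrow>
            ((\<lambda>t. ?S N ?a t + g t) \<longlongrightarrow> of_int (euler chi N ?a) + l) (at 0)"
          unfolding eqE using nz by (intro tendsto_cong) (auto elim!: eventually_mono simp: eqS)
        also have "\<dots> \<longleftrightarrow> (?S N ?a \<longlongrightarrow> of_int (euler chi N ?a)) (at 0)"
        proof
          assume "((\<lambda>t. ?S N ?a t + g t) \<longlongrightarrow> of_int (euler chi N ?a) + l) (at 0)"
          from tendsto_diff[OF this g] show "(?S N ?a \<longlongrightarrow> of_int (euler chi N ?a)) (at 0)" by simp
        qed (rule tendsto_add[OF _ g])
        finally show ?thesis using True TE by (auto simp: P_def)
      next
        case False
        then show ?thesis using T by (auto simp: P_def)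
      qed
    next
      let ?a = "\<lambda>T. if T \<in> Pow ?E - {{}, ?E} then 0 else a T"
      show "P ?a"
        unfolding P_def
      proof
        assume z: "?a {} = 0 \<and> ?a ?E = 0"
        have "?S N ?a t = 1" if "t \<noteq> 0" for t
        proof -
          have "?S N ?a t = ?S N (\<lambda>_. 0) t" using z by (intro locsum_cong_a) auto
          also have "\<dots> = 1"
            using N ne inj_t[OF inj that] by (intro locsum_zero) (auto simp: loopless_def)
          finally show ?thesis .
        qed
        then have "(?S N ?a \<longlongrightarrow> 1) (at 0) \<longleftrightarrow> ((\<lambda>_. 1) \<longlongrightarrow> (1::real)) (at (0::real))"
          using nz by (intro tendsto_cong) (auto elim!: eventually_mono)
        moreover have "euler chi N ?a = euler chi N (\<lambda>_. 0)"
          using z by (intro euler_cong[OF chi N(1) ne]) (auto simp: is_flat_def)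
        ultimately show "(?S N ?a \<longlongrightarrow> of_int (euler chi N ?a)) (at 0)"
          using euler_zero[OF chi N(1,2) ne] by simp
      qed
    qed
    obtain i where i: "i \<in> ?E" using ne by blast
    \<comment> \<open>Subtracting \<open>a ?E\<close> times the coordinate \<open>i\<close>, a
      linear function, brings the coefficient of the ground set to 0 and keeps the one of the empty
      set.\<close>
    define a0 where "a0 T = a T - a ?E * of_bool (i \<in> T)" for T
    have "a0 {} = 0" "a0 ?E = 0" using a i by (simp_all add: a0_def)
    then have "(?S N a0 \<longlongrightarrow> of_int (euler chi N a0)) (at 0)" using P[of a0] by (simp add: P_def)
    then have "((\<lambda>t. exp (of_int (a ?E) * (t * w i)) * ?S N a0 t) \<longlongrightarrow>
        exp (of_int (a ?E) * (0 * w i)) * of_int (euler chi N a0)) (at 0)"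
      by (intro tendsto_intros)
    moreover have "?S N a t = exp (of_int (a ?E) * (t * w i)) * ?S N a0 t" for t
      by (rule locsum_linear[where a' = a and a = a0 and c = "a ?E"]) (simp_all add: a0_def i)
    moreover have "euler chi N a = euler chi N a0"
      by (rule euler_linear[OF chi N(1) i, where c = "a ?E"]) (simp add: a0_def)
    ultimately show ?thesis by simp
  qed
  show ?case
  proof (cases "loopless M")
    case True
    then show ?thesis using main[of M a] less.prems by simp
  next
    case False
    let ?N = "loops_to_coloops M"
    have fin: "finite (loops M)" using matroid_finite[OF less.prems(1)] by (simp add: loops_def)
    have ne: "loops M \<noteq> {}" using False by (auto simp: loopless_def loops_def)
    \<comment> \<open>This limit is finite, so no pole can compensate the zero of the product over
      the loops at \<open>t = 0\<close>.\<close>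
    have "(?S ?N a \<longlongrightarrow> of_int (euler chi ?N a)) (at 0)"
      using less.prems by (intro main is_matroid_loops_to_coloops loopless_loops_to_coloops) auto
    then have "((\<lambda>t. (\<Prod>e\<in>loops M. 1 - exp (t * w e)) * ?S ?N a t) \<longlongrightarrow>
        (\<Prod>e\<in>loops M. 1 - exp (0 * w e)) * of_int (euler chi ?N a)) (at 0)"
      by (intro tendsto_intros)
    then show ?thesis
      using False fin ne by (simp add: locsum_loops_to_coloops[OF less.prems(1)] zero_power card_gt_0_iff)
  qed
qed

section \<open>Piecewise Laurent polynomials are combinations of monomials\<close>

abbreviation (input) "lookup \<equiv> Poly_Mapping.lookup"
abbreviation (input) "keys \<equiv> Poly_Mapping.keys"
abbreviation (input) "single \<equiv> Poly_Mapping.single"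

lemma laurent_diff: "p \<in> laurent E \<Longrightarrow> q \<in> laurent E \<Longrightarrow> p - q \<in> laurent E"
  using laurent_add[of p E "- q"] laurent_uminus[of q E] by simp

lemma laurent_mult: "p \<in> laurent E \<Longrightarrow> q \<in> laurent E \<Longrightarrow> p * q \<in> laurent E"
  unfolding laurent_def
proof (intro CollectI ballI)
  assume pq: "p \<in> {p. \<forall>m\<in>keys p. keys m \<subseteq> E}"
    "q \<in> {p. \<forall>m\<in>keys p. keys m \<subseteq> E}"
  fix m assume "m \<in> keys (p * q)"
  then obtain k l where kl: "m = k + l" "k \<in> keys p" "l \<in> keys q"
    using keys_mult[of p q] by blast
  then have "keys k \<subseteq> E" "keys l \<subseteq> E" using pq by simp_all
  then show "keys m \<subseteq> E"
    unfolding kl(1) using Poly_Mapping.keys_add[of k l] by blast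
qed

lemma laurent_dvd_sum: "(\<And>i. i \<in> I \<Longrightarrow> laurent_dvd E p (q i)) \<Longrightarrow> laurent_dvd E p (sum q I)"
  by (induction I rule: infinite_finite_induct) (auto intro: laurent_dvd_add laurent_dvd_0)

lemma laurent_dvd_mult: "laurent_dvd E p q \<Longrightarrow> r \<in> laurent E \<Longrightarrow> laurent_dvd E p (q * r)"
  unfolding laurent_dvd_def by (metis laurent_mult mult.assoc)

lemma single_sum_expand:
  fixes p :: "'b \<Rightarrow>\<^sub>0 int"
  assumes "finite A" "keys p \<subseteq> A"
  shows "p = (\<Sum>m\<in>A. single m (lookup p m))"
proof (rule poly_mapping_eqI)
  fix k
  have "lookup (\<Sum>m\<in>A. single m (lookup p m)) k =
      (\<Sum>m\<in>A. if m = k then lookup p m else 0)"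
    unfolding lookup_sum by (intro sum.cong refl) (simp only: lookup_single when_def)
  also have "\<dots> = (if k \<in> A then lookup p k else 0)"
    by (rule sum.delta[OF assms(1)])
  also have "\<dots> = lookup p k" using assms(2) by (auto simp: in_keys_iff)
  finally show "lookup p k =
      lookup (\<Sum>m\<in>A. single m (lookup p m)) k" ..
qed

section \<open>Divisibility by binomials \<open>x_a - x_b\<close>\<close>

definition subst_exponent :: "'a \<Rightarrow> 'a \<Rightarrow> ('a \<Rightarrow>\<^sub>0 int) \<Rightarrow> 'a \<Rightarrow>\<^sub>0 int" where
  "subst_exponent a b m =
     m + (single b (lookup m a) - single a (lookup m a))"

text \<open>The substitution \<open>x\<^sub>a \<mapsto> x\<^sub>b\<close>, whose kernel consists of the multiples of \<open>x\<^sub>a - x\<^sub>b\<close>.\<close>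

definition subst_var :: "'a \<Rightarrow> 'a \<Rightarrow> 'a laurent \<Rightarrow> 'a laurent" where
  "subst_var a b p = (\<Sum>m\<in>keys p.
     single (subst_exponent a b m) (lookup p m))"

lemma subst_exponent_add: "subst_exponent a b (k + m) = subst_exponent a b k + subst_exponent a b m"
  by (simp add: subst_exponent_def lookup_add single_add algebra_simps)

lemma subst_var_superset:
  assumes "finite A" "keys p \<subseteq> A"
  shows "subst_var a b p =
    (\<Sum>m\<in>A. single (subst_exponent a b m) (lookup p m))"
  unfolding subst_var_def using assms by (intro sum.mono_neutral_left) (auto simp: in_keys_iff)

lemma subst_var_add: "subst_var a b (p + q) = subst_var a b p + subst_var a b q"
proof -
  let ?A = "keys p \<union> keys q"
  have "subst_var a b r = (\<Sum>m\<in>?A. single (subst_exponent a b m) (lookup r m))"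
    if "keys r \<subseteq> ?A" for r
    using that by (intro subst_var_superset) auto
  then show ?thesis
    using Poly_Mapping.keys_add[of p q] by (simp add: lookup_add single_add sum.distrib)
qed

lemma subst_var_zero: "subst_var a b 0 = 0"
  by (simp add: subst_var_def)

lemma subst_var_single: "subst_var a b (single m c) = single (subst_exponent a b m) c"
  using subst_var_superset[of "{m}" "single m c" a b] by simp

lemma subst_var_sum: "subst_var a b (sum p I) = (\<Sum>i\<in>I. subst_var a b (p i))"
  by (induction I rule: infinite_finite_induct) (auto simp: subst_var_zero subst_var_add)

lemma subst_var_diff: "subst_var a b (p - q) = subst_var a b p - subst_var a b q"
  using subst_var_add[of a b "p - q" q] by simp

lemma subst_var_mult_single:
  "subst_var a b (single k 1 * q) =
    single (subst_exponent a b k) 1 * subst_var a b q"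
proof -
  have "single k 1 * q =
      (\<Sum>m\<in>keys q. single (k + m) (lookup q m))"
    by (subst (1) single_sum_expand[of "keys q" q])
      (simp_all add: sum_distrib_left mult_single)
  then have "subst_var a b (single k 1 * q) = (\<Sum>m\<in>keys q.
      single (subst_exponent a b k + subst_exponent a b m) (lookup q m))"
    by (simp add: subst_var_sum subst_var_single subst_exponent_add)
  also have "\<dots> = single (subst_exponent a b k) 1 * subst_var a b q"
    by (simp add: subst_var_def sum_distrib_left mult_single)
  finally show ?thesis .
qed

lemma subst_var_dvd:
  assumes "laurent_dvd E (xpow a 1 - xpow b 1) p"
  shows "subst_var a b p = 0"
proof -
  obtain r where r: "p = xpow a 1 * r - xpow b 1 * r"
    using assms unfolding laurent_dvd_def by (auto simp: left_diff_distrib)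
  have "subst_exponent a b (single a 1) = subst_exponent a b (single b 1)"
    by (rule poly_mapping_eqI)
      (auto simp: subst_exponent_def lookup_add lookup_minus lookup_single when_def)
  then show ?thesis
    unfolding r subst_var_diff unfolding xpow_def subst_var_mult_single by simp
qed

text \<open>If the substitution kills \<open>p\<close>, then \<open>p\<close> is the sum of the
  differences between its terms and their images. Passing to the image only moves exponent from
  \<open>a\<close> to \<open>b\<close>, so \<open>laurent_dvd_monomials\<close> applies to each
  difference.\<close>

lemma dvd_subst_var:
  assumes p: "p \<in> laurent E" and ab: "a \<in> E" "b \<in> E" "a \<noteq> b" and z: "subst_var a b p = 0"
  shows "laurent_dvd E (xpow a 1 - xpow b 1) p"
proof -
  let ?K = "keys p" and ?s = "\<lambda>m. single m (1::int)"
  have "p = p - subst_var a b p" using z by simp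
  also have "\<dots> = (\<Sum>m\<in>?K. single m (lookup p m) -
      single (subst_exponent a b m) (lookup p m))"
    by (subst (1) single_sum_expand[of ?K p]) (simp_all add: subst_var_def sum_subtractf)
  also have "\<dots> = (\<Sum>m\<in>?K. (?s m - ?s (subst_exponent a b m)) *
      single 0 (lookup p m))"
    by (simp add: left_diff_distrib mult_single)
  finally have eq: "p = \<dots>" .
  have "laurent_dvd E (xpow a 1 - xpow b 1) (\<Sum>m\<in>?K. (?s m - ?s (subst_exponent a b m)) *
      single 0 (lookup p m))"
  proof (intro laurent_dvd_sum laurent_dvd_mult laurent_dvd_monomials ab)
    fix m assume "m \<in> ?K"
    then show m: "keys m \<subseteq> E" using p by (auto simp: laurent_def)
    show "keys (subst_exponent a b m) \<subseteq> E"
    proof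
      fix c assume "c \<in> keys (subst_exponent a b m)"
      then have "c = a \<or> c = b \<or> c \<in> keys m"
        by (auto simp: in_keys_iff subst_exponent_def lookup_add lookup_minus lookup_single when_def
            split: if_splits)
      then show "c \<in> E" using m ab by auto
    qed
  qed (use ab in \<open>auto simp: subst_exponent_def lookup_add lookup_minus lookup_single when_def
      intro: laurent_single\<close>)
  then show ?thesis using eq by simp
qed

text \<open>Otherwise \<open>q\<close> would be invariant under translation of exponents by
  \<open>k\<close>, and its support would contain infinitely many translates of one
  exponent.\<close>

lemma mult_monomial_minus_one_cancel:
  fixes q :: "('a \<Rightarrow>\<^sub>0 int) \<Rightarrow>\<^sub>0 int"
  assumes "(single k 1 - 1) * q = 0" "k \<noteq> 0"
  shows "q = 0"
proof (rule ccontr)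
  assume "q \<noteq> 0"
  then obtain m where m: "lookup q m \<noteq> 0" by (metis lookup_zero poly_mapping_eqI)
  have "single k 1 * q = q" using assms(1) by (simp add: left_diff_distrib)
  moreover have shift: "lookup (single k 1 * q) (k + e) = lookup q e" for e
  proof -
    have "single k 1 * q =
        (\<Sum>m\<in>keys q. single (k + m) (lookup q m))"
      by (subst (1) single_sum_expand[of "keys q" q])
        (simp_all add: sum_distrib_left mult_single)
    then show ?thesis
      by (auto simp: lookup_sum lookup_single when_def sum.delta in_keys_iff)
  qed
  ultimately have "lookup q (k + e) = lookup q e" for e by metis
  then have eq: "lookup q (((+) k ^^ n) m) = lookup q m" for n
    by (induction n) auto
  obtain c where c: "lookup k c \<noteq> 0" using assms(2) by (metis lookup_zero poly_mapping_eqI)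
  have val: "lookup (((+) k ^^ n) m) c =
      int n * lookup k c + lookup m c" for n
    by (induction n) (auto simp: lookup_add algebra_simps)
  have "inj (\<lambda>n. ((+) k ^^ n) m)"
  proof (rule injI)
    fix n n' assume "((+) k ^^ n) m = ((+) k ^^ n') m"
    then have "int n * lookup k c + lookup m c =
        int n' * lookup k c + lookup m c"
      unfolding val[symmetric] by (rule arg_cong)
    then show "n = n'" using c by (simp only: add_right_cancel mult_cancel_right of_nat_eq_iff) blast
  qed
  moreover have "range (\<lambda>n. ((+) k ^^ n) m) \<subseteq> keys q"
    using eq m by (auto simp: in_keys_iff)
  ultimately show False
    using finite_imageD[of "\<lambda>n. ((+) k ^^ n) m" UNIV] finite_subset[OF _ finite_keys] by auto
qed

text \<open>Modulo \<open>x_a - x_b\<close>, that is after the substitution, \<open>x^k - 1\<close>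
  keeps its form and is no zero divisor as long as the substituted exponent is nonzero.\<close>

lemma laurent_dvd_cancel:
  assumes "laurent_dvd E (xpow a 1 - xpow b 1) ((single k 1 - 1) * q)"
    and "q \<in> laurent E" "a \<in> E" "b \<in> E" "a \<noteq> b" and k: "subst_exponent a b k \<noteq> 0"
  shows "laurent_dvd E (xpow a 1 - xpow b 1) q"
proof (rule dvd_subst_var)
  have "0 = subst_var a b (single k 1 * q - q)"
    using subst_var_dvd[OF assms(1)] by (simp add: left_diff_distrib)
  also have "\<dots> = (single (subst_exponent a b k) 1 - 1) * subst_var a b q"
    by (simp add: subst_var_diff subst_var_mult_single left_diff_distrib)
  finally show "subst_var a b q = 0" using mult_monomial_minus_one_cancel k by metis
qed (use assms in auto)

text \<open>\<open>x_a - x_b\<close> and \<open>x_a / x_b - 1\<close> differ by a unit. The latter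
  is the form that extends to all orderings as \<open>x^g - 1\<close> with \<open>g\<close>
  piecewise linear.\<close>

definition ratio_exponent :: "(nat \<Rightarrow> 'a) \<Rightarrow> nat \<Rightarrow> 'a \<Rightarrow>\<^sub>0 int" where
  "ratio_exponent \<sigma> i = single (\<sigma> i) 1 - single (\<sigma> (i + 1)) 1"

lemma laurent_dvd_ratio:
  assumes "laurent_dvd E (xpow (\<sigma> i) 1 - xpow (\<sigma> (i + 1)) 1) p" "\<sigma> (i + 1) \<in> E"
  obtains r where "r \<in> laurent E" "p = (single (ratio_exponent \<sigma> i) 1 - 1) * r"
proof -
  obtain r where r: "r \<in> laurent E" "p = (xpow (\<sigma> i) 1 - xpow (\<sigma> (i + 1)) 1) * r"
    using assms unfolding laurent_dvd_def by blast
  have "xpow (\<sigma> i) 1 - xpow (\<sigma> (i + 1)) 1 =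
      (single (ratio_exponent \<sigma> i) 1 - 1) * xpow (\<sigma> (i + 1)) 1"
    by (simp add: xpow_def ratio_exponent_def left_diff_distrib mult_single)
  then have "p = (single (ratio_exponent \<sigma> i) 1 - 1) * (xpow (\<sigma> (i + 1)) 1 * r)"
    using r(2) by (simp add: mult.assoc)
  moreover have "xpow (\<sigma> (i + 1)) 1 * r \<in> laurent E"
    unfolding xpow_def using assms(2) r(1) by (intro laurent_mult laurent_single) auto
  ultimately show thesis using that by blast
qed

text \<open>The factors are pairwise coprime: the substitution for \<open>j\<close> does not turn
  the ratio for another \<open>i\<close> into 1. So divisibility by the factor for \<open>j\<close>
  passes to the quotient by the factors already extracted.\<close>

lemma laurent_dvd_prod:
  assumes \<sigma>: "\<sigma> \<in> orderings E" and "D \<subseteq> {1..<card E}" and p: "p \<in> laurent E"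
    and dvd: "\<And>i. i \<in> D \<Longrightarrow> laurent_dvd E (xpow (\<sigma> i) 1 - xpow (\<sigma> (i + 1)) 1) p"
  shows "\<exists>q\<in>laurent E. p = (\<Prod>i\<in>D. single (ratio_exponent \<sigma> i) 1 - 1) * q"
proof -
  have "finite D" using assms(2) finite_subset by blast
  then show ?thesis using assms(2) dvd
  proof (induction D rule: finite_induct)
    case empty
    then show ?case using p by auto
  next
    case (insert j D)
    let ?y = "\<lambda>i. single (ratio_exponent \<sigma> i) 1 - 1 :: 'a laurent"
    obtain q where q: "q \<in> laurent E" "p = (\<Prod>i\<in>D. ?y i) * q"
      using insert.IH insert.prems by auto
    have in_E: "\<sigma> i \<in> E" if "i \<in> {1..card E}" for i using orderings_in[OF \<sigma>] that by blast
    have j: "\<sigma> j \<in> E" "\<sigma> (j + 1) \<in> E" "\<sigma> j \<noteq> \<sigma> (j + 1)"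
      using insert.prems(1) orderings_eq_iff[OF \<sigma>, of j "j + 1"] by (auto intro!: in_E)
    have ratio: "keys (ratio_exponent \<sigma> i) \<subseteq> E" if "i \<in> D" for i
    proof -
      have "\<sigma> i \<in> E" "\<sigma> (i + 1) \<in> E" using that insert.prems(1) by (auto intro!: in_E)
      then show ?thesis
        unfolding ratio_exponent_def
        using keys_diff_subset[of "single (\<sigma> i) (1::int)" "single (\<sigma> (i + 1)) 1"]
        by auto
    qed
    have y: "?y i \<in> laurent E" if "i \<in> D" for i
    proof -
      have "(1 :: 'a laurent) \<in> laurent E" using laurent_single[of 0 E 1] by simp
      then show ?thesis using ratio[OF that] by (intro laurent_diff laurent_single) auto
    qed
    have "laurent_dvd E (xpow (\<sigma> j) 1 - xpow (\<sigma> (j + 1)) 1) ((\<Prod>i\<in>D'. ?y i) * q) \<Longrightarrow>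
        laurent_dvd E (xpow (\<sigma> j) 1 - xpow (\<sigma> (j + 1)) 1) q" if "D' \<subseteq> D" for D'
      using finite_subset[OF that insert.hyps(1)] that
    proof (induction D' rule: finite_induct)
      case (insert i D')
      have ij: "i \<noteq> j" "i \<in> {1..<card E}" "j \<in> {1..<card E}"
        using insert.prems(2) \<open>j \<notin> D\<close> \<open>insert j D \<subseteq> {1..<card E}\<close> by auto
      \<comment> \<open>One of the positions \<open>i\<close>, \<open>i + 1\<close> lies outside
        \<open>{j, j + 1}\<close>; the exponent of its variable in the ratio survives the
        substitution.\<close>
      define c where "c = (if i < j then i else i + 1)"
      have c: "c \<in> {i, i + 1}" "c \<notin> {j, j + 1}" using ij(1) by (auto simp: c_def)
      have "\<sigma> c \<noteq> \<sigma> j" "\<sigma> c \<noteq> \<sigma> (j + 1)" "\<sigma> i \<noteq> \<sigma> (i + 1)"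
        using orderings_eq_iff[OF \<sigma>, of c j] orderings_eq_iff[OF \<sigma>, of c "j + 1"]
          orderings_eq_iff[OF \<sigma>, of i "i + 1"] c ij by auto
      then have "lookup (subst_exponent (\<sigma> j) (\<sigma> (j + 1)) (ratio_exponent \<sigma> i)) (\<sigma> c) \<noteq> 0"
        using c by (auto simp: subst_exponent_def ratio_exponent_def lookup_add lookup_minus
            lookup_single when_def)
      then have "subst_exponent (\<sigma> j) (\<sigma> (j + 1)) (ratio_exponent \<sigma> i) \<noteq> 0" by auto
      moreover have pq: "(\<Prod>i\<in>D'. ?y i) * q \<in> laurent E"
        using insert.hyps(1) insert.prems(2)
      proof (induction D' rule: finite_induct)
        case (insert i D')
        then show ?case using y[of i] by (auto simp: mult.assoc intro!: laurent_mult)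
      qed (simp add: q)
      ultimately have "laurent_dvd E (xpow (\<sigma> j) 1 - xpow (\<sigma> (j + 1)) 1) ((\<Prod>i\<in>D'. ?y i) * q)"
      proof (intro laurent_dvd_cancel[OF _ pq j])
        have "(\<Prod>i\<in>insert i D'. ?y i) * q = ?y i * ((\<Prod>i\<in>D'. ?y i) * q)"
          using insert.hyps by (simp only: prod.insert mult.assoc not_False_eq_True)
        then show "laurent_dvd E (xpow (\<sigma> j) 1 - xpow (\<sigma> (j + 1)) 1) (?y i * ((\<Prod>i\<in>D'. ?y i) * q))"
          using insert.prems(1) by (simp only:)
      qed
      moreover have "D' \<subseteq> D" using insert.prems(2) by simp
      ultimately show ?case using insert.IH by blast
    qed simp
    from this[OF order_refl] have "laurent_dvd E (xpow (\<sigma> j) 1 - xpow (\<sigma> (j + 1)) 1) q"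
      using insert.prems(2)[of j] q(2) by simp
    then obtain r where "r \<in> laurent E" "q = ?y j * r" using laurent_dvd_ratio j by metis
    then show ?case using insert.hyps q(2) by (auto simp: mult_ac)
  qed
qed

section \<open>The monomials \<open>x^g\<close> of piecewise linear functions \<open>g\<close>, and
  their span\<close>

definition flag_exponent :: "'a set \<Rightarrow> ('a set \<Rightarrow> int) \<Rightarrow> (nat \<Rightarrow> 'a) \<Rightarrow> 'a \<Rightarrow>\<^sub>0 int" where
  "flag_exponent E a \<sigma> =
     (\<Sum>k\<in>{1..card E}. single (\<sigma> k) (a (\<sigma> ` {1..k}) - a (\<sigma> ` {1..k - 1})))"

text \<open>This is \<open>x\<^sup>g\<close> for the piecewise linear function \<open>g = pl_comb E a\<close>.\<close>

definition flag_monomial :: "'a set \<Rightarrow> ('a set \<Rightarrow> int) \<Rightarrow> (nat \<Rightarrow> 'a) \<Rightarrow> 'a laurent" where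
  "flag_monomial E a \<sigma> = single (flag_exponent E a \<sigma>) 1"

lemma lookup_flag_exponent:
  assumes "\<sigma> \<in> orderings E" "k \<in> {1..card E}"
  shows "lookup (flag_exponent E a \<sigma>) (\<sigma> k) = a (\<sigma> ` {1..k}) - a (\<sigma> ` {1..k - 1})"
proof -
  have "lookup (flag_exponent E a \<sigma>) (\<sigma> k) =
      (\<Sum>j\<in>{1..card E}. if j = k then a (\<sigma> ` {1..j}) - a (\<sigma> ` {1..j - 1}) else 0)"
    unfolding flag_exponent_def lookup_sum
    using orderings_eq_iff[OF assms(1) _ assms(2)]
    by (intro sum.cong) (auto simp: lookup_single when_def)
  also have "\<dots> = a (\<sigma> ` {1..k}) - a (\<sigma> ` {1..k - 1})"
    using assms(2) by (simp add: sum.delta)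
  finally show ?thesis .
qed

lemma keys_flag_exponent:
  assumes "\<sigma> \<in> orderings E"
  shows "keys (flag_exponent E a \<sigma>) \<subseteq> E"
proof
  fix c assume "c \<in> keys (flag_exponent E a \<sigma>)"
  then have "(\<Sum>k\<in>{1..card E}. lookup
      (single (\<sigma> k) (a (\<sigma> ` {1..k}) - a (\<sigma> ` {1..k - 1}))) c) \<noteq> 0"
    by (simp add: in_keys_iff flag_exponent_def lookup_sum)
  then obtain k where "k \<in> {1..card E}" "lookup
      (single (\<sigma> k) (a (\<sigma> ` {1..k}) - a (\<sigma> ` {1..k - 1}))) c \<noteq> 0"
    by (meson sum.not_neutral_contains_not_neutral)
  then show "c \<in> E" using orderings_in[OF assms, of k] by (auto simp: lookup_single when_def split: if_splits)
qed

lemma exponent_eqI: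
  assumes "\<sigma> \<in> orderings E" "keys m \<subseteq> E" "keys m' \<subseteq> E"
    and "\<And>k. k \<in> {1..card E} \<Longrightarrow> lookup m (\<sigma> k) = lookup m' (\<sigma> k)"
  shows "m = m'"
proof (rule poly_mapping_eqI)
  fix c
  show "lookup m c = lookup m' c"
  proof (cases "c \<in> E")
    case True
    then show ?thesis using orderings_obtain[OF assms(1), of c] assms(4) by metis
  next
    case False
    then show ?thesis using assms(2,3) by (metis in_keys_iff subsetD)
  qed
qed

lemma flag_monomial_mult: "flag_monomial E a \<sigma> * flag_monomial E a' \<sigma> = flag_monomial E (\<lambda>T. a T + a' T) \<sigma>"
proof -
  have "flag_exponent E a \<sigma> + flag_exponent E a' \<sigma> = flag_exponent E (\<lambda>T. a T + a' T) \<sigma>"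
    unfolding flag_exponent_def sum.distrib[symmetric] by (simp add: algebra_simps flip: single_add)
  then show ?thesis by (simp add: flag_monomial_def mult_single)
qed

lemma flag_monomial_zero: "flag_monomial E (\<lambda>_. 0) \<sigma> = 1"
  by (simp add: flag_monomial_def flag_exponent_def)

lemma flag_monomial_linear:
  assumes "\<sigma> \<in> orderings E" "keys m \<subseteq> E"
  shows "flag_monomial E (\<lambda>T. \<Sum>i\<in>T. lookup m i) \<sigma> = single m 1"
proof -
  have "flag_exponent E (\<lambda>T. \<Sum>i\<in>T. lookup m i) \<sigma> = m"
  proof (rule exponent_eqI[OF assms(1) keys_flag_exponent[OF assms(1)] assms(2)])
    fix k assume k: "k \<in> {1..card E}"
    then have "{1..k} = insert k {1..k - 1}" by auto
    moreover have "\<sigma> k \<notin> \<sigma> ` {1..k - 1}"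
    proof -
      have "k - 1 \<le> card E" "\<not> k \<le> k - 1" using k by auto
      then show ?thesis using orderings_prefix_mem[OF assms(1) k] by metis
    qed
    ultimately show "lookup (flag_exponent E (\<lambda>T. \<Sum>i\<in>T. lookup m i) \<sigma>) (\<sigma> k) =
        lookup m (\<sigma> k)"
      unfolding lookup_flag_exponent[OF assms(1) k] by simp
  qed
  then show ?thesis by (simp add: flag_monomial_def)
qed

text \<open>Here \<open>g\<close> is the basis function of the prefix \<open>T\<close>. Together
  with \<open>flag_monomial_other\<close> this shows that \<open>x^g - 1\<close> is the factor from
  \<open>laurent_dvd_prod\<close> at \<open>\<sigma>\<close> and vanishes at every ordering that
  does not begin with \<open>T\<close>.\<close>

lemma flag_monomial_prefix:
  assumes \<sigma>: "\<sigma> \<in> orderings E" and i: "i \<in> {1..<card E}"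
  shows "flag_monomial E (\<lambda>T. of_bool (T = \<sigma> ` {1..i})) \<sigma> = single (ratio_exponent \<sigma> i) 1"
proof -
  have "flag_exponent E (\<lambda>T. of_bool (T = \<sigma> ` {1..i})) \<sigma> = ratio_exponent \<sigma> i"
  proof (rule exponent_eqI[OF \<sigma> keys_flag_exponent[OF \<sigma>]])
    show "keys (ratio_exponent \<sigma> i) \<subseteq> E"
      using orderings_in[OF \<sigma>, of i] orderings_in[OF \<sigma>, of "i + 1"] i
        keys_diff_subset[of "single (\<sigma> i) (1::int)" "single (\<sigma> (i + 1)) 1"]
      by (auto simp: ratio_exponent_def)
    fix k assume k: "k \<in> {1..card E}"
    have "\<sigma> ` {1..k} = \<sigma> ` {1..i} \<longleftrightarrow> k = i" "\<sigma> ` {1..k - 1} = \<sigma> ` {1..i} \<longleftrightarrow> k = i + 1"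
      using orderings_prefix_inj[OF \<sigma>, of k i] orderings_prefix_inj[OF \<sigma>, of "k - 1" i] i k by auto
    moreover have "\<sigma> i = \<sigma> k \<longleftrightarrow> i = k" "\<sigma> (i + 1) = \<sigma> k \<longleftrightarrow> i + 1 = k"
      using orderings_eq_iff[OF \<sigma> _ k] i by auto
    ultimately show "lookup (flag_exponent E (\<lambda>T. of_bool (T = \<sigma> ` {1..i})) \<sigma>) (\<sigma> k) =
        lookup (ratio_exponent \<sigma> i) (\<sigma> k)"
      unfolding lookup_flag_exponent[OF \<sigma> k]
      by (auto simp: ratio_exponent_def lookup_minus lookup_single when_def)
  qed
  then show ?thesis by (simp add: flag_monomial_def)
qed

lemma card_prefix: "\<sigma> \<in> orderings E \<Longrightarrow> k \<le> card E \<Longrightarrow> card (\<sigma> ` {1..k}) = k"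
  using card_image[of \<sigma> "{1..k}"] inj_on_subset[OF orderings_inj, of \<sigma> E "{1..k}"] by auto

text \<open>An ordering can pass through a set only with the prefix of the same size, so all
  increments along \<open>\<sigma>'\<close> are 0.\<close>

lemma flag_monomial_other:
  assumes \<sigma>: "\<sigma> \<in> orderings E" and \<sigma>': "\<sigma>' \<in> orderings E" and i: "i \<le> card E"
    and ne: "\<sigma>' ` {1..i} \<noteq> \<sigma> ` {1..i}"
  shows "flag_monomial E (\<lambda>T. of_bool (T = \<sigma> ` {1..i})) \<sigma>' = 1"
proof -
  have "\<sigma>' ` {1..k} \<noteq> \<sigma> ` {1..i}" if "k \<le> card E" for k
    using card_prefix[OF \<sigma>' that] card_prefix[OF \<sigma> i] ne by metis
  then have "a (\<sigma>' ` {1..k}) - a (\<sigma>' ` {1..k - 1}) = 0"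
    if "k \<in> {1..card E}" "a = (\<lambda>T. of_bool (T = \<sigma> ` {1..i}))" for k and a :: "'a set \<Rightarrow> int"
    using that by auto
  then have "flag_exponent E (\<lambda>T. of_bool (T = \<sigma> ` {1..i})) \<sigma>' = 0"
    unfolding flag_exponent_def by (intro sum.neutral) auto
  then show ?thesis by (simp add: flag_monomial_def)
qed

text \<open>Integer combinations are built one signed monomial at a time, the form in which additive
  statements about \<open>chi\<close> are proved. The premises constrain values at
  \<open>orderings E\<close> only, so that total functions can be combined pointwise.\<close>

inductive plaur_span :: "'a set \<Rightarrow> ((nat \<Rightarrow> 'a) \<Rightarrow> 'a laurent) \<Rightarrow> bool" for E where
  zero: "(\<And>\<sigma>. \<sigma> \<in> orderings E \<Longrightarrow> f \<sigma> = 0) \<Longrightarrow> plaur_span E f"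
| add: "plaur_span E f \<Longrightarrow> a {} = 0 \<Longrightarrow>
    (\<And>\<sigma>. \<sigma> \<in> orderings E \<Longrightarrow> g \<sigma> = f \<sigma> + flag_monomial E a \<sigma>) \<Longrightarrow> plaur_span E g"
| sub: "plaur_span E f \<Longrightarrow> a {} = 0 \<Longrightarrow>
    (\<And>\<sigma>. \<sigma> \<in> orderings E \<Longrightarrow> g \<sigma> = f \<sigma> - flag_monomial E a \<sigma>) \<Longrightarrow> plaur_span E g"

lemma plaur_span_cong:
  "plaur_span E f \<Longrightarrow> (\<And>\<sigma>. \<sigma> \<in> orderings E \<Longrightarrow> g \<sigma> = f \<sigma>) \<Longrightarrow> plaur_span E g"
proof (induction arbitrary: g rule: plaur_span.induct)
  case (zero f)
  then show ?case by (simp add: plaur_span.zero)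
next
  case (add f a h)
  then show ?case by (intro plaur_span.add[of E f a g]) auto
next
  case (sub f a h)
  then show ?case by (intro plaur_span.sub[of E f a g]) auto
qed

lemma plaur_span_add:
  "plaur_span E g \<Longrightarrow> plaur_span E f \<Longrightarrow> plaur_span E (\<lambda>\<sigma>. f \<sigma> + g \<sigma>)"
proof (induction rule: plaur_span.induct)
  case (zero g)
  then show ?case by (auto intro: plaur_span_cong)
next
  case (add g a h)
  then have "plaur_span E (\<lambda>\<sigma>. f \<sigma> + g \<sigma>)" by blast
  then show ?case by (rule plaur_span.add[where a = a]) (simp_all add: add)
next
  case (sub g a h)
  then have "plaur_span E (\<lambda>\<sigma>. f \<sigma> + g \<sigma>)" by blast
  then show ?case by (rule plaur_span.sub[where a = a]) (simp_all add: sub)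
qed

lemma plaur_span_uminus: "plaur_span E f \<Longrightarrow> plaur_span E (\<lambda>\<sigma>. - f \<sigma>)"
proof (induction rule: plaur_span.induct)
  case (zero f)
  then show ?case by (intro plaur_span.zero) simp
next
  case (add f a g)
  then show ?case by (intro plaur_span.sub[where a = a, OF add.IH]) simp_all
next
  case (sub f a g)
  then show ?case by (intro plaur_span.add[where a = a, OF sub.IH]) simp_all
qed

lemma plaur_span_diff: "plaur_span E f \<Longrightarrow> plaur_span E g \<Longrightarrow> plaur_span E (\<lambda>\<sigma>. f \<sigma> - g \<sigma>)"
  using plaur_span_add[OF plaur_span_uminus, of E g f] by simp

lemma plaur_span_flag_monomial: "a {} = 0 \<Longrightarrow> plaur_span E (flag_monomial E a)"
  by (rule plaur_span.add[OF plaur_span.zero[of E "\<lambda>_. 0"]]) auto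

lemma plaur_span_mult_flag_monomial:
  assumes "plaur_span E f" "a {} = 0"
  shows "plaur_span E (\<lambda>\<sigma>. f \<sigma> * flag_monomial E a \<sigma>)"
  using assms(1)
proof (induction rule: plaur_span.induct)
  case (zero f)
  then show ?case by (intro plaur_span.zero) simp
next
  case (add f c g)
  then show ?case using assms(2)
    by (intro plaur_span.add[where a = "\<lambda>T. c T + a T", OF add.IH])
      (simp_all add: algebra_simps flip: flag_monomial_mult)
next
  case (sub f c g)
  then show ?case using assms(2)
    by (intro plaur_span.sub[where a = "\<lambda>T. c T + a T", OF sub.IH])
      (simp_all add: left_diff_distrib flip: flag_monomial_mult)
qed

lemma plaur_span_mult:
  "plaur_span E g \<Longrightarrow> plaur_span E f \<Longrightarrow> plaur_span E (\<lambda>\<sigma>. f \<sigma> * g \<sigma>)"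
proof (induction rule: plaur_span.induct)
  case (zero g)
  then show ?case by (intro plaur_span.zero) simp
next
  case (add g a h)
  then have "plaur_span E (\<lambda>\<sigma>. f \<sigma> * g \<sigma> + f \<sigma> * flag_monomial E a \<sigma>)"
    by (intro plaur_span_add plaur_span_mult_flag_monomial) auto
  then show ?case by (rule plaur_span_cong) (simp add: add algebra_simps)
next
  case (sub g a h)
  then have "plaur_span E (\<lambda>\<sigma>. f \<sigma> * g \<sigma> - f \<sigma> * flag_monomial E a \<sigma>)"
    by (intro plaur_span_diff plaur_span_mult_flag_monomial) auto
  then show ?case by (rule plaur_span_cong) (simp add: sub algebra_simps)
qed

lemma plaur_span_one: "plaur_span E (\<lambda>_. 1)"
  using plaur_span_flag_monomial[of "\<lambda>_. 0" E] by (simp add: flag_monomial_zero[abs_def])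

lemma plaur_span_of_int: "plaur_span E (\<lambda>_. of_int c)"
proof -
  have nat: "plaur_span E (\<lambda>_. of_nat n)" for n
  proof (induction n)
    case (Suc n)
    then show ?case using plaur_span_add[OF Suc plaur_span_one] by simp
  qed (simp add: plaur_span.zero)
  show ?thesis
    using nat plaur_span_uminus[OF nat] by (cases c rule: int_cases2) simp_all
qed

lemma plaur_span_sum:
  "(\<And>i. i \<in> I \<Longrightarrow> plaur_span E (f i)) \<Longrightarrow> plaur_span E (\<lambda>\<sigma>. \<Sum>i\<in>I. f i \<sigma>)"
  by (induction I rule: infinite_finite_induct) (auto intro: plaur_span.zero plaur_span_add)

lemma plaur_span_prod:
  "(\<And>i. i \<in> I \<Longrightarrow> plaur_span E (f i)) \<Longrightarrow> plaur_span E (\<lambda>\<sigma>. \<Prod>i\<in>I. f i \<sigma>)"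
  by (induction I rule: infinite_finite_induct) (auto intro: plaur_span_one plaur_span_mult)

text \<open>\<open>PLaur\<close> without the requirement of being undefined off
  \<open>orderings E\<close>, so that pointwise sums stay in the class.\<close>

definition piecewise_laurent :: "'a set \<Rightarrow> ((nat \<Rightarrow> 'a) \<Rightarrow> 'a laurent) \<Rightarrow> bool" where
  "piecewise_laurent E f \<longleftrightarrow> (\<forall>\<sigma>\<in>orderings E. f \<sigma> \<in> laurent E \<and> (\<forall>i\<in>{1..<card E}.
     laurent_dvd E (xpow (\<sigma> i) 1 - xpow (\<sigma> (i + 1)) 1) (f \<sigma> - f (\<sigma> \<circ> transpose i (i + 1)))))"

lemma piecewise_laurent_add:
  assumes "piecewise_laurent E f" "piecewise_laurent E g"
    and "\<And>\<sigma>. \<sigma> \<in> orderings E \<Longrightarrow> h \<sigma> = f \<sigma> + g \<sigma>"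
  shows "piecewise_laurent E h"
  unfolding piecewise_laurent_def
proof (intro ballI conjI)
  fix \<sigma> assume \<sigma>: "\<sigma> \<in> orderings E"
  then show "h \<sigma> \<in> laurent E"
    using assms unfolding piecewise_laurent_def by (simp add: laurent_add)
  fix i assume i: "i \<in> {1..<card E}"
  let ?t = "\<sigma> \<circ> transpose i (i + 1)"
  have "h \<sigma> - h ?t = (f \<sigma> - f ?t) + (g \<sigma> - g ?t)"
    using assms(3) \<sigma> orderings_transpose[OF \<sigma> i] by simp
  then show "laurent_dvd E (xpow (\<sigma> i) 1 - xpow (\<sigma> (i + 1)) 1) (h \<sigma> - h ?t)"
    using assms(1,2) \<sigma> i unfolding piecewise_laurent_def by (simp add: laurent_dvd_add)
qed

lemma piecewise_laurent_uminus: "piecewise_laurent E f \<Longrightarrow> piecewise_laurent E (\<lambda>\<sigma>. - f \<sigma>)"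
  unfolding piecewise_laurent_def
  using laurent_dvd_uminus[of E _ "f _ - f _"] by (auto simp: laurent_uminus)

text \<open>Swapping positions \<open>i\<close> and \<open>i + 1\<close> changes only the prefix of
  length \<open>i\<close>, whose coefficient cancels in the sum of the two exponents
  involved.\<close>

lemma piecewise_laurent_flag_monomial: "piecewise_laurent E (flag_monomial E a)"
  unfolding piecewise_laurent_def
proof (intro ballI conjI)
  fix \<sigma> assume \<sigma>: "\<sigma> \<in> orderings E"
  show "flag_monomial E a \<sigma> \<in> laurent E"
    unfolding flag_monomial_def by (intro laurent_single keys_flag_exponent \<sigma>)
  fix i assume i: "i \<in> {1..<card E}"
  let ?t = "\<sigma> \<circ> transpose i (i + 1)"
  let ?l = "lookup (flag_exponent E a \<sigma>)" and ?l' = "lookup (flag_exponent E a ?t)"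
  have t: "?t \<in> orderings E" by (rule orderings_transpose[OF \<sigma> i])
  have i': "i \<in> {1..card E}" "i + 1 \<in> {1..card E}" using i by auto
  have pre: "?t ` {1..j} = \<sigma> ` {1..j}" if "j \<noteq> i" for j
    using that i by (intro image_transpose_prefix) auto
  have tv: "?t i = \<sigma> (i + 1)" "?t (i + 1) = \<sigma> i" by simp_all
  show "laurent_dvd E (xpow (\<sigma> i) 1 - xpow (\<sigma> (i + 1)) 1)
      (flag_monomial E a \<sigma> - flag_monomial E a ?t)"
    unfolding flag_monomial_def
  proof (rule laurent_dvd_monomials[OF keys_flag_exponent[OF \<sigma>] keys_flag_exponent[OF t]])
    show "\<sigma> i \<in> E" "\<sigma> (i + 1) \<in> E" "\<sigma> i \<noteq> \<sigma> (i + 1)"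
      using orderings_in[OF \<sigma> i'(1)] orderings_in[OF \<sigma> i'(2)] orderings_eq_iff[OF \<sigma> i'] by auto
    have "i - 1 \<noteq> i" using i by auto
    then show "?l (\<sigma> i) + ?l (\<sigma> (i + 1)) = ?l' (\<sigma> i) + ?l' (\<sigma> (i + 1))"
      using lookup_flag_exponent[OF \<sigma> i'(1), of a] lookup_flag_exponent[OF \<sigma> i'(2), of a]
        lookup_flag_exponent[OF t i'(1), of a] lookup_flag_exponent[OF t i'(2), of a]
        pre[of "i + 1"] pre[of "i - 1"] i unfolding tv by simp
    fix c assume c: "c \<noteq> \<sigma> i" "c \<noteq> \<sigma> (i + 1)"
    show "?l c = ?l' c"
    proof (cases "c \<in> E")
      case True
      then obtain k where k: "k \<in> {1..card E}" "c = \<sigma> k" using orderings_obtain[OF \<sigma>] by metis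
      then have ki: "k \<noteq> i" "k \<noteq> i + 1" using c by auto
      then have "?t k = c" using k(2) by (simp add: transpose_def)
      moreover have "k - 1 \<noteq> i" using ki k(1) by auto
      ultimately show ?thesis
        using lookup_flag_exponent[OF \<sigma> k(1), of a] lookup_flag_exponent[OF t k(1), of a]
          pre[OF ki(1)] pre[of "k - 1"] k(2) by simp
    next
      case False
      then show ?thesis
        using keys_flag_exponent[OF \<sigma>, of a] keys_flag_exponent[OF t, of a] by (metis in_keys_iff subsetD)
    qed
  qed
qed

lemma plaur_span_piecewise_laurent: "plaur_span E f \<Longrightarrow> piecewise_laurent E f"
proof (induction rule: plaur_span.induct)
  case (zero f)
  then have "f \<sigma> = 0" "f (\<sigma> \<circ> transpose i (i + 1)) = 0"
    if "\<sigma> \<in> orderings E" "i \<in> {1..<card E}" for \<sigma> i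
    using orderings_transpose[OF that] that by blast+
  then show ?case using zero
    unfolding piecewise_laurent_def by (auto simp only: laurent_0 diff_self laurent_dvd_0)
next
  case (add f a g)
  then show ?case using piecewise_laurent_add[OF _ piecewise_laurent_flag_monomial] by blast
next
  case (sub f a g)
  then show ?case
    by (intro piecewise_laurent_add[OF sub.IH piecewise_laurent_uminus[OF piecewise_laurent_flag_monomial]]) simp
qed

section \<open>Inversions relative to a fixed numbering of the elements\<close>

definition inversions :: "('a \<Rightarrow> nat) \<Rightarrow> 'a set \<Rightarrow> (nat \<Rightarrow> 'a) \<Rightarrow> ('a \<times> 'a) set" where
  "inversions \<rho> E \<sigma> = {(\<sigma> i, \<sigma> j) | i j. i \<in> {1..card E} \<and> j \<in> {1..card E} \<and> i < j \<and> \<rho> (\<sigma> j) < \<rho> (\<sigma> i)}"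

lemma inversions_subset: "\<sigma> \<in> orderings E \<Longrightarrow> inversions \<rho> E \<sigma> \<subseteq> E \<times> E"
  unfolding inversions_def using orderings_in[of \<sigma> E] by auto

text \<open>Inversions are recorded as pairs of elements, not of positions. Swapping two neighbours
  therefore affects only their own pair, which disappears in the case of a descent.\<close>

lemma inversions_transpose_descent:
  assumes fin: "finite E" and \<sigma>: "\<sigma> \<in> orderings E" and i: "i \<in> {1..<card E}" and d: "\<rho> (\<sigma> (i + 1)) < \<rho> (\<sigma> i)"
  shows "card (inversions \<rho> E (\<sigma> \<circ> transpose i (i + 1))) < card (inversions \<rho> E \<sigma>)"
proof (rule psubset_card_mono)
  let ?s = "transpose i (i + 1)"
  show "finite (inversions \<rho> E \<sigma>)"
    using inversions_subset[OF \<sigma>] fin finite_subset finite_SigmaI by metis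
  have i': "i \<in> {1..card E}" "i + 1 \<in> {1..card E}" using i by auto
  have mem: "?s k \<in> {1..card E}" if "k \<in> {1..card E}" for k using that i' by (auto simp: transpose_def)
  show "inversions \<rho> E (\<sigma> \<circ> ?s) \<subset> inversions \<rho> E \<sigma>"
  proof (rule psubsetI)
    show "inversions \<rho> E (\<sigma> \<circ> ?s) \<subseteq> inversions \<rho> E \<sigma>"
    proof
      fix z assume "z \<in> inversions \<rho> E (\<sigma> \<circ> ?s)"
      then obtain j k where z: "z = (\<sigma> (?s j), \<sigma> (?s k))" and jk: "j \<in> {1..card E}" "k \<in> {1..card E}" "j < k"
          "\<rho> (\<sigma> (?s k)) < \<rho> (\<sigma> (?s j))"
        unfolding inversions_def by auto
      have "\<not> (j = i \<and> k = i + 1)" using jk(4) d by auto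
      then have "?s j < ?s k" using jk(3) by (auto simp: transpose_def)
      then show "z \<in> inversions \<rho> E \<sigma>" unfolding inversions_def z using jk mem by blast
    qed
    have "(\<sigma> i, \<sigma> (i + 1)) \<in> inversions \<rho> E \<sigma>" unfolding inversions_def using i' d by force
    moreover have "(\<sigma> i, \<sigma> (i + 1)) \<notin> inversions \<rho> E (\<sigma> \<circ> ?s)"
    proof
      assume "(\<sigma> i, \<sigma> (i + 1)) \<in> inversions \<rho> E (\<sigma> \<circ> ?s)"
      then obtain j k where jk: "j \<in> {1..card E}" "k \<in> {1..card E}" "j < k" "\<sigma> i = \<sigma> (?s j)" "\<sigma> (i + 1) = \<sigma> (?s k)"
        unfolding inversions_def by auto
      then have "i = ?s j" "i + 1 = ?s k"
        using orderings_eq_iff[OF \<sigma> i'(1) mem[OF jk(1)]] orderings_eq_iff[OF \<sigma> i'(2) mem[OF jk(2)]] by auto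
      then show False using jk(3) by (auto simp: transpose_def split: if_splits)
    qed
    ultimately show "inversions \<rho> E (\<sigma> \<circ> ?s) \<noteq> inversions \<rho> E \<sigma>" by blast
  qed
qed

text \<open>The inversions fix the relative order of every pair, and the position of
  \<open>x\<close> is the number of elements that do not come after \<open>x\<close>.\<close>

lemma orderings_eqI:
  assumes fin: "finite E" and \<sigma>: "\<sigma> \<in> orderings E" and \<tau>: "\<tau> \<in> orderings E" and \<rho>: "inj_on \<rho> E"
    and inv: "inversions \<rho> E \<sigma> = inversions \<rho> E \<tau>"
  shows "\<sigma> = \<tau>"
proof -
  define pos where "pos \<sigma> = the_inv_into {1..card E} \<sigma>" for \<sigma> :: "nat \<Rightarrow> 'a"
  have pos: "pos \<upsilon> x \<in> {1..card E}" "\<upsilon> (pos \<upsilon> x) = x" if "\<upsilon> \<in> orderings E" "x \<in> E" for \<upsilon> x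
    using the_inv_into_into[OF orderings_inj[OF that(1)], of x "{1..card E}"]
      f_the_inv_into_f[OF orderings_inj[OF that(1)], of x] orderings_image[OF that(1)] that(2)
    by (auto simp: pos_def)
  have mem: "(x, y) \<in> inversions \<rho> E \<upsilon> \<longleftrightarrow> pos \<upsilon> x < pos \<upsilon> y"
    if "\<upsilon> \<in> orderings E" "x \<in> E" "y \<in> E" "\<rho> y < \<rho> x" for \<upsilon> x y
  proof
    assume "(x, y) \<in> inversions \<rho> E \<upsilon>"
    then obtain i j where ij: "x = \<upsilon> i" "y = \<upsilon> j" "i \<in> {1..card E}" "j \<in> {1..card E}" "i < j"
      unfolding inversions_def by auto
    then show "pos \<upsilon> x < pos \<upsilon> y"
      using the_inv_into_f_f[OF orderings_inj[OF that(1)]] by (simp add: pos_def)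
  next
    assume "pos \<upsilon> x < pos \<upsilon> y"
    then show "(x, y) \<in> inversions \<rho> E \<upsilon>"
      unfolding inversions_def using pos[OF that(1)] that by (intro CollectI exI[of _ "pos \<upsilon> x"] exI[of _ "pos \<upsilon> y"]) auto
  qed
  have same: "pos \<sigma> x < pos \<sigma> y \<longleftrightarrow> pos \<tau> x < pos \<tau> y" if "x \<in> E" "y \<in> E" "x \<noteq> y" for x y
  proof (cases "\<rho> y < \<rho> x")
    case True
    then show ?thesis using mem[OF \<sigma> that(1,2)] mem[OF \<tau> that(1,2)] inv by simp
  next
    case False
    then have "\<rho> x < \<rho> y" using \<rho> that by (metis inj_onD linorder_neqE_nat)
    then have "pos \<sigma> y < pos \<sigma> x \<longleftrightarrow> pos \<tau> y < pos \<tau> x"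
      using mem[OF \<sigma> that(2,1)] mem[OF \<tau> that(2,1)] inv by simp
    moreover have "pos \<sigma> x \<noteq> pos \<sigma> y" "pos \<tau> x \<noteq> pos \<tau> y" using pos \<sigma> \<tau> that by metis+
    ultimately show ?thesis by linarith
  qed
  have count: "pos \<upsilon> x = card {y \<in> E. pos \<upsilon> y \<le> pos \<upsilon> x}" if "\<upsilon> \<in> orderings E" "x \<in> E" for \<upsilon> x
  proof -
    have "{y \<in> E. pos \<upsilon> y \<le> pos \<upsilon> x} = \<upsilon> ` {1..pos \<upsilon> x}"
    proof (intro equalityI subsetI)
      fix y assume "y \<in> {y \<in> E. pos \<upsilon> y \<le> pos \<upsilon> x}"
      then show "y \<in> \<upsilon> ` {1..pos \<upsilon> x}" using pos[OF that(1), of y] by (intro image_eqI[of _ _ "pos \<upsilon> y"]) auto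
    next
      fix y assume "y \<in> \<upsilon> ` {1..pos \<upsilon> x}"
      then obtain j where j: "j \<in> {1..pos \<upsilon> x}" "y = \<upsilon> j" by blast
      then have "j \<in> {1..card E}" using pos[OF that] by auto
      then show "y \<in> {y \<in> E. pos \<upsilon> y \<le> pos \<upsilon> x}"
        using j orderings_in[OF that(1)] the_inv_into_f_f[OF orderings_inj[OF that(1)]] by (auto simp: pos_def)
    qed
    then show ?thesis using card_prefix[OF that(1)] pos[OF that] by simp
  qed
  have "pos \<sigma> x = pos \<tau> x" if "x \<in> E" for x
  proof -
    have "pos \<sigma> y \<le> pos \<sigma> x \<longleftrightarrow> pos \<tau> y \<le> pos \<tau> x" if "y \<in> E" for y
      using same[OF \<open>x \<in> E\<close> that] by (cases "x = y") (auto simp: not_less[symmetric])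
    then have "{y \<in> E. pos \<sigma> y \<le> pos \<sigma> x} = {y \<in> E. pos \<tau> y \<le> pos \<tau> x}" by auto
    then show ?thesis using count[OF \<sigma> that] count[OF \<tau> that] by simp
  qed
  then have "\<sigma> k = \<tau> k" if "k \<in> {1..card E}" for k
    using pos(2)[OF \<tau> orderings_in[OF \<sigma> that]] the_inv_into_f_f[OF orderings_inj[OF \<sigma>] that]
      orderings_in[OF \<sigma> that] by (simp add: pos_def)
  moreover have "\<sigma> k = \<tau> k" if "k \<notin> {1..card E}" for k
    using \<sigma> \<tau> that by (auto simp: orderings_def extensional_def)
  ultimately show ?thesis by blast
qed

text \<open>Between descents \<open>\<rho>\<close> increases along \<open>\<sigma>\<close>, so every
  inversion of \<open>\<sigma>\<close> straddles a descent. As \<open>\<tau>\<close> shares the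
  prefix there, it has the same inversion: \<open>\<sigma>\<close> is the unique minimum among the
  orderings through its descent prefixes.\<close>

lemma inversions_descent_flag:
  assumes fin: "finite E" and \<sigma>: "\<sigma> \<in> orderings E" and \<tau>: "\<tau> \<in> orderings E" and \<rho>: "inj_on \<rho> E"
    and flag: "\<And>i. i \<in> {1..<card E} \<Longrightarrow> \<rho> (\<sigma> (i + 1)) < \<rho> (\<sigma> i) \<Longrightarrow> \<tau> ` {1..i} = \<sigma> ` {1..i}"
    and ne: "\<tau> \<noteq> \<sigma>"
  shows "card (inversions \<rho> E \<sigma>) < card (inversions \<rho> E \<tau>)"
proof (rule psubset_card_mono)
  show "finite (inversions \<rho> E \<tau>)"
    using inversions_subset[OF \<tau>] fin finite_subset finite_SigmaI by metis
  have "inversions \<rho> E \<sigma> \<subseteq> inversions \<rho> E \<tau>"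
  proof
    fix z assume "z \<in> inversions \<rho> E \<sigma>"
    then obtain j k where z: "z = (\<sigma> j, \<sigma> k)" and jk: "j \<in> {1..card E}" "k \<in> {1..card E}" "j < k"
        "\<rho> (\<sigma> k) < \<rho> (\<sigma> j)"
      unfolding inversions_def by auto
    have "\<exists>i\<in>{j..<k}. \<rho> (\<sigma> (i + 1)) < \<rho> (\<sigma> i)"
    proof (rule ccontr)
      assume *: "\<not> ?thesis"
      have "j \<le> k" using jk by simp
      then have "\<rho> (\<sigma> j) \<le> \<rho> (\<sigma> k)" using *
      proof (induction k rule: dec_induct)
        case (step n)
        then have "\<rho> (\<sigma> j) \<le> \<rho> (\<sigma> n)" by auto
        moreover have "\<rho> (\<sigma> n) \<le> \<rho> (\<sigma> (n + 1))" using step by (auto simp: not_less)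
        ultimately show ?case by simp
      qed simp
      then show False using jk by simp
    qed
    then obtain i where i: "j \<le> i" "i < k" "\<rho> (\<sigma> (i + 1)) < \<rho> (\<sigma> i)" by auto
    then have i': "i \<in> {1..<card E}" using jk by auto
    have eq: "\<tau> ` {1..i} = \<sigma> ` {1..i}" using flag[OF i' i(3)] .
    have "\<sigma> j \<in> \<tau> ` {1..i}" unfolding eq using i jk by auto
    then obtain p where p: "p \<in> {1..i}" "\<sigma> j = \<tau> p" by blast
    have "\<sigma> k \<notin> \<tau> ` {1..i}" unfolding eq using orderings_prefix_mem[OF \<sigma> jk(2), of i] i i' by auto
    moreover obtain q where q: "q \<in> {1..card E}" "\<sigma> k = \<tau> q"
      using orderings_obtain[OF \<tau> orderings_in[OF \<sigma> jk(2)]] by metis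
    ultimately have "i < q" by (metis atLeastAtMost_iff image_eqI not_less)
    then show "z \<in> inversions \<rho> E \<tau>"
      unfolding inversions_def z using p q jk(4) i' by (intro CollectI exI[of _ p] exI[of _ q]) auto
  qed
  then show "inversions \<rho> E \<sigma> \<subset> inversions \<rho> E \<tau>"
    using orderings_eqI[OF fin \<sigma> \<tau> \<rho>] ne by blast
qed

text \<open>The value of \<open>f\<close> at a \<open>\<sigma>\<close> with the fewest inversions among those where \<open>f\<close> does not vanish is
  divisible by all \<open>y\<^sub>i - 1\<close> for descents \<open>i\<close>. The product of these factors extends to a combination
  of monomials that vanishes at all other orderings with at most as many inversions, which makes
  it possible to clear the values of \<open>f\<close> one by one.\<close>

lemma piecewise_laurent_span:
  assumes fin: "finite E" and f: "piecewise_laurent E f"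
  shows "plaur_span E f"
proof -
  obtain \<rho> :: "'a \<Rightarrow> nat" where \<rho>: "inj_on \<rho> E" using finite_imp_inj_to_nat_seg[OF fin] by blast
  let ?v = "\<lambda>\<sigma>. card (inversions \<rho> E \<sigma>)"
  have finO: "finite (orderings E)"
    using list_of_bij[OF fin] bij_betw_finite finite_permutations_of_set by blast
  \<comment> \<open>\<open>S\<close> collects the orderings at which \<open>f\<close> has been
    cleared; it is filled up in order of the number of inversions.\<close>
  have "plaur_span E f" if "S \<subseteq> orderings E" "\<And>\<sigma> \<tau>. \<sigma> \<in> S \<Longrightarrow> \<tau> \<in> orderings E - S \<Longrightarrow> ?v \<sigma> \<le> ?v \<tau>"
    "\<And>\<sigma>. \<sigma> \<in> S \<Longrightarrow> f \<sigma> = 0" "piecewise_laurent E f" for S f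
    using that
  proof (induction "card (orderings E - S)" arbitrary: S f rule: less_induct)
    case less
    show ?case
    proof (cases "S = orderings E")
      case True
      then show ?thesis using less.prems by (intro plaur_span.zero) auto
    next
      case False
      then have neO: "orderings E - S \<noteq> {}" using less.prems(1) by blast
      define \<sigma> where "\<sigma> = arg_min_on ?v (orderings E - S)"
      have \<sigma>S: "\<sigma> \<in> orderings E - S" and min: "\<And>\<tau>. \<tau> \<in> orderings E - S \<Longrightarrow> ?v \<sigma> \<le> ?v \<tau>"
        using arg_min_if_finite[of "orderings E - S" ?v] finO neO unfolding \<sigma>_def
        by (auto simp: not_less[symmetric])
      then have \<sigma>: "\<sigma> \<in> orderings E" by blast
      define D where "D = {i \<in> {1..<card E}. \<rho> (\<sigma> (i + 1)) < \<rho> (\<sigma> i)}"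
      have dvd: "laurent_dvd E (xpow (\<sigma> i) 1 - xpow (\<sigma> (i + 1)) 1) (f \<sigma>)" if i: "i \<in> D" for i
      proof -
        have i': "i \<in> {1..<card E}" "\<rho> (\<sigma> (i + 1)) < \<rho> (\<sigma> i)" using i by (auto simp: D_def)
        let ?t = "\<sigma> \<circ> transpose i (i + 1)"
        \<comment> \<open>Undoing a descent leads into \<open>S\<close>, where \<open>f\<close>
          vanishes; the divisibility condition then concerns \<open>f \<sigma>\<close>
          alone.\<close>
        have "?v ?t < ?v \<sigma>" by (rule inversions_transpose_descent[where \<rho> = \<rho>, OF fin \<sigma> i'])
        then have "?t \<in> S" using min[of ?t] orderings_transpose[OF \<sigma> i'(1)] by auto
        then have "f ?t = 0" using less.prems by blast
        moreover have "laurent_dvd E (xpow (\<sigma> i) 1 - xpow (\<sigma> (i + 1)) 1) (f \<sigma> - f ?t)"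
          using less.prems(4) \<sigma> i' unfolding piecewise_laurent_def by blast
        ultimately show ?thesis by simp
      qed
      have "f \<sigma> \<in> laurent E" using less.prems(4) \<sigma> unfolding piecewise_laurent_def by blast
      moreover have "D \<subseteq> {1..<card E}" by (auto simp: D_def)
      ultimately obtain q where q: "q \<in> laurent E"
        "f \<sigma> = (\<Prod>i\<in>D. single (ratio_exponent \<sigma> i) 1 - 1) * q"
        using laurent_dvd_prod[OF \<sigma> _ _ dvd] by blast
      \<comment> \<open>The quotient \<open>q\<close> is extended to all orderings by treating its
        exponents as linear functions, whose monomials are the same at every ordering.\<close>
      define c where "c \<tau> = (\<Prod>i\<in>D. flag_monomial E (\<lambda>T. of_bool (T = \<sigma> ` {1..i})) \<tau> - 1) *
        (\<Sum>m\<in>keys q. of_int (lookup q m) *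
          flag_monomial E (\<lambda>T. \<Sum>i\<in>T. lookup m i) \<tau>)" for \<tau>
      have span: "plaur_span E c"
        unfolding c_def[abs_def]
        by (intro plaur_span_mult plaur_span_prod plaur_span_sum plaur_span_diff
            plaur_span_flag_monomial plaur_span_one plaur_span_of_int) (auto simp: D_def)
      have c\<sigma>: "c \<sigma> = f \<sigma>"
      proof -
        have "(\<Sum>m\<in>keys q. of_int (lookup q m) *
            flag_monomial E (\<lambda>T. \<Sum>i\<in>T. lookup m i) \<sigma>) =
          (\<Sum>m\<in>keys q. single m (lookup q m))"
        proof (rule sum.cong[OF refl])
          fix m assume "m \<in> keys q"
          then have "keys m \<subseteq> E" using q(1) by (auto simp: laurent_def)
          then have "flag_monomial E (\<lambda>T. \<Sum>i\<in>T. lookup m i) \<sigma> = single m 1"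
            by (rule flag_monomial_linear[OF \<sigma>])
          then show "of_int (lookup q m) *
              flag_monomial E (\<lambda>T. \<Sum>i\<in>T. lookup m i) \<sigma> =
              single m (lookup q m)"
            by (simp add: mult_single flip: single_of_int)
        qed
        also have "\<dots> = q" using single_sum_expand[of "keys q" q] by simp
        finally show ?thesis
          unfolding c_def q(2) using flag_monomial_prefix[OF \<sigma>]
          by (intro arg_cong2[of _ _ _ _ "(*)"] prod.cong) (auto simp: D_def)
      qed
      have c0: "c \<tau> = 0" if \<tau>: "\<tau> \<in> S" for \<tau>
      proof -
        have \<tau>O: "\<tau> \<in> orderings E" and "\<tau> \<noteq> \<sigma>" "?v \<tau> \<le> ?v \<sigma>" using \<tau> \<sigma>S less.prems by auto
        have "\<exists>i\<in>D. \<tau> ` {1..i} \<noteq> \<sigma> ` {1..i}"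
        proof (rule ccontr)
          assume "\<not> ?thesis"
          then have "\<tau> ` {1..i} = \<sigma> ` {1..i}" if "i \<in> {1..<card E}" "\<rho> (\<sigma> (i + 1)) < \<rho> (\<sigma> i)" for i
            using that unfolding D_def by blast
          then have "?v \<sigma> < ?v \<tau>"
            using \<open>\<tau> \<noteq> \<sigma>\<close> by (rule inversions_descent_flag[OF fin \<sigma> \<tau>O \<rho>])
          then show False using \<open>?v \<tau> \<le> ?v \<sigma>\<close> by simp
        qed
        then obtain i where i: "i \<in> D" "\<tau> ` {1..i} \<noteq> \<sigma> ` {1..i}" by blast
        then have "flag_monomial E (\<lambda>T. of_bool (T = \<sigma> ` {1..i})) \<tau> = 1"
          by (intro flag_monomial_other[OF \<sigma> \<tau>O]) (auto simp: D_def)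
        moreover have "finite D" by (simp add: D_def)
        ultimately have "(\<Prod>i\<in>D. flag_monomial E (\<lambda>T. of_bool (T = \<sigma> ` {1..i})) \<tau> - 1) = 0"
          using i(1) by (intro prod_zero) auto
        then show ?thesis by (simp add: c_def)
      qed
      have "plaur_span E (\<lambda>\<tau>. f \<tau> - c \<tau>)"
      proof (rule less.hyps[of "insert \<sigma> S"])
        show "card (orderings E - insert \<sigma> S) < card (orderings E - S)"
          using \<sigma>S finO by (intro psubset_card_mono) auto
        show "insert \<sigma> S \<subseteq> orderings E" using \<sigma> less.prems by blast
        show "?v \<tau> \<le> ?v \<upsilon>" if "\<tau> \<in> insert \<sigma> S" "\<upsilon> \<in> orderings E - insert \<sigma> S" for \<tau> \<upsilon>
          using that less.prems(2)[of \<tau> \<upsilon>] min[of \<upsilon>] by auto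
        show "f \<tau> - c \<tau> = 0" if "\<tau> \<in> insert \<sigma> S" for \<tau> using that c0 c\<sigma> less.prems(3) by auto
        show "piecewise_laurent E (\<lambda>\<tau>. f \<tau> - c \<tau>)"
          by (rule piecewise_laurent_add[OF less.prems(4)
                piecewise_laurent_uminus[OF plaur_span_piecewise_laurent[OF span]]]) simp
      qed
      from plaur_span_add[OF span this] show ?thesis by simp
    qed
  qed
  from this[of "{}" f] f show ?thesis by simp
qed

lemma PLaur_span: "finite E \<Longrightarrow> f \<in> PLaur E \<Longrightarrow> plaur_span E f"
  by (rule piecewise_laurent_span) (auto simp: PLaur_def piecewise_laurent_def)

section \<open>The duality\<close>

definition pairing :: "('a \<Rightarrow>\<^sub>0 int) \<Rightarrow> ('a \<Rightarrow> real) \<Rightarrow> real" where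
  "pairing m b = (\<Sum>i\<in>keys m. of_int (lookup m i) * b i)"

lemma laurent_exp_pairing:
  "laurent_exp p b = (\<Sum>m\<in>keys p. of_int (lookup p m) * exp (pairing m b))"
  by (simp add: laurent_exp_def pairing_def)

lemma pairing_superset:
  assumes "finite A" "keys m \<subseteq> A"
  shows "pairing m b = (\<Sum>i\<in>A. of_int (lookup m i) * b i)"
  unfolding pairing_def using assms by (intro sum.mono_neutral_left) (auto simp: in_keys_iff)

lemma pairing_add: "pairing (m + k) b = pairing m b + pairing k b"
proof -
  let ?A = "keys m \<union> keys k"
  have "pairing l b = (\<Sum>i\<in>?A. of_int (lookup l i) * b i)"
    if "keys l \<subseteq> ?A" for l
    using that by (intro pairing_superset) auto
  then show ?thesis
    using Poly_Mapping.keys_add[of m k] by (simp add: lookup_add algebra_simps sum.distrib)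
qed

lemma pairing_zero: "pairing 0 b = 0"
  by (simp add: pairing_def)

lemma pairing_single: "pairing (single i c) b = of_int c * b i"
  using pairing_superset[of "{i}" "single i c" b] by simp

lemma pairing_sum: "pairing (sum m I) b = (\<Sum>i\<in>I. pairing (m i) b)"
  by (induction I rule: infinite_finite_induct) (auto simp: pairing_zero pairing_add)

lemma pairing_uminus: "pairing (- m) b = - pairing m b"
  using pairing_add[of m "- m" b] by (simp add: pairing_zero)

lemma pairing_minus_right: "pairing m (\<lambda>i. - b i) = - pairing m b"
  by (simp add: pairing_def sum_negf)

lemma laurent_exp_superset:
  assumes "finite A" "keys p \<subseteq> A"
  shows "laurent_exp p b = (\<Sum>m\<in>A. of_int (lookup p m) * exp (pairing m b))"
  unfolding laurent_exp_pairing using assms by (intro sum.mono_neutral_left) (auto simp: in_keys_iff)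

lemma laurent_exp_add: "laurent_exp (p + q) b = laurent_exp p b + laurent_exp q b"
proof -
  let ?A = "keys p \<union> keys q"
  have "laurent_exp r b = (\<Sum>m\<in>?A. of_int (lookup r m) * exp (pairing m b))"
    if "keys r \<subseteq> ?A" for r
    using that by (intro laurent_exp_superset) auto
  then show ?thesis
    using Poly_Mapping.keys_add[of p q] by (simp add: lookup_add algebra_simps sum.distrib)
qed

lemma laurent_exp_zero: "laurent_exp 0 b = 0"
  by (simp add: laurent_exp_def)

lemma laurent_exp_single: "laurent_exp (single m c) b = of_int c * exp (pairing m b)"
  using laurent_exp_superset[of "{m}" "single m c" b] by simp

lemma laurent_exp_sum: "laurent_exp (sum p I) b = (\<Sum>i\<in>I. laurent_exp (p i) b)"
  by (induction I rule: infinite_finite_induct) (auto simp: laurent_exp_zero laurent_exp_add)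

lemma laurent_exp_diff: "laurent_exp (p - q) b = laurent_exp p b - laurent_exp q b"
  using laurent_exp_add[of "p - q" q b] by simp

lemma laurent_exp_mult: "laurent_exp (p * q) b = laurent_exp p b * laurent_exp q b"
proof -
  let ?s = "\<lambda>p. \<Sum>m\<in>keys p. single m (lookup p m)"
  have "p = ?s p" "q = ?s q" by (auto intro: single_sum_expand)
  then have "laurent_exp (p * q) b = laurent_exp (?s p * ?s q) b" by simp
  also have "\<dots> = (\<Sum>m\<in>keys p. \<Sum>k\<in>keys q.
      of_int (lookup p m * lookup q k) * exp (pairing (m + k) b))"
    by (simp add: sum_product laurent_exp_sum mult_single laurent_exp_single)
  also have "\<dots> = laurent_exp p b * laurent_exp q b"
    unfolding laurent_exp_pairing sum_product by (simp add: pairing_add exp_add mult_ac)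
  finally show ?thesis .
qed

lemma laurent_exp_one: "laurent_exp 1 b = 1"
  using laurent_exp_single[of 0 1 b] by (simp add: pairing_zero)

lemma laurent_exp_prod: "laurent_exp (prod p I) b = (\<Prod>i\<in>I. laurent_exp (p i) b)"
  by (induction I rule: infinite_finite_induct) (auto simp: laurent_exp_one laurent_exp_mult)

lemma laurent_exp_xpow: "laurent_exp (xpow i k) b = exp (of_int k * b i)"
  by (simp add: xpow_def laurent_exp_single pairing_single)

lemma inj_uminus: "inj (uminus :: 'b::group_add \<Rightarrow> 'b)"
  by (rule injI) simp

lemma laurent_exp_dual: "laurent_exp (Poly_Mapping.map_key uminus p) (\<lambda>i. - b i) = laurent_exp p b"
proof -
  have "keys (Poly_Mapping.map_key uminus p) = uminus ` keys p"
    by (auto simp: keys_map_key[OF inj_uminus] image_iff) (metis minus_minus)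
  then have "laurent_exp (Poly_Mapping.map_key uminus p) (\<lambda>i. - b i) =
      (\<Sum>m\<in>uminus ` keys p. of_int (lookup p (- m)) * exp (- pairing m b))"
    by (simp add: laurent_exp_pairing map_key.rep_eq[OF inj_uminus] pairing_minus_right)
  also have "\<dots> = laurent_exp p b"
    by (simp add: sum.reindex inj_on_def laurent_exp_pairing pairing_uminus)
  finally show ?thesis .
qed

lemma laurent_exp_flag_monomial:
  "laurent_exp (flag_monomial E a \<sigma>) b =
    exp (\<Sum>k\<in>{1..card E}. of_int (a (\<sigma> ` {1..k}) - a (\<sigma> ` {1..k - 1})) * b (\<sigma> k))"
  by (simp add: flag_monomial_def laurent_exp_single flag_exponent_def pairing_sum pairing_single)

lemma dual_flag_monomial:
  "Poly_Mapping.map_key uminus (flag_monomial E a \<sigma>) = flag_monomial E (\<lambda>T. - a T) \<sigma>"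
proof -
  have "flag_exponent E a \<sigma> = - flag_exponent E (\<lambda>T. - a T) \<sigma>"
    by (rule poly_mapping_eqI)
      (simp add: flag_exponent_def lookup_sum lookup_uminus lookup_single when_def sum_negf[symmetric]
        if_distrib[of uminus] cong: if_cong)
  then show ?thesis
    unfolding flag_monomial_def by (metis map_key_single inj_uminus)
qed

lemma plaur_span_dual:
  assumes "plaur_span E f"
  shows "plaur_span E (plaur_dual E f)"
proof -
  let ?d = "Poly_Mapping.map_key (uminus :: ('a \<Rightarrow>\<^sub>0 int) \<Rightarrow> _)"
  have add: "?d (p + q) = ?d p + ?d q" for p q :: "'a laurent" by (rule map_key_plus[OF inj_uminus])
  have diff: "?d (p - q) = ?d p - ?d q" for p q :: "'a laurent" using add[of "p - q" q] by simp
  have zero: "?d 0 = (0 :: 'a laurent)" using diff[of 0 0] by simp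
  from assms have "plaur_span E (\<lambda>\<sigma>. ?d (f \<sigma>))"
  proof (induction rule: plaur_span.induct)
    case (zero f)
    then show ?case using \<open>?d 0 = 0\<close> by (intro plaur_span.zero) simp
  next
    case (add f a g)
    then show ?case using \<open>\<And>p q. ?d (p + q) = ?d p + ?d q\<close>
      by (intro plaur_span.add[where a = "\<lambda>T. - a T", OF add.IH]) (simp_all add: dual_flag_monomial)
  next
    case (sub f a g)
    then show ?case
      by (intro plaur_span.sub[where a = "\<lambda>T. - a T", OF sub.IH]) (simp_all add: diff dual_flag_monomial)
  qed
  then show ?thesis by (rule plaur_span_cong) (simp add: plaur_dual_def)
qed

text \<open>Agreement on common faces is inherited from the spanning monomials: on the cone of
  \<open>\<sigma>\<close> each evaluates to \<open>exp (pl_comb E a b)\<close>, an expression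
  without \<open>\<sigma>\<close>.\<close>

lemma laurent_exp_well_defined:
  assumes "plaur_span E f" "finite E" "E \<noteq> {}"
  shows "\<exists>g. \<forall>\<sigma>\<in>orderings E. \<forall>b\<in>max_cone E \<sigma>. laurent_exp (f \<sigma>) b = g b"
  using assms(1)
proof (induction rule: plaur_span.induct)
  case (zero f)
  then show ?case by (intro exI[of _ "\<lambda>_. 0"]) (simp add: laurent_exp_zero)
next
  case (add f a h)
  then obtain g where "\<forall>\<sigma>\<in>orderings E. \<forall>b\<in>max_cone E \<sigma>. laurent_exp (f \<sigma>) b = g b" by blast
  then show ?case using add.hyps
    by (intro exI[of _ "\<lambda>b. g b + exp (pl_comb E a b)"])
      (simp add: laurent_exp_add laurent_exp_flag_monomial pl_comb_max_cone assms)
next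
  case (sub f a h)
  then obtain g where "\<forall>\<sigma>\<in>orderings E. \<forall>b\<in>max_cone E \<sigma>. laurent_exp (f \<sigma>) b = g b" by blast
  then show ?case using sub.hyps
    by (intro exI[of _ "\<lambda>b. g b - exp (pl_comb E a b)"])
      (simp add: laurent_exp_diff laurent_exp_flag_monomial pl_comb_max_cone assms)
qed

lemma plaur_exp_eq:
  assumes "plaur_span E f" "finite E" "E \<noteq> {}" "\<sigma> \<in> orderings E" "b \<in> max_cone E \<sigma>"
  shows "plaur_exp E f b = laurent_exp (f \<sigma>) b"
proof -
  obtain g where g: "\<forall>\<sigma>\<in>orderings E. \<forall>b\<in>max_cone E \<sigma>. laurent_exp (f \<sigma>) b = g b"
    using laurent_exp_well_defined[OF assms(1-3)] by blast
  show ?thesis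
    unfolding plaur_exp_def using g assms(4,5) by (intro the_equality) auto
qed

lemma eqI_max_cone:
  assumes "finite E" "b \<in> RE E"
    and "\<And>\<sigma>. \<sigma> \<in> orderings E \<Longrightarrow> b \<in> max_cone E \<sigma> \<Longrightarrow> u = v"
  shows "u = v"
  using max_cone_exists[OF assms(1,2)] assms(3) by metis

section \<open>Localization sums indexed by orderings\<close>

lemma wt_list_of:
  "wt a {} y (map \<sigma> [1..<Suc m]) =
    exp (\<Sum>k\<in>{1..m}. of_int (a (\<sigma> ` {1..k}) - a (\<sigma> ` {1..k - 1})) * y (\<sigma> k))"
proof (induction m)
  case (Suc m)
  have "set (map \<sigma> [1..<Suc m]) = \<sigma> ` {1..m}"
    by (simp only: set_map set_upt atLeastLessThanSuc_atLeastAtMost)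
  moreover have "insert (\<sigma> (Suc m)) (\<sigma> ` {1..m}) = \<sigma> ` {1..Suc m}"
    by (simp add: atLeastAtMostSuc_conv)
  moreover have "map \<sigma> [1..<Suc (Suc m)] = map \<sigma> [1..<Suc m] @ [\<sigma> (Suc m)]" by simp
  ultimately show ?case using Suc
    by (simp only: wt_append wt.simps Un_empty_left) (simp add: exp_add)
qed simp

lemma num_list_of:
  "num r {} y (map \<sigma> [1..<Suc m]) =
    (\<Prod>k\<in>{1..m}. if r (\<sigma> ` {1..k - 1}) < r (\<sigma> ` {1..k}) then 1 else 1 - exp (y (\<sigma> k)))"
proof (induction m)
  case (Suc m)
  have "set (map \<sigma> [1..<Suc m]) = \<sigma> ` {1..m}"
    by (simp only: set_map set_upt atLeastLessThanSuc_atLeastAtMost)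
  moreover have "insert (\<sigma> (Suc m)) (\<sigma> ` {1..m}) = \<sigma> ` {1..Suc m}"
    by (simp add: atLeastAtMostSuc_conv)
  moreover have "map \<sigma> [1..<Suc (Suc m)] = map \<sigma> [1..<Suc m] @ [\<sigma> (Suc m)]" by simp
  ultimately show ?case using Suc
    by (simp only: num_append num.simps Un_empty_left) simp
qed simp

lemma num_greedy_basis:
  assumes \<sigma>: "\<sigma> \<in> orderings (ground M)" and fin: "finite (ground M)"
  shows "num (rk M) {} y (list_of (ground M) \<sigma>) =
    (\<Prod>i\<in>ground M - greedy_basis M \<sigma>. 1 - exp (y i))"
proof -
  let ?E = "ground M" and ?B = "greedy_basis M \<sigma>"
  have "num (rk M) {} y (list_of ?E \<sigma>) =
      (\<Prod>k\<in>{1..card ?E}. if \<sigma> k \<in> ?B then 1 else 1 - exp (y (\<sigma> k)))"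
    unfolding list_of_def num_list_of using in_greedy_basis_iff[OF \<sigma>] by (intro prod.cong) auto
  also have "\<dots> = (\<Prod>i\<in>?E. if i \<in> ?B then 1 else 1 - exp (y i))"
    using \<sigma> by (intro prod.reindex_bij_betw) (simp add: orderings_def)
  also have "\<dots> = (\<Prod>i\<in>?E - ?B. 1 - exp (y i))"
    using fin by (intro prod.mono_neutral_cong_right) auto
  finally show ?thesis .
qed

text \<open>Along the prefixes the rank climbs from 0 to the full rank in steps of at most 1, so the
  number of jumps is the rank.\<close>

lemma card_greedy_basis:
  assumes M: "is_matroid M" and \<sigma>: "\<sigma> \<in> orderings (ground M)"
  shows "card (greedy_basis M \<sigma>) = rk M (ground M)"
proof -
  let ?E = "ground M"
  let ?J = "\<lambda>m. {k \<in> {1..m}. rk M (\<sigma> ` {1..k - 1}) < rk M (\<sigma> ` {1..k})}"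
  have "card (?J m) = rk M (\<sigma> ` {1..m})" if "m \<le> card ?E" for m
    using that
  proof (induction m)
    case 0
    then show ?case using matroid_rk_empty[OF M] by simp
  next
    case (Suc m)
    have "\<sigma> ` {1..Suc m} = insert (\<sigma> (Suc m)) (\<sigma> ` {1..m})"
      by (simp add: atLeastAtMostSuc_conv)
    moreover have "\<sigma> ` {1..m} \<subseteq> ?E" "\<sigma> (Suc m) \<in> ?E"
      using orderings_prefix[OF \<sigma>, of m] orderings_in[OF \<sigma>, of "Suc m"] Suc.prems by auto
    ultimately have r: "rk M (\<sigma> ` {1..m}) \<le> rk M (\<sigma> ` {1..Suc m})"
      "rk M (\<sigma> ` {1..Suc m}) \<le> rk M (\<sigma> ` {1..m}) + 1"
      using is_matroid_rk_insert[OF M] by metis+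
    have "?J (Suc m) = (if rk M (\<sigma> ` {1..m}) < rk M (\<sigma> ` {1..Suc m}) then insert (Suc m) (?J m) else ?J m)"
      by (auto simp: le_Suc_eq)
    then show ?case using Suc r by auto
  qed
  from this[of "card ?E"] have "card (?J (card ?E)) = rk M ?E" using orderings_image[OF \<sigma>] by simp
  moreover have "greedy_basis M \<sigma> = \<sigma> ` ?J (card ?E)" unfolding greedy_basis_def by auto
  moreover have "inj_on \<sigma> (?J (card ?E))" by (rule inj_on_subset[OF orderings_inj[OF \<sigma>]]) auto
  ultimately show ?thesis by (simp add: card_image)
qed

text \<open>Each factor satisfies \<open>1 - 1/z = - (1/z) * (1 - z)\<close> with \<open>z\<close>
  the ratio of consecutive variables, and the product of the \<open>1/z\<close> telescopes to the
  quotient of the first variable by the last.\<close>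

lemma den_uminus:
  "xs \<noteq> [] \<Longrightarrow>
    den (\<lambda>i. - y i) xs = (-1) ^ (length xs - 1) * exp (y (hd xs) - y (last xs)) * den y xs"
proof (induction y xs rule: den.induct)
  case (3 y a b xs)
  have "1 - exp (- y b - - y a) = - exp (y a - y b) * (1 - exp (y b - y a))"
    by (simp add: algebra_simps flip: exp_add)
  then show ?case using 3 by (simp add: exp_diff)
qed auto

definition plaur_locsum :: "'a matroid \<Rightarrow> ((nat \<Rightarrow> 'a) \<Rightarrow> 'a laurent) \<Rightarrow> ('a \<Rightarrow> real) \<Rightarrow> real" where
  "plaur_locsum M f y = (\<Sum>\<sigma>\<in>orderings (ground M). laurent_exp (f \<sigma>) y *
     num (rk M) {} y (list_of (ground M) \<sigma>) / den y (list_of (ground M) \<sigma>))"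

lemma plaur_locsum_flag_monomial:
  assumes "finite (ground M)"
  shows "plaur_locsum M (flag_monomial (ground M) a) y = locsum (rk M) a {} (ground M) y"
proof -
  let ?l = "list_of (ground M)"
  have "plaur_locsum M (flag_monomial (ground M) a) y =
      (\<Sum>\<sigma>\<in>orderings (ground M). wt a {} y (?l \<sigma>) * num (rk M) {} y (?l \<sigma>) / den y (?l \<sigma>))"
    unfolding plaur_locsum_def laurent_exp_flag_monomial wt_list_of[symmetric] list_of_def ..
  also have "\<dots> = locsum (rk M) a {} (ground M) y"
    unfolding locsum_def by (rule sum.reindex_bij_betw[OF list_of_bij[OF assms]])
  finally show ?thesis .
qed

text \<open>This holds summand by summand. Inverting the variables splits \<open>(-1)^(n-r)\<close>
  and the inverse variables outside the greedy basis off \<open>num\<close>, and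
  \<open>(-1)^(n-1)\<close> and the quotient of the first variable by the last off
  \<open>den\<close>. The monomials make up \<open>omega M\<close>, the signs
  \<open>(-1)^(r-1)\<close>.\<close>

lemma plaur_locsum_dual:
  assumes M: "is_matroid M" and ne: "ground M \<noteq> {}" and r: "rk M (ground M) \<noteq> 0"
  shows "plaur_locsum M (plaur_dual (ground M) f) (\<lambda>i. - y i) =
    (-1) ^ (rk M (ground M) - 1) * plaur_locsum M (\<lambda>\<sigma>. f \<sigma> * omega M \<sigma>) y"
  unfolding plaur_locsum_def sum_distrib_left
proof (rule sum.cong[OF refl])
  let ?E = "ground M" and ?r = "rk M (ground M)"
  fix \<sigma> assume \<sigma>: "\<sigma> \<in> orderings ?E"
  let ?B = "greedy_basis M \<sigma>" and ?l = "list_of ?E \<sigma>" and ?n = "card ?E"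
  have fin: "finite ?E" using M by (rule matroid_finite)
  have n: "?n \<ge> 1" using fin ne by (simp add: Suc_le_eq card_gt_0_iff)
  have BE: "?B \<subseteq> ?E" unfolding greedy_basis_def using orderings_in[OF \<sigma>] by auto
  then have cardEB: "card (?E - ?B) = ?n - ?r"
    using card_greedy_basis[OF M \<sigma>] finite_subset[OF BE fin] by (simp add: card_Diff_subset)
  have rn: "?r \<le> ?n" using matroid_rk_le_card[OF M, of ?E] by simp
  define N where "N = num (rk M) {} y ?l"
  define W where "W = (\<Prod>i\<in>?E - ?B. exp (- y i))"
  have num: "num (rk M) {} (\<lambda>i. - y i) ?l = (-1) ^ (?n - ?r) * W * N"
  proof -
    have "num (rk M) {} (\<lambda>i. - y i) ?l = (\<Prod>i\<in>?E - ?B. (-1) * exp (- y i) * (1 - exp (y i)))"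
      unfolding num_greedy_basis[OF \<sigma> fin]
      by (intro prod.cong refl) (simp add: algebra_simps flip: exp_add)
    then show ?thesis
      unfolding N_def W_def num_greedy_basis[OF \<sigma> fin] prod.distrib by (simp add: cardEB)
  qed
  have l: "?l \<noteq> []" "length ?l = ?n" "hd ?l = \<sigma> 1" "last ?l = \<sigma> ?n"
    using n by (auto simp: list_of_def hd_map last_map simp del: upt_Suc)
  have den: "den (\<lambda>i. - y i) ?l = (-1) ^ (?n - 1) * exp (y (\<sigma> 1) - y (\<sigma> ?n)) * den y ?l"
    using den_uminus[OF l(1), of y] l by simp
  have dual: "laurent_exp (plaur_dual ?E f \<sigma>) (\<lambda>i. - y i) = laurent_exp (f \<sigma>) y"
    using \<sigma> by (simp add: plaur_dual_def laurent_exp_dual)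
  have om: "laurent_exp (omega M \<sigma>) y = exp (y (\<sigma> ?n) - y (\<sigma> 1)) * W"
    using \<sigma> by (simp add: omega_def laurent_exp_mult laurent_exp_prod laurent_exp_xpow W_def
        exp_diff exp_minus field_simps)
  \<comment> \<open>All subtractions are truncated; \<open>1 \<le> ?r\<close> and
    \<open>?r \<le> ?n\<close> justify \<open>(n-1) + (r-1) = (n-r) + 2 * (r-1)\<close>, whose last
    term is even.\<close>
  have sign: "(-1) ^ (?n - ?r) = (-1) ^ (?n - 1) * ((-1) ^ (?r - 1) :: real)"
  proof -
    have "(?n - 1) + (?r - 1) = (?n - ?r) + 2 * (?r - 1)" using rn r by simp
    from arg_cong[OF this, of "\<lambda>k. (-1 :: real) ^ k"] show ?thesis
      unfolding power_add power_mult by simp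
  qed
  have e: "exp (y (\<sigma> ?n) - y (\<sigma> 1)) = 1 / exp (y (\<sigma> 1) - y (\<sigma> ?n))"
    by (simp add: exp_diff)
  show "laurent_exp (plaur_dual ?E f \<sigma>) (\<lambda>i. - y i) * num (rk M) {} (\<lambda>i. - y i) ?l /
      den (\<lambda>i. - y i) ?l =
    (-1) ^ (?r - 1) * (laurent_exp (f \<sigma> * omega M \<sigma>) y * num (rk M) {} y ?l / den y ?l)"
    unfolding dual num den laurent_exp_mult om sign N_def[symmetric] e
    by (simp add: field_simps)
qed

text \<open>By additivity it suffices to treat monomials, where \<open>locsum_tendsto\<close>
  applies. Membership in \<open>PExp\<close> is carried along in the induction because additivity of
  \<open>chi\<close> is given on the carrier of \<open>K_ring M\<close>.\<close>

lemma plaur_span_limit: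
  assumes chi: "matroid_euler_characteristics chi"
    and M: "is_matroid M" "loopless M" "ground M \<noteq> {}" and w: "inj_on w (ground M)"
    and f: "plaur_span (ground M) f"
  shows "pexp M (plaur_exp (ground M) f)"
    and "((\<lambda>t. plaur_locsum M f (\<lambda>i. t * w i)) \<longlongrightarrow> of_int (chi M (phi M f))) (at 0)"
proof -
  let ?E = "ground M"
  have fin: "finite ?E" using M by (simp add: matroid_finite)
  have addchi: "chi M (K_class M (\<lambda>b. g b + h b)) = chi M (K_class M g) + chi M (K_class M h)"
    if "pexp M g" "pexp M h" for g h
  proof -
    have "\<forall>u\<in>carrier (K_ring M). \<forall>v\<in>carrier (K_ring M).
        chi M (u \<oplus>\<^bsub>K_ring M\<^esub> v) = chi M u + chi M v"
      using chi M unfolding matroid_euler_characteristics_def by blast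
    then show ?thesis unfolding K_class_add[OF that] using K_class_carrier that by blast
  qed
  have pe: "pexp M (\<lambda>b. exp (pl_comb ?E a b))" for a
    using M fin by (intro PLin_pexp pl_comb_PLin)
  have support: "pexp M g" "K_class M g = K_class M h" if "pexp M h" "\<And>b. b \<in> RE ?E \<Longrightarrow> g b = h b" for g h
  proof -
    have eq: "\<And>b. b \<in> fan_support M \<Longrightarrow> g b = h b" using that(2) fan_support_RE[OF M(1)] by blast
    then show "K_class M g = K_class M h" by (rule K_class_cong)
    from eq have "restrict g (fan_support M) = restrict h (fan_support M)" by (rule restrict_ext)
    then show "pexp M g" using that(1) by (simp add: pexp_def)
  qed
  have lim: "((\<lambda>t. plaur_locsum M (flag_monomial ?E a) (\<lambda>i. t * w i)) \<longlongrightarrow>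
      of_int (chi M (K_class M (\<lambda>b. exp (pl_comb ?E a b))))) (at 0)" if "a {} = 0" for a
    using locsum_tendsto[OF chi M(1,3) w, of a] that M(2)
    by (simp add: plaur_locsum_flag_monomial[OF fin] euler_def psi_def)
  have at_cone: "plaur_exp ?E g b = laurent_exp (g \<sigma>) b"
    if "plaur_span ?E g" "\<sigma> \<in> orderings ?E" "b \<in> max_cone ?E \<sigma>" for g \<sigma> b
    by (rule plaur_exp_eq[OF that(1) fin M(3) that(2,3)])
  have at_cone_monomial: "exp (pl_comb ?E a b) = laurent_exp (flag_monomial ?E a \<sigma>) b"
    if "a {} = 0" "\<sigma> \<in> orderings ?E" "b \<in> max_cone ?E \<sigma>" for a \<sigma> b
    using that fin M by (simp add: laurent_exp_flag_monomial pl_comb_max_cone)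
  from f have "pexp M (plaur_exp ?E f) \<and>
    ((\<lambda>t. plaur_locsum M f (\<lambda>i. t * w i)) \<longlongrightarrow> of_int (chi M (phi M f))) (at 0)"
  proof (induction rule: plaur_span.induct)
    case (zero f)
    have z: "pexp M (\<lambda>_. 0)" unfolding pexp_iff using exp_sum_zero by blast
    have eq: "plaur_exp ?E f b = 0" if "b \<in> RE ?E" for b
    proof (rule eqI_max_cone[OF fin that])
      fix \<sigma> assume "\<sigma> \<in> orderings ?E" "b \<in> max_cone ?E \<sigma>"
      then show "plaur_exp ?E f b = 0"
        using at_cone[OF plaur_span.zero[OF zero]] zero by (simp add: laurent_exp_zero)
    qed
    have "chi M (K_class M (\<lambda>_. 0)) = 0" using addchi[OF z z] by simp
    moreover have "K_class M (plaur_exp ?E f) = K_class M (\<lambda>_. 0)"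
      by (rule support(2)[OF z]) (rule eq)
    ultimately have "chi M (phi M f) = 0" unfolding phi_def by simp
    moreover have "plaur_locsum M f y = 0" for y
      unfolding plaur_locsum_def using zero by (simp add: laurent_exp_zero)
    moreover have "pexp M (plaur_exp ?E f)" by (rule support(1)[OF z]) (rule eq)
    ultimately show ?case by simp
  next
    case (add f a g)
    let ?e = "\<lambda>b. exp (pl_comb ?E a b)"
    have "plaur_span ?E g" by (rule plaur_span.add[where f = f and a = a]) (fact add.hyps)+
    have eq: "plaur_exp ?E g b = plaur_exp ?E f b + ?e b" if "b \<in> RE ?E" for b
    proof (rule eqI_max_cone[OF fin that])
      fix \<sigma> assume "\<sigma> \<in> orderings ?E" "b \<in> max_cone ?E \<sigma>"
      then show "plaur_exp ?E g b = plaur_exp ?E f b + ?e b"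
        using at_cone \<open>plaur_span ?E g\<close> add.hyps at_cone_monomial[of a] by (simp add: laurent_exp_add)
    qed
    have s: "pexp M (\<lambda>b. plaur_exp ?E f b + ?e b)" using add.IH pe by (intro pexp_add) auto
    have g: "pexp M (plaur_exp ?E g)" by (rule support(1)[OF s]) (rule eq)
    have "K_class M (plaur_exp ?E g) = K_class M (\<lambda>b. plaur_exp ?E f b + ?e b)"
      by (rule support(2)[OF s]) (rule eq)
    then have c: "chi M (phi M g) = chi M (phi M f) + chi M (K_class M ?e)"
      unfolding phi_def using addchi[OF conjunct1[OF add.IH] pe] by simp
    have "plaur_locsum M g y = plaur_locsum M f y + plaur_locsum M (flag_monomial ?E a) y" for y
      unfolding plaur_locsum_def using add.hyps(3)
      by (simp add: laurent_exp_add sum.distrib distrib_right add_divide_distrib)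
    then show ?case
      using g tendsto_add[OF conjunct2[OF add.IH] lim[of a, OF add.hyps(2)]] c by simp
  next
    case (sub f a g)
    let ?e = "\<lambda>b. exp (pl_comb ?E a b)"
    have "plaur_span ?E g" by (rule plaur_span.sub[where f = f and a = a]) (fact sub.hyps)+
    have eq: "plaur_exp ?E g b = plaur_exp ?E f b + - ?e b" if "b \<in> RE ?E" for b
    proof (rule eqI_max_cone[OF fin that])
      fix \<sigma> assume "\<sigma> \<in> orderings ?E" "b \<in> max_cone ?E \<sigma>"
      then show "plaur_exp ?E g b = plaur_exp ?E f b + - ?e b"
        using at_cone \<open>plaur_span ?E g\<close> sub.hyps at_cone_monomial[of a] by (simp add: laurent_exp_diff)
    qed
    have "pexp M (\<lambda>b. - ?e b)"
      using pe[of a] unfolding pexp_iff by (intro ballI exp_sum_uminus) (rule bspec)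
    then have s: "pexp M (\<lambda>b. plaur_exp ?E f b + - ?e b)" using sub.IH by (intro pexp_add) auto
    have g: "pexp M (plaur_exp ?E g)" by (rule support(1)[OF s]) (rule eq)
    \<comment> \<open>\<open>chi\<close> is known to respect sums, so the difference is treated as
      the sum \<open>f = g + x^a\<close>.\<close>
    have "chi M (K_class M (plaur_exp ?E f)) = chi M (K_class M (\<lambda>b. plaur_exp ?E g b + ?e b))"
      by (rule arg_cong[of _ _ "chi M"], rule support(2)[OF pexp_add[OF g pe]]) (simp add: eq)
    also have "\<dots> = chi M (K_class M (plaur_exp ?E g)) + chi M (K_class M ?e)"
      by (rule addchi[OF g pe])
    finally have c: "chi M (phi M g) = chi M (phi M f) - chi M (K_class M ?e)"
      unfolding phi_def by simp
    have "plaur_locsum M g y = plaur_locsum M f y - plaur_locsum M (flag_monomial ?E a) y" for y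
      unfolding plaur_locsum_def using sub.hyps(3)
      by (simp add: laurent_exp_diff sum_subtractf left_diff_distrib diff_divide_distrib)
    then show ?case
      using g tendsto_diff[OF conjunct2[OF sub.IH] lim[of a, OF sub.hyps(2)]] c by simp
  qed
  then show "pexp M (plaur_exp ?E f)"
    "((\<lambda>t. plaur_locsum M f (\<lambda>i. t * w i)) \<longlongrightarrow> of_int (chi M (phi M f))) (at 0)" by auto
qed

lemma phi_mult:
  assumes M: "is_matroid M" "ground M \<noteq> {}"
    and f: "plaur_span (ground M) f" "pexp M (plaur_exp (ground M) f)"
    and g: "plaur_span (ground M) g" "pexp M (plaur_exp (ground M) g)"
  shows "phi M (\<lambda>\<sigma>. f \<sigma> * g \<sigma>) = phi M f \<otimes>\<^bsub>K_ring M\<^esub> phi M g"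
proof -
  let ?E = "ground M"
  have fin: "finite ?E" using M by (simp add: matroid_finite)
  have "K_class M (plaur_exp ?E (\<lambda>\<sigma>. f \<sigma> * g \<sigma>)) =
      K_class M (\<lambda>b. plaur_exp ?E f b * plaur_exp ?E g b)"
  proof (rule K_class_cong)
    fix b assume "b \<in> fan_support M"
    then have b: "b \<in> RE ?E" by (rule fan_support_RE[OF M(1)])
    show "plaur_exp ?E (\<lambda>\<sigma>. f \<sigma> * g \<sigma>) b = plaur_exp ?E f b * plaur_exp ?E g b"
    proof (rule eqI_max_cone[OF fin b])
      fix \<sigma> assume \<sigma>: "\<sigma> \<in> orderings ?E" "b \<in> max_cone ?E \<sigma>"
      show "plaur_exp ?E (\<lambda>\<sigma>. f \<sigma> * g \<sigma>) b = plaur_exp ?E f b * plaur_exp ?E g b"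
        using plaur_exp_eq[OF f(1) fin M(2) \<sigma>] plaur_exp_eq[OF g(1) fin M(2) \<sigma>]
          plaur_exp_eq[OF plaur_span_mult[OF g(1) f(1)] fin M(2) \<sigma>] by (simp add: laurent_exp_mult)
    qed
  qed
  then show ?thesis unfolding phi_def using K_class_mult[OF f(2) g(2)] by simp
qed

theorem corollary5p2:
  fixes M :: "'a matroid"
    and chi :: "'a matroid \<Rightarrow> (('a \<Rightarrow> real) \<Rightarrow> real) set \<Rightarrow> int"
    and f :: "(nat \<Rightarrow> 'a) \<Rightarrow> 'a laurent"
  assumes "is_matroid M" and "loopless M" and "ground M \<noteq> {}"
    and "matroid_euler_characteristics chi"
    and "f \<in> PLaur (ground M)"
  shows "chi M (phi M (plaur_dual (ground M) f)) =
    (-1) ^ (rk M (ground M) - 1) * chi M (phi M f \<otimes>\<^bsub>K_ring M\<^esub> phi M (omega M))"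
proof -
  let ?E = "ground M" and ?g = "\<lambda>\<sigma>. f \<sigma> * omega M \<sigma>"
  have fin: "finite ?E" using assms(1) by (rule matroid_finite)
  obtain h :: "'a \<Rightarrow> nat" where h: "inj_on h ?E" using finite_imp_inj_to_nat_seg[OF fin] by blast
  \<comment> \<open>Distinct coordinates keep all denominators nonzero for
    \<open>t \<noteq> 0\<close>; they are taken from a numbering of the ground set.\<close>
  define w where "w i = real (h i)" for i
  have w: "inj_on w ?E" using h by (auto simp: w_def inj_on_def)
  have f: "plaur_span ?E f" by (rule PLaur_span[OF fin assms(5)])
  have om: "plaur_span ?E (omega M)" by (rule PLaur_span[OF fin omega_in_PLaur[OF assms(1,3)]])
  note limit = plaur_span_limit[OF assms(4,1-3) w]
  obtain e where e: "e \<in> ?E" using assms(3) by blast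
  then have "0 < rk M {e}" using assms(2) by (simp add: loopless_def)
  also have "\<dots> \<le> rk M ?E" using e by (intro matroid_rk_mono[OF assms(1)]) auto
  finally have r: "rk M ?E \<noteq> 0" by simp
  \<comment> \<open>The limit for the dual of \<open>f\<close> is read along \<open>- t\<close>,
    where \<open>plaur_locsum_dual\<close> turns the sum into a sign times the sum for
    \<open>?g\<close> along \<open>t\<close>.\<close>
  have "filterlim (\<lambda>t::real. - t) (at 0) (at 0)"
    by (rule filterlim_atI) (auto intro!: tendsto_eq_intros simp: eventually_at_filter)
  from filterlim_compose[OF limit(2)[OF plaur_span_dual[OF f]] this]
  have "((\<lambda>t. plaur_locsum M (plaur_dual ?E f) (\<lambda>i. - (t * w i))) \<longlongrightarrow>
      of_int (chi M (phi M (plaur_dual ?E f)))) (at 0)" by simp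
  moreover have "((\<lambda>t. plaur_locsum M (plaur_dual ?E f) (\<lambda>i. - (t * w i))) \<longlongrightarrow>
      (-1) ^ (rk M ?E - 1) * of_int (chi M (phi M ?g))) (at 0)"
    unfolding plaur_locsum_dual[OF assms(1,3) r]
    by (intro tendsto_mult tendsto_const limit(2) plaur_span_mult om f)
  ultimately have "real_of_int (chi M (phi M (plaur_dual ?E f))) =
      (-1) ^ (rk M ?E - 1) * of_int (chi M (phi M ?g))"
    by (rule LIM_unique)
  then have "real_of_int (chi M (phi M (plaur_dual ?E f))) =
      of_int ((-1) ^ (rk M ?E - 1) * chi M (phi M ?g))" by simp
  then have "chi M (phi M (plaur_dual ?E f)) = (-1) ^ (rk M ?E - 1) * chi M (phi M ?g)"
    by (simp only: of_int_eq_iff)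
  also have "phi M ?g = phi M f \<otimes>\<^bsub>K_ring M\<^esub> phi M (omega M)"
    by (intro phi_mult assms(1,3) f om limit(1))
  finally show ?thesis .
qed

end
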